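(* Let $K\ge 1$, $N\ge 2K$ and $L\in\mathbb{N}$ with $K\le L\le N-K$. Let $z_1,\dots,z_K\in\mathbb{C}$ be non-zero, pairwise distinct nodes in the closed unit disk ($0<|z_k|\le 1$), let $\alpha_1,\dots,\alpha_K\in\mathbb{C}$ be weights with $\alpha_{\min}\triangleq\min_k|\alpha_k|>0$, and put $\alpha_{\max}\triangleq\max_k|\alpha_k|$. Let $\boldsymbol e=(e_0,\dots,e_{N-1})\in\mathbb{C}^N$ be an arbitrary (deterministic) noise vector, and let the measurements be $\widetilde x_n=x_n+e_n$, $n=0,\dots,N-1$, where $x_n=\sum_{k=1}^K\alpha_k z_k^n$. \textbf{Case 1 (ESPRIT).} Let $\widetilde{\mathbf X}=\mathscr H_L(\widetilde x_0,\dots,\widetilde x_{N-1})\in\mathbb{C}^{L\times(N-L+1)}$, and let $\widetilde{\mathbf S}\in\mathbb{C}^{L\times K}$ be the matrix whose columns are the left singular vectors of $\widetilde{\mathbf X}$ associated with its $K$ largest singular values in a singular value decomposition of $\widetilde{\mathbf X}$. Let $\widetilde{\mathbf S}_\downarrow$ (resp. $\widetilde{\mathbf S}_\uparrow$) be the $(L-1)\times K$ matrix formed by the first (resp. last) $L-1$ rows of $\widetilde{\mathbf S}$, let $\widetilde{\boldsymbol\Phi}=\widetilde{\mathbf S}_\downarrow^\dagger\widetilde{\mathbf S}_\uparrow\in\mathbb{C}^{K\times K}$ ($\dagger$ the Moore–Penrose pseudoinverse), and let $\widehat z_1,\dots,\widehat z_K$ be the eigenvalues of $\widetilde{\boldsymbol\Phi}$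 (with algebraic multiplicity). Assume that $\widetilde{\boldsymbol\Phi}$ is a solution of the linear system $\widetilde{\mathbf S}_\downarrow\mathbf Y=\widetilde{\mathbf S}_\uparrow$, and that \[\gamma\triangleq\frac{\sqrt{\min\{L,N-L+1\}}\,\|\boldsymbol e\|_2}{\alpha_{\min}\,\sigma_{\min}(\mathbf V_L)\,\sigma_{\min}(\mathbf V_{N-L+1})}<\frac{1}{1+\sqrt2\,\beta},\qquad \beta\triangleq\frac{\sigma_{\max}(\mathbf V_L)}{\sigma_{\min}(\mathbf V_{L-1})}.\] Then there is a permutation $\pi$ of $\{1,\dots,K\}$ such that for all $k=1,\dots,K$, \[|\widehat z_{\pi(k)}-z_k|\le\frac{(2K-1)\sqrt2\,\beta\gamma}{1-(1+\sqrt2\beta)\gamma}\bigl(1+\kappa(\mathbf V_L)\bigr)\kappa(\mathbf V_L).\] \textbf{Case 2 (Matrix Pencil).} Let $\widetilde{\mathbf X}_1=\mathscr H_L(\widetilde x_0,\dots,\widetilde x_{N-2})$ and $\widetilde{\mathbf X}_2=\mathscr H_L(\widetilde x_1,\dots,\widetilde x_{N-1})$, both in $\mathbb{C}^{L\times(N-L)}$. Take a singular value decomposition of $\widetilde{\mathbf X}_1$ and let $\widetilde{\mathbf S}_1\in\mathbb{C}^{L\times K}$ and $\widetilde{\mathbf R}_1\in\mathbb{C}^{(N-L)\times K}$ consist of the left, resp. right, singular vectors associated with the $K$ largest singular values of $\widetilde{\mathbf X}_1$. Define $\widetilde{\boldsymbol\Psi}_1=\widetilde{\mathbf S}_1^H\widetilde{\mathbf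 X}_1\widetilde{\mathbf R}_1$ and $\widetilde{\boldsymbol\Psi}_2=\widetilde{\mathbf S}_1^H\widetilde{\mathbf X}_2\widetilde{\mathbf R}_1$ in $\mathbb{C}^{K\times K}$. Assume the pair $(\widetilde{\boldsymbol\Psi}_1,\widetilde{\boldsymbol\Psi}_2)$ is regular, and let $\widehat z_1,\dots,\widehat z_K\in\mathbb{C}\cup\{\infty\}$ be its $K$ generalized eigenvalues (with algebraic multiplicity, including infinite ones). Assume \[\gamma\triangleq\frac{\sqrt{\min\{L,N-L\}}\,\|\boldsymbol e\|_2}{\alpha_{\min}\,\sigma_{\min}(\mathbf V_L)\,\sigma_{\min}(\mathbf V_{N-L})}<1.\] Then there is a permutation $\pi$ of $\{1,\dots,K\}$ such that for all $k=1,\dots,K$, \[\chi(\widehat z_{\pi(k)},z_k)\le\frac{(2K-1)\gamma}{\sqrt{1+A_{\min}^2}}\left[\frac{2\sqrt2}{1-\gamma}\frac{\alpha_{\max}}{\alpha_{\min}}\kappa(\mathbf V_L)\kappa(\mathbf V_{N-L})+\left(1+\frac{\sqrt2\gamma}{1-\gamma}\right)\right],\] where $A_{\min}\triangleq\min_{1\le k\le K}|z_k|$.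
   Context: For $M\ge K$, $\mathbf V_M\in\mathbb{C}^{M\times K}$ denotes the Vandermonde matrix with entries $(\mathbf V_M)_{\ell k}=z_k^{\ell-1}$, $\ell=1,\dots,M$, $k=1,\dots,K$. For complex numbers $y_0,\dots,y_{M-1}$ and $1\le L\le M$, $\mathscr H_L(y_0,\dots,y_{M-1})\in\mathbb{C}^{L\times(M-L+1)}$ is the Hankel matrix with $(i,j)$ entry $y_{i+j}$ ($0\le i\le L-1$, $0\le j\le M-L$). $\sigma_{\min},\sigma_{\max}$ denote the smallest and largest singular values, $\kappa(\mathbf A)=\sigma_{\max}(\mathbf A)/\sigma_{\min}(\mathbf A)$. A pair $(\mathbf A,\mathbf B)$ of $K\times K$ matrices is regular if there is $(a,b)\in\mathbb{C}^2$ with $\det(a\mathbf A-b\mathbf B)\neq0$; its generalized eigenvalues are the $\lambda\in\mathbb{C}$ such that $\mathbf B\boldsymbol y=\lambda\mathbf A\boldsymbol y$ for some $\boldsymbol y\ne0$, i.e. roots of $\det(\mathbf B-\lambda\mathbf A)$, with the value $\infty$ assigned (with multiplicity) to the missing roots, corresponding to vectors $\boldsymbol y\neq 0$ with $\mathbf A\boldsymbol y=0$; a regular pair has exactly $K$ generalized eigenvalues in $\mathbb{C}\cup\{\infty\}$ counted with algebraic multiplicity. The chordal distance on $\mathbb{C}\cup\{\infty\}$ is $\chi(z,z')=|z-z'|/(\sqrt{1+|z|^2}\sqrt{1+|z'|^2})$ for $z,z'\in\mathbb{C}$ and $\chi(z,\infty)=1/\sqrt{1+|z|^2}$ for $z\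in\mathbb{C}$.
   Formalization: Case 1 (ESPRIT) is stated for L ≥ K+1 only: at L = K the matrix V_{L−1} in β is not defined (V_M requires M ≥ K), and with β read from its non-zero singular values the bound fails, e.g. K = L = 2, e = 0, where Φ is singular but all nodes are non-zero. *)

theory Defs
  imports "Jordan_Normal_Form.Char_Poly" "HOL-Combinatorics.Permutations"
begin

text \<open>All matrices are Jordan_Normal_Form matrices over the complex numbers;
  indices are 0-based (row l, column k of a matrix correspond to l+1, k+1 in the paper).\<close>

definition vandermonde :: "nat \<Rightarrow> nat \<Rightarrow> (nat \<Rightarrow> complex) \<Rightarrow> complex mat" where
  "vandermonde M K z = mat M K (\<lambda>(l, k). z k ^ l)"

definition hankel :: "nat \<Rightarrow> nat \<Rightarrow> (nat \<Rightarrow> complex) \<Rightarrow> complex mat" where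
  "hankel L M y = mat L (M - L + 1) (\<lambda>(i, j). y (i + j))"

definition adj :: "complex mat \<Rightarrow> complex mat" where
  "adj A = mat (dim_col A) (dim_row A) (\<lambda>(i, j). cnj (A $$ (j, i)))"

definition unitary_mat :: "complex mat \<Rightarrow> bool" where
  "unitary_mat U \<longleftrightarrow> U \<in> carrier_mat (dim_row U) (dim_row U) \<and> adj U * U = 1\<^sub>m (dim_row U)"

definition is_svd :: "complex mat \<Rightarrow> complex mat \<Rightarrow> complex mat \<Rightarrow> complex mat \<Rightarrow> bool" where
  "is_svd A U S W \<longleftrightarrow>
     U \<in> carrier_mat (dim_row A) (dim_row A) \<and> W \<in> carrier_mat (dim_col A) (dim_col A) \<and>
     S \<in> carrier_mat (dim_row A) (dim_col A) \<and> unitary_mat U \<and> unitary_mat W \<and>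
     (\<forall>i < dim_row A. \<forall>j < dim_col A. i \<noteq> j \<longrightarrow> S $$ (i, j) = 0) \<and>
     (\<forall>i < min (dim_row A) (dim_col A). S $$ (i, i) \<in> \<real> \<and> 0 \<le> Re (S $$ (i, i))) \<and>
     (\<forall>i j. i \<le> j \<longrightarrow> j < min (dim_row A) (dim_col A) \<longrightarrow> Re (S $$ (j, j)) \<le> Re (S $$ (i, i))) \<and>
     A = U * S * adj W"

definition sing_val :: "complex mat \<Rightarrow> nat \<Rightarrow> real" where
  "sing_val A i = Re ((SOME S. \<exists>U W. is_svd A U S W) $$ (i, i))"

definition sigma_max :: "complex mat \<Rightarrow> real" where
  "sigma_max A = sing_val A 0"

definition sigma_min :: "complex mat \<Rightarrow> real" where
  "sigma_min A = sing_val A (min (dim_row A) (dim_col A) - 1)"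

definition kappa :: "complex mat \<Rightarrow> real" where
  "kappa A = sigma_max A / sigma_min A"

definition first_cols :: "nat \<Rightarrow> complex mat \<Rightarrow> complex mat" where
  "first_cols k A = mat (dim_row A) k (\<lambda>(i, j). A $$ (i, j))"

definition rows_down :: "complex mat \<Rightarrow> complex mat" where
  "rows_down A = mat (dim_row A - 1) (dim_col A) (\<lambda>(i, j). A $$ (i, j))"

definition rows_up :: "complex mat \<Rightarrow> complex mat" where
  "rows_up A = mat (dim_row A - 1) (dim_col A) (\<lambda>(i, j). A $$ (i + 1, j))"

definition is_pinv :: "complex mat \<Rightarrow> complex mat \<Rightarrow> bool" where
  "is_pinv A B \<longleftrightarrow> B \<in> carrier_mat (dim_col A) (dim_row A) \<and>
     A * B * A = A \<and> B * A * B = B \<and> adj (A * B) = A * B \<and> adj (B * A) = B * A"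

definition pinv :: "complex mat \<Rightarrow> complex mat" where
  "pinv A = (THE B. is_pinv A B)"

definition vnorm :: "nat \<Rightarrow> (nat \<Rightarrow> complex) \<Rightarrow> real" where
  "vnorm N e = sqrt (\<Sum>n<N. (cmod (e n))\<^sup>2)"

text \<open>Extended complex plane: None represents infinity. Chordal distance.\<close>
fun chordal :: "complex option \<Rightarrow> complex option \<Rightarrow> real" where
  "chordal (Some z) (Some w) = cmod (z - w) / (sqrt (1 + (cmod z)\<^sup>2) * sqrt (1 + (cmod w)\<^sup>2))"
| "chordal (Some z) None = 1 / sqrt (1 + (cmod z)\<^sup>2)"
| "chordal None (Some w) = 1 / sqrt (1 + (cmod w)\<^sup>2)"
| "chordal None None = 0"

definition regular_pair :: "complex mat \<Rightarrow> complex mat \<Rightarrow> bool" where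
  "regular_pair A B \<longleftrightarrow> (\<exists>a b. det (a \<cdot>\<^sub>m A - b \<cdot>\<^sub>m B) \<noteq> 0)"

definition pencil_poly :: "complex mat \<Rightarrow> complex mat \<Rightarrow> complex poly" where
  "pencil_poly A B = det (map_mat (\<lambda>x. [:x:]) B - map_mat (\<lambda>x. [:0, x:]) A)"

text \<open>zh_0,...,zh_{K-1} (None = infinity) are the K generalized eigenvalues of the pair (A,B)
  with algebraic multiplicity: the finite ones are exactly the roots of det(B - lambda A)
  with multiplicity, the remaining K - deg ones are infinite.\<close>
definition gen_eigs :: "nat \<Rightarrow> complex mat \<Rightarrow> complex mat \<Rightarrow> (nat \<Rightarrow> complex option) \<Rightarrow> bool" where
  "gen_eigs K A B zh \<longleftrightarrow> (\<exists>c. c \<noteq> 0 \<and>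
     pencil_poly A B = Polynomial.smult c (\<Prod>k\<in>{k. k < K \<and> zh k \<noteq> None}. [:- the (zh k), 1:]))"

definition amin :: "nat \<Rightarrow> (nat \<Rightarrow> complex) \<Rightarrow> real" where
  "amin K \<alpha> = Min ((\<lambda>k. cmod (\<alpha> k)) ` {..<K})"
definition amax :: "nat \<Rightarrow> (nat \<Rightarrow> complex) \<Rightarrow> real" where
  "amax K \<alpha> = Max ((\<lambda>k. cmod (\<alpha> k)) ` {..<K})"

end

theory Submission
  imports Defs "HOL-Analysis.L2_Norm"
begin

text \<open>Both estimators are governed by a \<open>K \<times> K\<close> matrix pencil that is a perturbation of
  \<open>(C, Z C)\<close>, where \<open>Z\<close> is the diagonal matrix of the nodes. An eigenvalue \<open>\<lambda>\<close> of a pencil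
  \<open>(C + G\<^sub>1, Z C + G\<^sub>2)\<close> with \<open>\<parallel>C y\<parallel> \<ge> c \<parallel>y\<parallel>\<close> and \<open>\<parallel>G\<^sub>i y\<parallel> \<le> \<eta> \<parallel>y\<parallel>\<close> has a node \<open>z\<close> with
  \<open>c \<bar>\<lambda> - z\<bar> \<le> \<eta> (1 + \<bar>\<lambda>\<bar>)\<close>, hence \<open>\<bar>\<lambda> - z\<bar> \<le> 2 \<eta> / (c - \<eta>)\<close> as \<open>\<bar>z\<bar> \<le> 1\<close>. Following the roots
  along the segment joining the two pencils turns this inclusion into a matching and costs the
  factor \<open>2 K - 1\<close>. The constants \<open>c\<close> and \<open>\<eta>\<close> come from a \<open>sin \<Theta>\<close> bound: the leading singular
  vectors of the noisy Hankel matrix are within \<open>\<tau> = \<gamma> / (1 - \<gamma>)\<close> of the column space of the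
  Vandermonde matrix, so that \<open>c\<close> carries the cosine \<open>\<surd>(1 - \<tau>\<^sup>2)\<close>.\<close>

section \<open>Matching of roots along a homotopy\<close>

text \<open>An eigenvector \<open>y\<close> of the pencil enters only through
  \<open>w = C y\<close>, on which the diagonal \<open>Z\<close> acts coordinatewise; no passage to
  an eigenbasis is made, so no condition number arises apart from what is already contained in
  \<beta> and \<gamma>. The factors \<open>(1 + kappa) * kappa\<close> and
  \<open>amax / amin * kappa * kappa\<close> of the claimed bounds are used only through being at
  least 2 and 1. Two obstacles shape the rest. Knowing that every eigenvalue has a node nearby does
  not pair them, since several eigenvalues may gather at one node; counting must be done cluster by
  cluster, and only while no root escapes to infinity. And \<open>sigma_min\<close>,
  \<open>sigma_max\<close> rest on a choice operator, so nothing is known about them until a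
  singular value decomposition is shown to exist; this is done for injective matrices with at least
  as many rows as columns, which covers Vandermonde matrices of distinct nodes.\<close>

lemma bounded_complex_convergent_subseq:
  fixes x :: "nat \<Rightarrow> complex"
  assumes "\<And>n. cmod (x n) \<le> B"
  shows "\<exists>l \<phi>. strict_mono (\<phi> :: nat \<Rightarrow> nat) \<and> (\<lambda>n. x (\<phi> n)) \<longlonglongrightarrow> l"
proof -
  have real: "\<exists>\<phi>. strict_mono (\<phi> :: nat \<Rightarrow> nat) \<and> convergent (\<lambda>n. y (\<phi> n))"
    if y: "\<And>n. \<bar>y n\<bar> \<le> B" for y :: "nat \<Rightarrow> real"
  proof -
    obtain \<phi> where \<phi>: "strict_mono (\<phi> :: nat \<Rightarrow> nat)" "monoseq (\<lambda>n. y (\<phi> n))"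
      using seq_monosub by blast
    moreover have "Bseq (\<lambda>n. y (\<phi> n))" using y by (intro BseqI'[of _ B]) simp
    ultimately show ?thesis using Bseq_monoseq_convergent by blast
  qed
  obtain \<phi> where \<phi>: "strict_mono (\<phi> :: nat \<Rightarrow> nat)" "convergent (\<lambda>n. Re (x (\<phi> n)))"
    using real[of "\<lambda>n. Re (x n)"] abs_Re_le_cmod assms order_trans by blast
  obtain \<psi> where \<psi>: "strict_mono (\<psi> :: nat \<Rightarrow> nat)" "convergent (\<lambda>n. Im (x (\<phi> (\<psi> n))))"
    using real[of "\<lambda>n. Im (x (\<phi> n))"] abs_Im_le_cmod assms order_trans by blast
  obtain a b where "(\<lambda>n. Re (x (\<phi> n))) \<longlonglongrightarrow> a" and b: "(\<lambda>n. Im (x (\<phi> (\<psi> n)))) \<longlonglongrightarrow> b"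
    using \<phi>(2) \<psi>(2) by (auto simp: convergent_def)
  then have "(\<lambda>n. Re (x (\<phi> (\<psi> n)))) \<longlonglongrightarrow> a"
    using LIMSEQ_subseq_LIMSEQ[OF _ \<psi>(1)] by (fastforce simp: o_def)
  then have "(\<lambda>n. x ((\<phi> \<circ> \<psi>) n)) \<longlonglongrightarrow> Complex a b"
    using b tendsto_Complex by fastforce
  then show ?thesis using strict_mono_o[OF \<phi>(1) \<psi>(1)] by blast
qed

text \<open>Coordinates are handled one at a time: a limit already reached survives further
  thinning. Applied both to tuples of roots and to the entries of unit vectors.\<close>

lemma bounded_family_convergent_subseq:
  fixes x :: "nat \<Rightarrow> nat \<Rightarrow> complex"
  assumes "\<And>n k. k < K \<Longrightarrow> cmod (x n k) \<le> B"
  shows "\<exists>l \<phi>. strict_mono (\<phi> :: nat \<Rightarrow> nat) \<and> (\<forall>k<K. (\<lambda>n. x (\<phi> n) k) \<longlonglongrightarrow> l k)"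
  using assms
proof (induction K)
  case 0
  then show ?case by (auto intro!: exI[of _ id] strict_monoI)
next
  case (Suc K)
  then obtain l \<phi> where \<phi>: "strict_mono (\<phi> :: nat \<Rightarrow> nat)"
    and l: "\<forall>k<K. (\<lambda>n. x (\<phi> n) k) \<longlonglongrightarrow> l k"
    by (metis less_Suc_eq)
  obtain m \<psi> where \<psi>: "strict_mono (\<psi> :: nat \<Rightarrow> nat)"
    and m: "(\<lambda>n. x (\<phi> (\<psi> n)) K) \<longlonglongrightarrow> m"
    using bounded_complex_convergent_subseq[of "\<lambda>n. x (\<phi> n) K" B] Suc.prems by auto
  have "\<forall>k<Suc K. (\<lambda>n. x ((\<phi> \<circ> \<psi>) n) k) \<longlonglongrightarrow> (l(K := m)) k"
  proof (intro allI impI)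
    fix k assume "k < Suc K"
    then consider "k = K" | "k < K" by linarith
    then show "(\<lambda>n. x ((\<phi> \<circ> \<psi>) n) k) \<longlonglongrightarrow> (l(K := m)) k"
    proof cases
      case 1
      then show ?thesis using m by (simp add: o_def)
    next
      case 2
      then have "((\<lambda>n. x (\<phi> n) k) \<circ> \<psi>) \<longlonglongrightarrow> l k"
        using l \<psi> by (intro LIMSEQ_subseq_LIMSEQ) auto
      then show ?thesis using 2 by (simp add: o_def)
    qed
  qed
  moreover have "strict_mono (\<phi> \<circ> \<psi>)" using \<phi> \<psi> by (rule strict_mono_o)
  ultimately show ?case by blast
qed

text \<open>Unique factorization, in the form in which lists of eigenvalues are compared throughout.
  The other constant \<open>d\<close> cannot vanish, since the left-hand side is not the zero
  polynomial.\<close>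

lemma prod_linear_eq_imp_mset_eq:
  fixes a b :: "nat \<Rightarrow> complex"
  assumes "c \<noteq> 0" and "\<And>x. c * (\<Prod>k<K. x - a k) = d * (\<Prod>k<K. x - b k)"
  shows "image_mset a (mset_set {..<K}) = image_mset b (mset_set {..<K})"
proof -
  have roots: "proots (\<Prod>k<K. [:- f k, 1:]) = image_mset f (mset_set {..<K})" for f :: "nat \<Rightarrow> complex"
    by (subst proots_prod) (auto simp: sum_unfold_sum_mset image_mset.compositionality o_def)
  have eval: "poly (Polynomial.smult e (\<Prod>k<K. [:- f k, 1:])) x = e * (\<Prod>k<K. x - f k)"
    for e x and f :: "nat \<Rightarrow> complex"
    by (simp add: poly_prod)
  have eq: "Polynomial.smult c (\<Prod>k<K. [:- a k, 1:]) = Polynomial.smult d (\<Prod>k<K. [:- b k, 1:])"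
    by (rule poly_ext) (simp only: eval assms(2))
  have "(\<Prod>k<K. [:- a k, 1:]) \<noteq> 0" by simp
  then have "d \<noteq> 0" using eq assms(1) by auto
  have "proots (Polynomial.smult c (\<Prod>k<K. [:- a k, 1:])) = proots (Polynomial.smult d (\<Prod>k<K. [:- b k, 1:]))"
    using eq by simp
  then show ?thesis using assms(1) \<open>d \<noteq> 0\<close> roots by simp
qed

text \<open>A shortest path repeats no vertex, and \<open>n\<close> edges visit \<open>n + 1\<close>
  vertices; hence the strict bound, which later allows at most \<open>K - 1\<close> links between
  two discs of a cluster.\<close>

lemma rtrancl_imp_relpow_less_card:
  assumes "finite V" "R \<subseteq> V \<times> V" "x \<in> V" "(x, y) \<in> R\<^sup>*"
  shows "\<exists>n < card V. (x, y) \<in> R ^^ n"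
proof -
  define n where "n = (LEAST n. (x, y) \<in> R ^^ n)"
  have ex: "\<exists>n. (x, y) \<in> R ^^ n" using assms(4) by (simp add: rtrancl_power)
  then have n: "(x, y) \<in> R ^^ n" unfolding n_def by (rule LeastI_ex)
  have least: "n \<le> m" if "(x, y) \<in> R ^^ m" for m
    unfolding n_def using that by (rule Least_le)
  obtain f where f: "f 0 = x" "f n = y" "\<And>i. i < n \<Longrightarrow> (f i, f (Suc i)) \<in> R"
    using n by (auto simp: relpow_fun_conv)
  have path: "(f i, f (i + j)) \<in> R ^^ j" if "i + j \<le> n" for i j
    using that f(3) by (induction j) auto
  have "inj_on f {..n}"
  proof (rule linorder_inj_onI)
    fix i j assume ij: "i < j" and "i \<in> {..n}" and j: "j \<in> {..n}"
    show "f i \<noteq> f j"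
    proof
      assume eq: "f i = f j"
      \<comment> \<open>Cutting out the loop between positions \<open>i\<close> and \<open>j\<close>
        leaves a shorter path.\<close>
      have "(x, f i) \<in> R ^^ i" using path[of 0 i] ij j f(1) by simp
      moreover have "(f j, y) \<in> R ^^ (n - j)" using path[of j "n - j"] j f(2) by simp
      ultimately have "(x, y) \<in> R ^^ (i + (n - j))"
        using eq by (auto simp: relpow_add)
      from least[OF this] show False using ij j by simp
    qed
  qed auto
  moreover have "f ` {..n} \<subseteq> V"
  proof
    fix v assume "v \<in> f ` {..n}"
    then obtain i where i: "i \<le> n" "v = f i" by auto
    show "v \<in> V"
    proof (cases i)
      case 0
      then show ?thesis using i f assms by simp
    next
      case (Suc m)
      then show ?thesis using f(3)[of m] i assms(2) by auto
    qed
  qed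
  ultimately have "card {..n} \<le> card V" using assms(1) by (rule card_inj_on_le)
  then show ?thesis using n by (intro exI[of _ n]) simp
qed

text \<open>The discs of radius \<open>\<rho>\<close> around the \<open>z j\<close> fall into clusters; along the homotopy no root can
  pass from one cluster to another, since the clusters are disjoint compact sets. So at the end each
  cluster contains as many roots as centres, and a cluster of \<open>m\<close> discs has spread at most
  \<open>(2m - 1)\<rho>\<close> seen from one of its centres.\<close>

lemma root_matching:
  fixes z :: "nat \<Rightarrow> complex" and r :: "real \<Rightarrow> nat \<Rightarrow> complex"
  assumes f: "\<And>t x. t \<in> {0..1} \<Longrightarrow> f t x = c t * (\<Prod>k<K. x - r t k)"
    and c_nz: "\<And>t. t \<in> {0..1} \<Longrightarrow> c t \<noteq> 0"
    and c_cont: "continuous_on {0..1} c"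
    and f_cont: "\<And>x. continuous_on {0..1} (\<lambda>t. f t x)"
    and near: "\<And>t k. t \<in> {0..1} \<Longrightarrow> k < K \<Longrightarrow> \<exists>j<K. cmod (r t k - z j) \<le> \<rho>"
    and r0: "\<And>x. f 0 x = c 0 * (\<Prod>k<K. x - z k)"
  shows "\<exists>\<pi>. \<pi> permutes {..<K} \<and> (\<forall>k<K. cmod (r 1 (\<pi> k) - z k) \<le> (2 * real K - 1) * \<rho>)"
proof -
  \<comment> \<open>Two closed discs of radius \<rho> can share a point only if their centres are at
    most 2\<rho> apart, so distinct components of \<open>R\<close> have disjoint unions of
    discs.\<close>
  define R where "R = {(i, j). i < K \<and> j < K \<and> cmod (z i - z j) \<le> 2 * \<rho>}"
  have sym: "sym (R\<^sup>*)"
    by (intro sym_rtrancl) (auto simp: R_def sym_def norm_minus_commute)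
  \<comment> \<open>The index set of the cluster that contains \<open>w\<close>; it is empty if
    \<open>w\<close> lies in no disc.\<close>
  define cl where "cl = (\<lambda>w. {k. \<exists>j<K. cmod (w - z j) \<le> \<rho> \<and> (j, k) \<in> R\<^sup>*})"
  have cl_eq: "cl w = R\<^sup>* `` {j}" if "j < K" "cmod (w - z j) \<le> \<rho>" for w j
  proof -
    have "(j, i) \<in> R" if i: "i < K" "cmod (w - z i) \<le> \<rho>" for i
    proof -
      have "cmod (z j - z i) \<le> cmod (w - z i) + cmod (w - z j)"
        using norm_triangle_ineq4[of "w - z i" "w - z j"] by simp
      then show ?thesis using i \<open>j < K\<close> \<open>cmod (w - z j) \<le> \<rho>\<close> by (auto simp: R_def)
    qed
    then show ?thesis
      unfolding cl_def using that by (auto intro: rtrancl_trans converse_rtrancl_into_rtrancl)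
  qed
  \<comment> \<open>The roots \<open>r t\<close> carry no continuous labelling, so the invariant has
    to be symmetric in them: the multiset of the clusters they occupy.\<close>
  define m where "m = (\<lambda>t. image_mset cl (image_mset (r t) (mset_set {..<K})))"
  define B where "B = (\<Sum>j<K. cmod (z j)) + \<rho>"
  have bound: "cmod (r t k) \<le> B" if tk: "t \<in> {0..1}" "k < K" for t k
  proof -
    obtain j where j: "j < K" "cmod (r t k - z j) \<le> \<rho>" using near[OF tk] by blast
    have "cmod (r t k) \<le> cmod (r t k - z j) + cmod (z j)"
      using norm_triangle_ineq[of "r t k - z j" "z j"] by simp
    moreover have "cmod (z j) \<le> (\<Sum>j<K. cmod (z j))"
      using j by (intro member_le_sum) auto
    ultimately show ?thesis using j unfolding B_def by linarith
  qed
  \<comment> \<open>Sequential form of local constancy; finding a single index \<open>n\<close> is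
    enough to contradict a sequence on which \<open>m\<close> always differs from
    \<open>m t\<close>.\<close>
  have subseq: "\<exists>n. m (s n) = m t"
    if s: "\<And>n. s n \<in> {0..1}" "s \<longlonglongrightarrow> t" and t: "t \<in> {0..1}" for s t
  proof -
    obtain l \<phi> where \<phi>: "strict_mono (\<phi> :: nat \<Rightarrow> nat)"
      and l: "\<forall>k<K. (\<lambda>n. r (s (\<phi> n)) k) \<longlonglongrightarrow> l k"
      using bounded_family_convergent_subseq[of K "\<lambda>n. r (s n)" B] bound s by meson
    have s\<phi>: "(\<lambda>n. s (\<phi> n)) \<longlonglongrightarrow> t"
      using LIMSEQ_subseq_LIMSEQ[OF s(2) \<phi>] by (simp add: o_def)
    \<comment> \<open>The limits of the root tuples factor \<open>f t\<close> as well, so they are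
      the roots \<open>r t\<close> up to order.\<close>
    have lim: "f t x = c t * (\<Prod>k<K. x - l k)" for x
    proof (rule LIMSEQ_unique)
      show "(\<lambda>n. f (s (\<phi> n)) x) \<longlonglongrightarrow> f t x"
        using continuous_on_tendsto_compose[OF f_cont s\<phi> t] s(1) by simp
      have "(\<lambda>n. c (s (\<phi> n)) * (\<Prod>k<K. x - r (s (\<phi> n)) k)) \<longlonglongrightarrow> c t * (\<Prod>k<K. x - l k)"
        using continuous_on_tendsto_compose[OF c_cont s\<phi> t] s(1) l
        by (intro tendsto_intros) auto
      then show "(\<lambda>n. f (s (\<phi> n)) x) \<longlonglongrightarrow> c t * (\<Prod>k<K. x - l k)"
        using f s(1) by simp
    qed
    have mt: "m t = image_mset cl (image_mset l (mset_set {..<K}))"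
      unfolding m_def using prod_linear_eq_imp_mset_eq[where a = "r t" and b = l and c = "c t" and d = "c t"] lim f t c_nz by simp
    \<comment> \<open>If the cluster differed infinitely often, one of the finitely many discs would
      contain the root infinitely often. Being closed, that disc also contains the limit, and then
      both lie in the cluster of its centre.\<close>
    have ev: "eventually (\<lambda>n. cl (r (s (\<phi> n)) k) = cl (l k)) sequentially" if k: "k < K" for k
    proof (rule ccontr)
      assume "\<not> ?thesis"
      then have "\<exists>\<^sub>F n in sequentially. cl (r (s (\<phi> n)) k) \<noteq> cl (l k)"
        by (simp add: frequently_def)
      then have "\<exists>\<^sub>F n in sequentially. \<exists>j\<in>{..<K}. cmod (r (s (\<phi> n)) k - z j) \<le> \<rho> \<and> cl (r (s (\<phi> n)) k) \<noteq> cl (l k)"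
        by (rule frequently_mono[rotated]) (use near s(1) k in blast)
      then obtain j where j: "j < K"
        "\<exists>\<^sub>F n in sequentially. cmod (r (s (\<phi> n)) k - z j) \<le> \<rho> \<and> cl (r (s (\<phi> n)) k) \<noteq> cl (l k)"
        unfolding frequently_bex_finite_distrib[OF finite_lessThan] by blast
      have "cmod (l k - z j) \<le> \<rho>"
      proof (rule ccontr)
        assume "\<not> ?thesis"
        moreover have "(\<lambda>n. cmod (r (s (\<phi> n)) k - z j)) \<longlonglongrightarrow> cmod (l k - z j)"
          using l k by (intro tendsto_intros) auto
        ultimately have "eventually (\<lambda>n. cmod (r (s (\<phi> n)) k - z j) > \<rho>) sequentially"
          using order_tendstoD(1) by fastforce
        from frequently_eventually_frequently[OF j(2) this]
        have "\<exists>\<^sub>F n in sequentially. False" by (rule frequently_elim1) auto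
        then show False by simp
      qed
      then have "cl (l k) = R\<^sup>* `` {j}" using cl_eq j(1) by blast
      then have "\<exists>\<^sub>F n in sequentially. False"
        using cl_eq[OF j(1)] by (intro frequently_elim1[OF j(2)]) auto
      then show False by simp
    qed
    have "eventually (\<lambda>n. \<forall>k\<in>{..<K}. cl (r (s (\<phi> n)) k) = cl (l k)) sequentially"
      using ev by (intro eventually_ball_finite) auto
    then obtain n where n: "\<forall>k\<in>{..<K}. cl (r (s (\<phi> n)) k) = cl (l k)"
      by (auto simp: eventually_sequentially)
    have "m (s (\<phi> n)) = image_mset cl (image_mset l (mset_set {..<K}))"
      unfolding m_def image_mset.compositionality using n by (intro image_mset_cong) auto
    then show ?thesis using mt by metis
  qed
  \<comment> \<open>On a connected interval local constancy suffices. It is tested along sequences: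
    the terms at which \<open>m\<close> differs from \<open>m t\<close> would form a sequence
    excluded by \<open>subseq\<close>.\<close>
  have m01: "m 0 = m 1"
  proof (rule connected_local_const[of "{0..1::real}"], simp, simp, simp, rule ballI)
    fix t :: real assume t: "t \<in> {0..1}"
    show "\<forall>\<^sub>F s in at t within {0..1}. m t = m s"
    proof (rule sequentially_imp_eventually_within, intro allI impI)
      fix s :: "nat \<Rightarrow> real" assume s: "(\<forall>n. s n \<in> {0..1} \<and> s n \<noteq> t) \<and> s \<longlonglongrightarrow> t"
      show "\<forall>\<^sub>F n in sequentially. m t = m (s n)"
      proof (rule ccontr)
        assume "\<not> ?thesis"
        then have "infinite {n. m t \<noteq> m (s n)}"
          by (metis MOST_iff_cofinite cofinite_eq_sequentially)
        then obtain \<psi> where \<psi>: "strict_mono (\<psi> :: nat \<Rightarrow> nat)" "\<And>n. \<psi> n \<in> {n. m t \<noteq> m (s n)}"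
          using infinite_enumerate by blast
        have "(\<lambda>n. s (\<psi> n)) \<longlonglongrightarrow> t"
          using s LIMSEQ_subseq_LIMSEQ[of s t \<psi>] \<psi> by (simp add: o_def)
        then obtain n where "m (s (\<psi> n)) = m t" using subseq[of "\<lambda>n. s (\<psi> n)" t] s t by auto
        then show False using \<psi>(2)[of n] by simp
      qed
    qed
  qed
  have \<rho>: "\<rho> \<ge> 0" if "k < K" for k
    using near[of 0 k] that norm_ge_zero by (meson atLeastAtMost_iff order.refl order_trans zero_le_one)
  have m0: "m 0 = image_mset cl (image_mset z (mset_set {..<K}))"
    unfolding m_def using prod_linear_eq_imp_mset_eq[where a = "r 0" and b = z and c = "c 0" and d = "c 0"] r0 f[of 0] c_nz[of 0]
    by simp
  have "image_mset (\<lambda>k. cl (z k)) (mset_set {..<K}) = image_mset (\<lambda>k. cl (r 1 k)) (mset_set {..<K})"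
    using m01 m0 by (simp add: m_def image_mset.compositionality o_def)
  from image_mset_eq_implies_permutes[OF finite_lessThan this]
  obtain \<pi> where \<pi>: "\<pi> permutes {..<K}" "\<forall>k<K. cl (z k) = cl (r 1 (\<pi> k))"
    by (metis lessThan_iff)
  have "cmod (r 1 (\<pi> k) - z k) \<le> (2 * real K - 1) * \<rho>" if k: "k < K" for k
  proof -
    have "\<pi> k < K" using \<pi>(1) k by (metis lessThan_iff permutes_in_image)
    then obtain j where j: "j < K" "cmod (r 1 (\<pi> k) - z j) \<le> \<rho>" using near[of 1] by auto
    have "k \<in> cl (z k)" using cl_eq[of k "z k"] k \<rho> by auto
    then have "(j, k) \<in> R\<^sup>*" using \<pi>(2) k cl_eq[OF j] by auto
    then obtain n where n: "n < K" "(j, k) \<in> R ^^ n"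
      using rtrancl_imp_relpow_less_card[of "{..<K}" R j k] j by (auto simp: R_def)
    have "cmod (z i - z i') \<le> 2 * \<rho> * real n" if "(i, i') \<in> R ^^ n" for i i' n
      using that
    proof (induction n arbitrary: i')
      case (Suc n)
      then obtain i'' where i'': "(i, i'') \<in> R ^^ n" "(i'', i') \<in> R" by auto
      have "cmod (z i - z i') \<le> cmod (z i - z i'') + cmod (z i'' - z i')"
        using norm_triangle_ineq[of "z i - z i''" "z i'' - z i'"] by simp
      then show ?case using Suc.IH[OF i''(1)] i''(2) by (auto simp: R_def algebra_simps)
    qed simp
    then have "cmod (z j - z k) \<le> 2 * \<rho> * real n" using n by blast
    \<comment> \<open>At most \<open>K - 1\<close> links of length 2\<rho> between centres, and one
      more \<rho> from the root to the centre of its disc: together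
      \<open>(2 * K - 1) * \<rho>\<close>.\<close>
    also have "\<dots> \<le> 2 * \<rho> * (real K - 1)" using n \<rho>[OF k] by (intro mult_left_mono) auto
    finally have "cmod (z j - z k) \<le> 2 * \<rho> * (real K - 1)" .
    moreover have "cmod (r 1 (\<pi> k) - z k) \<le> cmod (r 1 (\<pi> k) - z j) + cmod (z j - z k)"
      using norm_triangle_ineq[of "r 1 (\<pi> k) - z j" "z j - z k"] by simp
    ultimately show ?thesis using j by (simp add: algebra_simps)
  qed
  then show ?thesis using \<pi> by blast
qed

section \<open>Euclidean norms and adjoints\<close>

definition ip :: "complex vec \<Rightarrow> complex vec \<Rightarrow> complex" where
  "ip v w = (\<Sum>i<dim_vec v. v $ i * cnj (w $ i))"

text \<open>Phrased with \<open>L2_set\<close> in order to inherit its triangle and Cauchy-Schwarz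
  inequalities.\<close>

definition nrm :: "complex vec \<Rightarrow> real" where
  "nrm v = L2_set (\<lambda>i. cmod (v $ i)) {..<dim_vec v}"

lemma nrm_ge_0 [simp]: "0 \<le> nrm v"
  by (simp add: nrm_def)

lemma nrm_sq: "(nrm v)\<^sup>2 = (\<Sum>i<dim_vec v. (cmod (v $ i))\<^sup>2)"
  by (simp add: nrm_def L2_set_def sum_nonneg)

lemma ip_self: "ip v v = complex_of_real ((nrm v)\<^sup>2)"
  by (simp add: ip_def nrm_sq complex_norm_square[symmetric])

lemma nrm_eq_0: "v \<in> carrier_vec n \<Longrightarrow> nrm v = 0 \<longleftrightarrow> v = 0\<^sub>v n"
  by (auto simp: nrm_def L2_set_eq_0_iff)

lemma nrm_zero [simp]: "nrm (0\<^sub>v n) = 0"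
  by (simp add: nrm_def L2_set_def)

lemma nrm_smult [simp]: "nrm (c \<cdot>\<^sub>v v) = cmod c * nrm v"
  unfolding nrm_def
  by (subst L2_set_right_distrib) (auto simp: norm_mult intro!: L2_set_cong)

lemma nrm_uminus [simp]: "nrm (- v) = nrm v"
  unfolding nrm_def by (auto intro!: L2_set_cong)

lemma nrm_diff: "v \<in> carrier_vec n \<Longrightarrow> w \<in> carrier_vec n \<Longrightarrow> nrm (v - w) \<le> nrm v + nrm w"
  unfolding nrm_def
  by (auto intro!: order_trans[OF L2_set_mono L2_set_triangle_ineq] norm_triangle_ineq4)

lemma cmod_ip_le: "dim_vec v = dim_vec w \<Longrightarrow> cmod (ip v w) \<le> nrm v * nrm w"
proof -
  assume d: "dim_vec v = dim_vec w"
  have "cmod (ip v w) \<le> (\<Sum>i<dim_vec v. \<bar>cmod (v $ i)\<bar> * \<bar>cmod (w $ i)\<bar>)"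
    unfolding ip_def by (rule order_trans[OF norm_sum]) (simp add: norm_mult)
  also have "\<dots> \<le> nrm v * nrm w" unfolding nrm_def d[symmetric] by (rule L2_set_mult_ineq)
  finally show ?thesis .
qed

lemma ip_add_left: "v \<in> carrier_vec n \<Longrightarrow> w \<in> carrier_vec n \<Longrightarrow> ip (v + w) u = ip v u + ip w u"
  by (simp add: ip_def sum.distrib distrib_right)

lemma ip_add_right: "v \<in> carrier_vec n \<Longrightarrow> w \<in> carrier_vec n \<Longrightarrow> u \<in> carrier_vec n \<Longrightarrow> ip u (v + w) = ip u v + ip u w"
  by (simp add: ip_def sum.distrib distrib_left)

lemma ip_smult_left: "ip (c \<cdot>\<^sub>v v) u = c * ip v u"
  by (simp add: ip_def sum_distrib_left mult.assoc)

lemma ip_smult_right: "dim_vec v = dim_vec u \<Longrightarrow> ip u (c \<cdot>\<^sub>v v) = cnj c * ip u v"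
  by (simp add: ip_def sum_distrib_left mult.assoc mult.left_commute)

lemma ip_commute: "dim_vec v = dim_vec w \<Longrightarrow> ip v w = cnj (ip w v)"
  by (simp add: ip_def mult.commute)

lemma ip_zero_right [simp]: "u \<in> carrier_vec n \<Longrightarrow> ip u (0\<^sub>v n) = 0"
  by (simp add: ip_def)

lemma pythagoras:
  assumes "v \<in> carrier_vec n" "w \<in> carrier_vec n" "ip v w = 0"
  shows "(nrm (v + w))\<^sup>2 = (nrm v)\<^sup>2 + (nrm w)\<^sup>2"
proof -
  have "ip w v = 0" using ip_commute[of w v] assms by simp
  have "ip (v + w) (v + w) = ip v v + ip w w"
    using assms \<open>ip w v = 0\<close> by (simp add: ip_add_left[of _ n] ip_add_right[of _ n])
  then show ?thesis unfolding ip_self by (metis of_real_add of_real_eq_iff)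
qed

lemma mult_mat_vec_index:
  "A \<in> carrier_mat m n \<Longrightarrow> x \<in> carrier_vec n \<Longrightarrow> i < m \<Longrightarrow> (A *\<^sub>v x) $ i = (\<Sum>j<n. A $$ (i, j) * x $ j)"
  by (auto simp: scalar_prod_def atLeast0LessThan intro!: sum.cong)

lemma adj_carrier [simp]: "A \<in> carrier_mat m n \<Longrightarrow> adj A \<in> carrier_mat n m"
  by (auto simp: adj_def)

lemma adj_index: "A \<in> carrier_mat m n \<Longrightarrow> i < n \<Longrightarrow> j < m \<Longrightarrow> adj A $$ (i, j) = cnj (A $$ (j, i))"
  by (auto simp: adj_def)

lemma adj_dim [simp]: "dim_row (adj A) = dim_col A" "dim_col (adj A) = dim_row A"
  by (auto simp: adj_def)

lemma adj_adj [simp]: "adj (adj A) = A"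
  by (auto simp: adj_def)

lemma adj_mult:
  assumes "A \<in> carrier_mat m n" "B \<in> carrier_mat n k"
  shows "adj (A * B) = adj B * adj A"
  using assms
  by (intro eq_matI) (auto simp: adj_def scalar_prod_def mult.commute intro!: sum.cong)

lemma adj_add: "A \<in> carrier_mat m n \<Longrightarrow> B \<in> carrier_mat m n \<Longrightarrow> adj (A + B) = adj A + adj B"
  by (intro eq_matI) (auto simp: adj_def)

lemma adj_one [simp]: "adj (1\<^sub>m n) = 1\<^sub>m n"
  by (intro eq_matI) (auto simp: adj_def)

lemma ip_mult_mat_vec:
  assumes A: "A \<in> carrier_mat m n" and x: "x \<in> carrier_vec n" and y: "y \<in> carrier_vec m"
  shows "ip (A *\<^sub>v x) y = ip x (adj A *\<^sub>v y)"
proof -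
  have "ip (A *\<^sub>v x) y = (\<Sum>i<m. (\<Sum>j<n. A $$ (i, j) * x $ j) * cnj (y $ i))"
    using A by (auto simp: ip_def mult_mat_vec_index[OF A x] simp del: index_mult_mat_vec intro!: sum.cong)
  also have "\<dots> = (\<Sum>i<m. \<Sum>j<n. x $ j * (A $$ (i, j) * cnj (y $ i)))"
    by (simp add: sum_distrib_right mult.assoc mult.left_commute)
  also have "\<dots> = (\<Sum>j<n. \<Sum>i<m. x $ j * (A $$ (i, j) * cnj (y $ i)))"
    by (rule sum.swap)
  also have "\<dots> = (\<Sum>j<n. x $ j * cnj ((adj A *\<^sub>v y) $ j))"
    by (intro sum.cong refl)
      (simp add: mult_mat_vec_index[OF adj_carrier[OF A] y] adj_index[OF A] sum_distrib_left del: index_mult_mat_vec)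
  also have "\<dots> = ip x (adj A *\<^sub>v y)"
    using x by (simp add: ip_def del: index_mult_mat_vec)
  finally show ?thesis .
qed

lemma nrm_mult_mat_vec_sq:
  assumes A: "A \<in> carrier_mat m n" and x: "x \<in> carrier_vec n"
  shows "complex_of_real ((nrm (A *\<^sub>v x))\<^sup>2) = ip x (adj A *\<^sub>v (A *\<^sub>v x))"
  unfolding ip_self[symmetric] using ip_mult_mat_vec[OF A x, of "A *\<^sub>v x"] A x by simp

lemma nrm_isometry:
  assumes A: "A \<in> carrier_mat m n" and x: "x \<in> carrier_vec n" and "adj A * A = 1\<^sub>m n"
  shows "nrm (A *\<^sub>v x) = nrm x"
proof -
  have "adj A *\<^sub>v (A *\<^sub>v x) = x"
    using assoc_mult_mat_vec[OF adj_carrier[OF A] A x] assms(3) x by simp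
  then have "(nrm (A *\<^sub>v x))\<^sup>2 = (nrm x)\<^sup>2"
    using nrm_mult_mat_vec_sq[OF A x] ip_self[of x] of_real_eq_iff by metis
  then show ?thesis by simp
qed

text \<open>Cauchy-Schwarz in every row. The Frobenius norm is the operator bound that the
  repetition pattern of a Hankel matrix makes easy to evaluate.\<close>

lemma nrm_mult_mat_vec_le_frobenius:
  assumes A: "A \<in> carrier_mat m n" and x: "x \<in> carrier_vec n"
  shows "nrm (A *\<^sub>v x) \<le> sqrt (\<Sum>i<m. \<Sum>j<n. (cmod (A $$ (i, j)))\<^sup>2) * nrm x"
proof (rule power2_le_imp_le)
  have "(cmod ((A *\<^sub>v x) $ i))\<^sup>2 \<le> (\<Sum>j<n. (cmod (A $$ (i, j)))\<^sup>2) * (nrm x)\<^sup>2" if "i < m" for i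
  proof -
    have "cmod ((A *\<^sub>v x) $ i) \<le> (\<Sum>j<n. \<bar>cmod (A $$ (i, j))\<bar> * \<bar>cmod (x $ j)\<bar>)"
      using mult_mat_vec_index[OF A x that] by (simp del: index_mult_mat_vec) (rule order_trans[OF norm_sum], simp add: norm_mult)
    also have "\<dots> \<le> L2_set (\<lambda>j. cmod (A $$ (i, j))) {..<n} * L2_set (\<lambda>j. cmod (x $ j)) {..<n}"
      by (rule L2_set_mult_ineq)
    finally have "(cmod ((A *\<^sub>v x) $ i))\<^sup>2 \<le> (L2_set (\<lambda>j. cmod (A $$ (i, j))) {..<n} * L2_set (\<lambda>j. cmod (x $ j)) {..<n})\<^sup>2"
      by (rule power_mono) simp
    then show ?thesis
      using x by (simp add: power_mult_distrib nrm_sq L2_set_def sum_nonneg)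
  qed
  then have "(\<Sum>i<m. (cmod ((A *\<^sub>v x) $ i))\<^sup>2) \<le> (\<Sum>i<m. (\<Sum>j<n. (cmod (A $$ (i, j)))\<^sup>2) * (nrm x)\<^sup>2)"
    by (intro sum_mono) simp
  then show "(nrm (A *\<^sub>v x))\<^sup>2 \<le> (sqrt (\<Sum>i<m. \<Sum>j<n. (cmod (A $$ (i, j)))\<^sup>2) * nrm x)\<^sup>2"
    using A by (simp add: nrm_sq[of "A *\<^sub>v x"] power_mult_distrib sum_nonneg sum_distrib_right del: index_mult_mat_vec)
qed (simp add: sum_nonneg)

lemma vec_add_diff_cancel:
  "v \<in> carrier_vec n \<Longrightarrow> w \<in> carrier_vec n \<Longrightarrow> v + (w - v) = (w :: complex vec)"
  by (intro eq_vecI) auto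

lemma vec_add_diff_add:
  "u \<in> carrier_vec n \<Longrightarrow> v \<in> carrier_vec n \<Longrightarrow> w \<in> carrier_vec n \<Longrightarrow> (u + v) - (u + w) = v - (w :: complex vec)"
  by (intro eq_vecI) auto

lemma assoc_mult_mat_vec3:
  assumes "A \<in> carrier_mat n1 n2" "B \<in> carrier_mat n2 n3" "C \<in> carrier_mat n3 n4" "v \<in> carrier_vec n4"
  shows "(A * B * C) *\<^sub>v v = A *\<^sub>v (B *\<^sub>v (C *\<^sub>v v))"
  using assoc_mult_mat_vec[OF mult_carrier_mat[OF assms(1,2)] assms(3,4)]
    assoc_mult_mat_vec[OF assms(1,2), of "C *\<^sub>v v"] assms(3,4) by simp

section \<open>Left inverses and orthogonal projections\<close>

lemma inverse_mat_exists:
  assumes "(G :: complex mat) \<in> carrier_mat n n" "det G \<noteq> 0"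
  obtains H where "H \<in> carrier_mat n n" "H * G = 1\<^sub>m n" "G * H = 1\<^sub>m n"
  using det_non_zero_imp_unit[OF assms] by (auto simp: Units_def ring_mat_def)

text \<open>The lower bound makes the Gram matrix \<open>adj A * A\<close> invertible, and
  \<open>P\<close> is its inverse times \<open>adj A\<close>. Then \<open>A * P\<close> is the
  orthogonal projection onto the range of \<open>A\<close>, which accounts for the normal equations
  and for Pythagoras; the norm bound on \<open>P\<close> follows since a projection does not
  increase norms.\<close>

lemma left_inverse_exists:
  assumes A: "A \<in> carrier_mat m n" and a: "a > 0"
    and low: "\<And>x. x \<in> carrier_vec n \<Longrightarrow> a * nrm x \<le> nrm (A *\<^sub>v x)"
  obtains P where "P \<in> carrier_mat n m" "P * A = 1\<^sub>m n"
    "\<And>x. x \<in> carrier_vec m \<Longrightarrow> adj A *\<^sub>v (x - A *\<^sub>v (P *\<^sub>v x)) = 0\<^sub>v n"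
    "\<And>x. x \<in> carrier_vec m \<Longrightarrow> (nrm x)\<^sup>2 = (nrm (A *\<^sub>v (P *\<^sub>v x)))\<^sup>2 + (nrm (x - A *\<^sub>v (P *\<^sub>v x)))\<^sup>2"
    "\<And>x. x \<in> carrier_vec m \<Longrightarrow> a * nrm (P *\<^sub>v x) \<le> nrm x"
proof -
  define G where "G = adj A * A"
  have G: "G \<in> carrier_mat n n" using A by (auto simp: G_def)
  have "det G \<noteq> 0"
  proof
    assume "det G = 0"
    then obtain v where v: "v \<in> carrier_vec n" "v \<noteq> 0\<^sub>v n" "G *\<^sub>v v = 0\<^sub>v n"
      using det_0_iff_vec_prod_zero[OF G] by auto
    have "adj A *\<^sub>v (A *\<^sub>v v) = 0\<^sub>v n"
      using v assoc_mult_mat_vec[OF adj_carrier[OF A] A v(1)] by (simp add: G_def)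
    then have "nrm (A *\<^sub>v v) = 0" using nrm_mult_mat_vec_sq[OF A v(1)] v(1) by simp
    then have "nrm v = 0" using low[OF v(1)] a
      by (metis linorder_not_less mult_eq_0_iff nrm_ge_0 order_less_le zero_less_mult_iff)
    then show False using v nrm_eq_0 by blast
  qed
  then obtain H where H: "H \<in> carrier_mat n n" "H * G = 1\<^sub>m n" "G * H = 1\<^sub>m n"
    using inverse_mat_exists[OF G] by blast
  define P where "P = H * adj A"
  have P: "P \<in> carrier_mat n m" using A H by (auto simp: P_def)
  have PA: "P * A = 1\<^sub>m n"
    using assoc_mult_mat[OF H(1) adj_carrier[OF A] A] H(2) by (simp add: P_def G_def)
  have orth: "adj A *\<^sub>v (x - A *\<^sub>v (P *\<^sub>v x)) = 0\<^sub>v n" if x: "x \<in> carrier_vec m" for x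
  proof -
    have y: "adj A *\<^sub>v x \<in> carrier_vec n" using A x by (meson adj_carrier mult_mat_vec_carrier)
    have Px: "P *\<^sub>v x = H *\<^sub>v (adj A *\<^sub>v x)"
      unfolding P_def by (rule assoc_mult_mat_vec[OF H(1) adj_carrier[OF A] x])
    have Pxc: "P *\<^sub>v x \<in> carrier_vec n" using P x by simp
    have "adj A *\<^sub>v (A *\<^sub>v (P *\<^sub>v x)) = G *\<^sub>v (P *\<^sub>v x)"
      unfolding G_def by (rule assoc_mult_mat_vec[OF adj_carrier[OF A] A Pxc, symmetric])
    also have "\<dots> = (G * H) *\<^sub>v (adj A *\<^sub>v x)"
      unfolding Px by (rule assoc_mult_mat_vec[OF G H(1) y, symmetric])
    also have "\<dots> = adj A *\<^sub>v x" using H y by simp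
    finally have *: "adj A *\<^sub>v (A *\<^sub>v (P *\<^sub>v x)) = adj A *\<^sub>v x" .
    have "adj A *\<^sub>v (x - A *\<^sub>v (P *\<^sub>v x)) = adj A *\<^sub>v x - adj A *\<^sub>v (A *\<^sub>v (P *\<^sub>v x))"
      using A x Pxc by (intro mult_minus_distrib_mat_vec[OF adj_carrier[OF A]]) auto
    also have "\<dots> = 0\<^sub>v n" using * y by auto
    finally show ?thesis .
  qed
  have pyth: "(nrm x)\<^sup>2 = (nrm (A *\<^sub>v (P *\<^sub>v x)))\<^sup>2 + (nrm (x - A *\<^sub>v (P *\<^sub>v x)))\<^sup>2"
    if x: "x \<in> carrier_vec m" for x
  proof -
    have Pxc: "P *\<^sub>v x \<in> carrier_vec n" using P x by simp
    have Axc: "A *\<^sub>v (P *\<^sub>v x) \<in> carrier_vec m" using A Pxc by simp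
    have "ip (A *\<^sub>v (P *\<^sub>v x)) (x - A *\<^sub>v (P *\<^sub>v x)) = 0"
      using ip_mult_mat_vec[OF A Pxc, of "x - A *\<^sub>v (P *\<^sub>v x)"] orth[OF x] x Axc Pxc by simp
    moreover have "A *\<^sub>v (P *\<^sub>v x) + (x - A *\<^sub>v (P *\<^sub>v x)) = x" by (rule vec_add_diff_cancel[OF Axc x])
    ultimately show ?thesis using pythagoras[OF Axc, of "x - A *\<^sub>v (P *\<^sub>v x)"] x Axc by simp
  qed
  have "a * nrm (P *\<^sub>v x) \<le> nrm x" if x: "x \<in> carrier_vec m" for x
  proof -
    have "a * nrm (P *\<^sub>v x) \<le> nrm (A *\<^sub>v (P *\<^sub>v x))" using low P x by simp
    also have "\<dots> \<le> nrm x"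
      by (rule power2_le_imp_le) (use pyth[OF x] in auto)
    finally show ?thesis .
  qed
  then show ?thesis using that[OF P PA orth pyth] by blast
qed

text \<open>The squared norm of \<open>adj Q\<close> at \<open>x\<close> is the inner product of
  \<open>x\<close> with \<open>Q\<close> applied to that image; Cauchy-Schwarz and one cancellation
  finish.\<close>

lemma adj_bound:
  assumes Q: "Q \<in> carrier_mat n m" and c: "\<And>x. x \<in> carrier_vec m \<Longrightarrow> nrm (Q *\<^sub>v x) \<le> c * nrm x"
    and "c \<ge> 0" and x: "x \<in> carrier_vec n"
  shows "nrm (adj Q *\<^sub>v x) \<le> c * nrm x"
proof -
  let ?y = "adj Q *\<^sub>v x"
  have y: "?y \<in> carrier_vec m" using Q x by (meson adj_carrier mult_mat_vec_carrier)
  have Qy: "Q *\<^sub>v ?y \<in> carrier_vec n" using Q y by simp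
  have "complex_of_real ((nrm ?y)\<^sup>2) = ip x (Q *\<^sub>v ?y)"
    using nrm_mult_mat_vec_sq[OF adj_carrier[OF Q] x] by simp
  then have "(nrm ?y)\<^sup>2 = cmod (ip x (Q *\<^sub>v ?y))"
    by (metis abs_power2 norm_of_real)
  also have "\<dots> \<le> nrm x * nrm (Q *\<^sub>v ?y)" using x Q by (intro cmod_ip_le) simp
  also have "\<dots> \<le> nrm x * (c * nrm ?y)" by (intro mult_left_mono c y) auto
  finally have *: "nrm ?y * nrm ?y \<le> c * nrm x * nrm ?y" by (simp add: power2_eq_square mult_ac)
  show ?thesis
  proof (cases "nrm ?y = 0")
    case True
    then show ?thesis using \<open>c \<ge> 0\<close> by simp
  next
    case False
    then show ?thesis using * by (simp add: order_less_le)
  qed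
qed

section \<open>Existence of singular value decompositions\<close>

definition orthonormal :: "nat \<Rightarrow> nat \<Rightarrow> (nat \<Rightarrow> complex vec) \<Rightarrow> bool" where
  "orthonormal n k u \<longleftrightarrow> (\<forall>i<k. u i \<in> carrier_vec n) \<and>
     (\<forall>i<k. \<forall>j<k. ip (u i) (u j) = (if i = j then 1 else 0))"

lemma orthonormal_nrm: "orthonormal n k u \<Longrightarrow> i < k \<Longrightarrow> nrm (u i) = 1"
proof -
  assume "orthonormal n k u" "i < k"
  then have "complex_of_real ((nrm (u i))\<^sup>2) = complex_of_real 1"
    unfolding ip_self[symmetric] by (simp add: orthonormal_def)
  then have "(nrm (u i))\<^sup>2 = 1" by (simp only: of_real_eq_iff)
  then show ?thesis using nrm_ge_0[of "u i"] by (simp add: power2_eq_1_iff)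
qed

text \<open>Fewer than \<open>n\<close> linear conditions, padded with zero rows to a singular
  square matrix, have a common nonzero solution. The vectors \<open>u i\<close> may be
  dependent.\<close>

lemma exists_unit_orthogonal:
  assumes "k < n" and u: "\<And>i. i < k \<Longrightarrow> u i \<in> carrier_vec n"
  obtains x where "x \<in> carrier_vec n" "nrm x = 1" "\<And>i. i < k \<Longrightarrow> ip x (u i) = 0"
proof -
  define M where "M = mat n n (\<lambda>(i, j). if i < k then cnj (u i $ j) else 0)"
  have M: "M \<in> carrier_mat n n" by (simp add: M_def)
  \<comment> \<open>Row \<open>k\<close> of \<open>M\<close> is one of the padding rows.\<close>
  have "transpose_mat M *\<^sub>v unit_vec n k = 0\<^sub>v n"
    using \<open>k < n\<close> by (intro eq_vecI) (auto simp: M_def)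
  moreover have "unit_vec n k \<noteq> (0\<^sub>v n :: complex vec)"
    using \<open>k < n\<close> by (metis index_unit_vec(1) index_zero_vec(1) one_neq_zero)
  ultimately have "det (transpose_mat M) = 0"
    using det_0_iff_vec_prod_zero[of "transpose_mat M" n] M unit_vec_carrier by (metis transpose_carrier_mat)
  then have "det M = 0" using det_transpose[OF M] by simp
  then obtain v where v: "v \<in> carrier_vec n" "v \<noteq> 0\<^sub>v n" "M *\<^sub>v v = 0\<^sub>v n"
    using det_0_iff_vec_prod_zero[OF M] by auto
  have nz: "nrm v \<noteq> 0" using v nrm_eq_0 by blast
  have "ip v (u i) = 0" if "i < k" for i
  proof -
    have "(M *\<^sub>v v) $ i = (\<Sum>j<n. M $$ (i, j) * v $ j)"
      by (rule mult_mat_vec_index[OF M v(1)]) (use that \<open>k < n\<close> in simp)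
    then show ?thesis
      using v that \<open>k < n\<close> by (simp add: M_def ip_def mult.commute del: index_mult_mat_vec)
  qed
  then show ?thesis
    using that[of "complex_of_real (1 / nrm v) \<cdot>\<^sub>v v"] v nz by (simp add: ip_smult_left norm_divide)
qed

lemma orthonormal_extend:
  assumes "orthonormal n k u" "k \<le> m" "m \<le> n"
  shows "\<exists>u'. orthonormal n m u' \<and> (\<forall>i<k. u' i = u i)"
  using assms(2,3)
proof (induction m rule: dec_induct)
  case base
  then show ?case using assms by blast
next
  case (step m)
  then obtain u' where u': "orthonormal n m u'" "\<forall>i<k. u' i = u i" by auto
  obtain x where x: "x \<in> carrier_vec n" "nrm x = 1" "\<And>i. i < m \<Longrightarrow> ip x (u' i) = 0"
    using exists_unit_orthogonal[of m n u'] u'(1) step by (auto simp: orthonormal_def)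
  have "ip (u' i) x = 0" if "i < m" for i
    using x(3)[OF that] ip_commute[of "u' i" x] x(1) u'(1) that by (simp add: orthonormal_def)
  then have "orthonormal n (Suc m) (u'(m := x))"
    using u'(1) x by (auto simp: orthonormal_def less_Suc_eq ip_self)
  moreover have "\<forall>i<k. (u'(m := x)) i = u i" using u'(2) step by auto
  ultimately show ?case by blast
qed

text \<open>Compactness of the unit sphere in a subspace: a maximising sequence of unit vectors has
  a subsequence converging in every coordinate, and norm, orthogonality and the value of the
  objective pass to the limit.\<close>

lemma exists_maximiser:
  assumes A: "A \<in> carrier_mat m n" and "k < n" and w: "\<And>i. i < k \<Longrightarrow> w i \<in> carrier_vec n"
  obtains x where "x \<in> carrier_vec n" "nrm x = 1" "\<And>i. i < k \<Longrightarrow> ip x (w i) = 0"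
    "\<And>y. y \<in> carrier_vec n \<Longrightarrow> (\<And>i. i < k \<Longrightarrow> ip y (w i) = 0) \<Longrightarrow> nrm (A *\<^sub>v y) \<le> nrm (A *\<^sub>v x) * nrm y"
proof -
  define X where "X = {x \<in> carrier_vec n. nrm x = 1 \<and> (\<forall>i<k. ip x (w i) = 0)}"
  define Y where "Y = (\<lambda>x. nrm (A *\<^sub>v x)) ` X"
  obtain x0 where "x0 \<in> carrier_vec n" "nrm x0 = 1" "\<And>i. i < k \<Longrightarrow> ip x0 (w i) = 0"
    using exists_unit_orthogonal[of k n w, OF \<open>k < n\<close> w] by blast
  then have "x0 \<in> X" by (simp add: X_def)
  then have "X \<noteq> {}" by blast
  then have Yne: "Y \<noteq> {}" by (simp add: Y_def)
  have bdd: "bdd_above Y"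
  proof (rule bdd_aboveI)
    fix y assume "y \<in> Y"
    then obtain x where "x \<in> carrier_vec n" "nrm x = 1" "y = nrm (A *\<^sub>v x)" by (auto simp: Y_def X_def)
    then show "y \<le> sqrt (\<Sum>i<m. \<Sum>j<n. (cmod (A $$ (i, j)))\<^sup>2)"
      using nrm_mult_mat_vec_le_frobenius[OF A] by fastforce
  qed
  have "\<exists>x\<in>X. nrm (A *\<^sub>v x) > Sup Y - inverse (real (Suc j))" for j
  proof -
    have "\<exists>y\<in>Y. Sup Y - inverse (real (Suc j)) < y"
      using less_cSup_iff[OF Yne bdd, of "Sup Y - inverse (real (Suc j))"] by simp
    then show ?thesis by (auto simp: Y_def)
  qed
  then obtain x where x: "\<And>j. x j \<in> X" "\<And>j. nrm (A *\<^sub>v x j) > Sup Y - inverse (real (Suc j))"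
    by metis
  have xc: "x j \<in> carrier_vec n" "nrm (x j) = 1" for j using x(1) by (auto simp: X_def)
  have "cmod (x j $ i) \<le> 1" if "i < n" for i j
  proof -
    have "cmod (x j $ i) \<le> nrm (x j)"
      unfolding nrm_def by (rule member_le_L2_set) (use that xc(1)[of j] in auto)
    then show ?thesis using xc by simp
  qed
  then obtain l \<phi> where \<phi>: "strict_mono (\<phi> :: nat \<Rightarrow> nat)"
    and l: "\<forall>i<n. (\<lambda>j. x (\<phi> j) $ i) \<longlonglongrightarrow> l i"
    using bounded_family_convergent_subseq[of n "\<lambda>j i. x j $ i" 1] by blast
  define v where "v = vec n l"
  have v: "v \<in> carrier_vec n" by (simp add: v_def)
  have nrm_lim: "(\<lambda>j. nrm (y j)) \<longlonglongrightarrow> nrm y'"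
    if "\<And>j. y j \<in> carrier_vec p" "y' \<in> carrier_vec p" "\<And>i. i < p \<Longrightarrow> (\<lambda>j. y j $ i) \<longlonglongrightarrow> y' $ i" for y y' p
  proof -
    have "(\<lambda>j. sqrt (\<Sum>i<p. (cmod (y j $ i))\<^sup>2)) \<longlonglongrightarrow> sqrt (\<Sum>i<p. (cmod (y' $ i))\<^sup>2)"
      by (intro tendsto_intros that(3)) auto
    moreover have "dim_vec (y j) = p" "dim_vec y' = p" for j using that by auto
    ultimately show ?thesis by (simp add: nrm_def L2_set_def)
  qed
  have "(\<lambda>j. nrm (x (\<phi> j))) \<longlonglongrightarrow> nrm v"
    by (rule nrm_lim[of _ n]) (use l xc v in \<open>auto simp: v_def\<close>)
  then have v1: "nrm v = 1" using xc(2) LIMSEQ_const_iff[of 1 "nrm v"] by simp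
  have v0: "ip v (w i) = 0" if "i < k" for i
  proof -
    have "(\<lambda>j. \<Sum>q<n. x (\<phi> j) $ q * cnj (w i $ q)) \<longlonglongrightarrow> (\<Sum>q<n. v $ q * cnj (w i $ q))"
      by (intro tendsto_intros) (use l in \<open>auto simp: v_def\<close>)
    moreover have "(\<Sum>q<n. x (\<phi> j) $ q * cnj (w i $ q)) = 0" for j
      using x(1)[of "\<phi> j"] that by (auto simp: X_def ip_def)
    ultimately show ?thesis using LIMSEQ_const_iff[of 0 "ip v (w i)"] v by (simp add: ip_def)
  qed
  have "(\<lambda>j. nrm (A *\<^sub>v x (\<phi> j))) \<longlonglongrightarrow> nrm (A *\<^sub>v v)"
  proof (rule nrm_lim[of _ m])
    show "A *\<^sub>v x (\<phi> j) \<in> carrier_vec m" for j using A xc by simp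
    show "A *\<^sub>v v \<in> carrier_vec m" using A v by simp
    show "(\<lambda>j. (A *\<^sub>v x (\<phi> j)) $ i) \<longlonglongrightarrow> (A *\<^sub>v v) $ i" if "i < m" for i
      unfolding mult_mat_vec_index[OF A v that] mult_mat_vec_index[OF A xc(1) that]
      by (intro tendsto_intros) (use l in \<open>auto simp: v_def\<close>)
  qed
  moreover have "(\<lambda>j. Sup Y - inverse (real (Suc j))) \<longlonglongrightarrow> Sup Y - 0"
    by (intro tendsto_diff tendsto_const LIMSEQ_inverse_real_of_nat)
  moreover have "Sup Y - inverse (real (Suc j)) \<le> nrm (A *\<^sub>v x (\<phi> j))" for j
  proof -
    have "inverse (real (Suc (\<phi> j))) \<le> inverse (real (Suc j))"
      using seq_suble[OF \<phi>, of j] by (intro le_imp_inverse_le) auto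
    then show ?thesis using x(2)[of "\<phi> j"] by linarith
  qed
  ultimately have max: "Sup Y \<le> nrm (A *\<^sub>v v)"
    using LIMSEQ_le by fastforce
  have "nrm (A *\<^sub>v y) \<le> nrm (A *\<^sub>v v) * nrm y"
    if y: "y \<in> carrier_vec n" "\<And>i. i < k \<Longrightarrow> ip y (w i) = 0" for y
  proof (cases "nrm y = 0")
    case True
    then show ?thesis using nrm_mult_mat_vec_le_frobenius[OF A y(1)] by simp
  next
    case False
    let ?y = "complex_of_real (1 / nrm y) \<cdot>\<^sub>v y"
    have "?y \<in> X" using y False by (simp add: X_def ip_smult_left norm_divide)
    then have "nrm (A *\<^sub>v ?y) \<le> Sup Y" by (intro cSup_upper bdd) (simp add: Y_def)
    moreover have "A *\<^sub>v ?y = complex_of_real (1 / nrm y) \<cdot>\<^sub>v (A *\<^sub>v y)"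
      by (rule mult_mat_vec[OF A y(1)])
    ultimately have "nrm (A *\<^sub>v y) / nrm y \<le> nrm (A *\<^sub>v v)" using max by (simp add: norm_divide)
    moreover have "nrm y > 0" using False nrm_ge_0[of y] by linarith
    ultimately show ?thesis by (simp add: field_simps)
  qed
  then show ?thesis using that[OF v v1 v0] by blast
qed

text \<open>First-order optimality of a maximiser of the Rayleigh quotient.\<close>

lemma maximiser_orthogonal_images:
  assumes A: "A \<in> carrier_mat m n" and x: "x \<in> carrier_vec n" "nrm x = 1"
    and y: "y \<in> carrier_vec n" "ip x y = 0"
    and max: "\<And>c. nrm (A *\<^sub>v (x + c \<cdot>\<^sub>v y)) \<le> nrm (A *\<^sub>v x) * nrm (x + c \<cdot>\<^sub>v y)"
  shows "ip (A *\<^sub>v x) (A *\<^sub>v y) = 0"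
proof (rule ccontr)
  define d where "d = ip (A *\<^sub>v x) (A *\<^sub>v y)"
  assume "ip (A *\<^sub>v x) (A *\<^sub>v y) \<noteq> 0"
  then have d: "cmod d > 0" by (simp add: d_def)
  define s where "s = nrm (A *\<^sub>v x)"
  define M where "M = s\<^sup>2 * (nrm y)\<^sup>2"
  \<comment> \<open>The step \<open>c = \<epsilon> * d\<close> makes the first-order gain
    \<open>2 * \<epsilon> * (cmod d)^2\<close> real and positive. The second-order cost is at most
    \<open>\<epsilon>^2 * (cmod d)^2 * M\<close>, and \<open>\<epsilon> * M < 1\<close> keeps it
    below the gain.\<close>
  define \<epsilon> where "\<epsilon> = 1 / (M + 1)"
  have M: "M \<ge> 0" by (simp add: M_def)
  define c where "c = complex_of_real \<epsilon> * d"
  have dd: "d * cnj d = complex_of_real ((cmod d)\<^sup>2)" by (rule complex_norm_square[symmetric])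
  have cc: "cmod c = \<epsilon> * cmod d" unfolding c_def norm_mult norm_of_real using M by (simp add: \<epsilon>_def)
  have Ax: "A *\<^sub>v x \<in> carrier_vec m" "A *\<^sub>v y \<in> carrier_vec m" using A x y by auto
  have cy: "c \<cdot>\<^sub>v y \<in> carrier_vec n" "c \<cdot>\<^sub>v (A *\<^sub>v y) \<in> carrier_vec m" using y Ax by auto
  have "A *\<^sub>v (x + c \<cdot>\<^sub>v y) = A *\<^sub>v x + c \<cdot>\<^sub>v (A *\<^sub>v y)"
    using mult_add_distrib_mat_vec[OF A x(1) cy(1)] mult_mat_vec[OF A y(1)] by simp
  then have lhs: "complex_of_real ((nrm (A *\<^sub>v (x + c \<cdot>\<^sub>v y)))\<^sup>2)
      = ip (A *\<^sub>v x + c \<cdot>\<^sub>v (A *\<^sub>v y)) (A *\<^sub>v x + c \<cdot>\<^sub>v (A *\<^sub>v y))"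
    by (simp add: ip_self)
  also have "\<dots> = s\<^sup>2 + cnj c * d + c * cnj d + c * cnj c * (nrm (A *\<^sub>v y))\<^sup>2"
    using Ax cy ip_commute[of "A *\<^sub>v y" "A *\<^sub>v x"] ip_self[of "A *\<^sub>v x"] ip_self[of "A *\<^sub>v y"]
    by (simp add: ip_add_left[of _ m] ip_add_right[of _ m] ip_smult_left ip_smult_right
        d_def[symmetric] s_def[symmetric] algebra_simps)
  also have "\<dots> = s\<^sup>2 + 2 * complex_of_real \<epsilon> * (d * cnj d)
      + (complex_of_real \<epsilon>)\<^sup>2 * (d * cnj d) * (nrm (A *\<^sub>v y))\<^sup>2"
    by (simp add: c_def algebra_simps power2_eq_square)
  also have "\<dots> = complex_of_real (s\<^sup>2 + 2 * \<epsilon> * (cmod d)\<^sup>2 + (\<epsilon> * cmod d)\<^sup>2 * (nrm (A *\<^sub>v y))\<^sup>2)"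
    unfolding dd by (simp add: power_mult_distrib)
  finally have lhs: "(nrm (A *\<^sub>v (x + c \<cdot>\<^sub>v y)))\<^sup>2 =
      s\<^sup>2 + 2 * \<epsilon> * (cmod d)\<^sup>2 + (\<epsilon> * cmod d)\<^sup>2 * (nrm (A *\<^sub>v y))\<^sup>2"
    by (simp only: of_real_eq_iff)
  have "(nrm (x + c \<cdot>\<^sub>v y))\<^sup>2 = 1 + (\<epsilon> * cmod d)\<^sup>2 * (nrm y)\<^sup>2"
    using pythagoras[OF x(1) cy(1)] x y cc by (simp add: ip_smult_right power_mult_distrib)
  moreover have "(nrm (A *\<^sub>v (x + c \<cdot>\<^sub>v y)))\<^sup>2 \<le> s\<^sup>2 * (nrm (x + c \<cdot>\<^sub>v y))\<^sup>2"
    using power_mono[OF max[of c], of 2] by (simp add: s_def power_mult_distrib)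
  ultimately have "2 * \<epsilon> * (cmod d)\<^sup>2 + (\<epsilon> * cmod d)\<^sup>2 * (nrm (A *\<^sub>v y))\<^sup>2 \<le> (\<epsilon> * cmod d)\<^sup>2 * M"
    using lhs by (simp add: M_def algebra_simps)
  then have "2 * \<epsilon> * (cmod d)\<^sup>2 \<le> (\<epsilon> * cmod d)\<^sup>2 * M"
    using mult_nonneg_nonneg[OF zero_le_power2[of "\<epsilon> * cmod d"] zero_le_power2[of "nrm (A *\<^sub>v y)"]]
    by linarith
  then have "(\<epsilon> * (cmod d)\<^sup>2) * 2 \<le> (\<epsilon> * (cmod d)\<^sup>2) * (\<epsilon> * M)"
    by (simp add: power2_eq_square mult_ac)
  moreover have "\<epsilon> * (cmod d)\<^sup>2 > 0" using d M by (simp add: \<epsilon>_def)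
  ultimately have "2 \<le> \<epsilon> * M" by (simp only: mult_le_cancel_left_pos)
  then show False using M by (simp add: \<epsilon>_def field_simps)
qed

text \<open>Greedy construction: each vector maximises the stretching by \<open>A\<close> on the
  orthogonal complement of the earlier ones, and later choices do not disturb this property.\<close>

lemma singular_vectors_exist:
  assumes A: "A \<in> carrier_mat m n" and "k \<le> n"
  shows "\<exists>w. orthonormal n k w \<and>
    (\<forall>i<k. \<forall>y\<in>carrier_vec n. (\<forall>j<i. ip y (w j) = 0) \<longrightarrow> nrm (A *\<^sub>v y) \<le> nrm (A *\<^sub>v w i) * nrm y)"
  using assms(2)
proof (induction k)
  case 0
  then show ?case by (auto simp: orthonormal_def)
next
  case (Suc k)
  then obtain w where w: "orthonormal n k w"
    "\<forall>i<k. \<forall>y\<in>carrier_vec n. (\<forall>j<i. ip y (w j) = 0) \<longrightarrow> nrm (A *\<^sub>v y) \<le> nrm (A *\<^sub>v w i) * nrm y"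
    by auto
  obtain x where x: "x \<in> carrier_vec n" "nrm x = 1" "\<And>i. i < k \<Longrightarrow> ip x (w i) = 0"
    "\<And>y. y \<in> carrier_vec n \<Longrightarrow> (\<And>i. i < k \<Longrightarrow> ip y (w i) = 0) \<Longrightarrow> nrm (A *\<^sub>v y) \<le> nrm (A *\<^sub>v x) * nrm y"
    using exists_maximiser[OF A, of k w] w(1) Suc.prems by (auto simp: orthonormal_def)
  have "ip (w i) x = 0" if "i < k" for i
    using x(3)[OF that] ip_commute[of "w i" x] x(1) w(1) that by (simp add: orthonormal_def)
  then have "orthonormal n (Suc k) (w(k := x))"
    using w(1) x by (auto simp: orthonormal_def less_Suc_eq ip_self)
  moreover have "\<forall>i<Suc k. \<forall>y\<in>carrier_vec n. (\<forall>j<i. ip y ((w(k := x)) j) = 0) \<longrightarrow>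
      nrm (A *\<^sub>v y) \<le> nrm (A *\<^sub>v (w(k := x)) i) * nrm y"
    using w(2) x(4) by (auto simp: less_Suc_eq)
  ultimately show ?case by blast
qed

lemma unitary_mat_of_orthonormal:
  assumes "orthonormal n n u"
  defines "U \<equiv> mat n n (\<lambda>(i, j). u j $ i)"
  shows "U \<in> carrier_mat n n" "adj U * U = 1\<^sub>m n" "U * adj U = 1\<^sub>m n"
proof -
  show U: "U \<in> carrier_mat n n" by (simp add: U_def)
  show 1: "adj U * U = 1\<^sub>m n"
  proof (intro eq_matI)
    fix i j assume ij: "i < dim_row (1\<^sub>m n :: complex mat)" "j < dim_col (1\<^sub>m n :: complex mat)"
    have "dim_vec (u j) = n" using assms(1) ij by (auto simp: orthonormal_def)
    then have "(adj U * U) $$ (i, j) = ip (u j) (u i)"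
      using ij by (simp add: U_def adj_def scalar_prod_def ip_def atLeast0LessThan mult.commute)
    then show "(adj U * U) $$ (i, j) = 1\<^sub>m n $$ (i, j)"
      using assms(1) ij by (simp add: orthonormal_def)
  qed (auto simp: U_def)
  show "U * adj U = 1\<^sub>m n" by (rule mat_mult_left_right_inverse[OF adj_carrier[OF U] U 1])
qed

text \<open>By first-order optimality the greedy right singular vectors have orthogonal images.
  Injectivity makes the lengths \<open>s i\<close> of these images positive, so they can be
  normalised, and \<open>n \<le> m\<close> leaves room to complete them to an orthonormal
  basis.\<close>

lemma svd_exists:
  assumes A: "A \<in> carrier_mat m n" and "n \<le> m"
    and inj: "\<And>x. x \<in> carrier_vec n \<Longrightarrow> A *\<^sub>v x = 0\<^sub>v m \<Longrightarrow> x = 0\<^sub>v n"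
  shows "\<exists>S U W. is_svd A U S W"
proof -
  obtain w where w: "orthonormal n n w"
    and max: "\<And>i y. i < n \<Longrightarrow> y \<in> carrier_vec n \<Longrightarrow> (\<And>j. j < i \<Longrightarrow> ip y (w j) = 0) \<Longrightarrow>
      nrm (A *\<^sub>v y) \<le> nrm (A *\<^sub>v w i) * nrm y"
    using singular_vectors_exist[OF A order_refl] by blast
  define s where "s i = nrm (A *\<^sub>v w i)" for i
  have wc: "w i \<in> carrier_vec n" "nrm (w i) = 1" if "i < n" for i
    using w that orthonormal_nrm by (auto simp: orthonormal_def)
  have wo: "ip (w i) (w j) = 0" if "i < n" "j < n" "i \<noteq> j" for i j
    using w that by (auto simp: orthonormal_def)
  have s_pos: "s i > 0" if "i < n" for i
  proof -
    have "w i \<noteq> 0\<^sub>v n" using wc[OF that] nrm_eq_0[of "w i" n] by auto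
    then have "A *\<^sub>v w i \<noteq> 0\<^sub>v m" using inj wc that by blast
    then have "nrm (A *\<^sub>v w i) \<noteq> 0" using nrm_eq_0[of "A *\<^sub>v w i" m] A wc that by auto
    then show ?thesis by (simp add: s_def order_less_le)
  qed
  \<comment> \<open>\<open>w j\<close> is an admissible competitor in the earlier maximisation that
    produced \<open>w i\<close>.\<close>
  have s_anti: "s j \<le> s i" if "i \<le> j" "j < n" for i j
    using max[of i "w j"] wc[of j] wo that by (auto simp: s_def)
  have orth: "ip (A *\<^sub>v w i) (A *\<^sub>v w j) = 0" if ij: "i < j" "j < n" for i j
  proof (rule maximiser_orthogonal_images[OF A])
    fix c
    have c: "w i + c \<cdot>\<^sub>v w j \<in> carrier_vec n" using wc ij by auto
    show "nrm (A *\<^sub>v (w i + c \<cdot>\<^sub>v w j)) \<le> nrm (A *\<^sub>v w i) * nrm (w i + c \<cdot>\<^sub>v w j)"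
      by (rule max[OF _ c]) (use ij wc wo in \<open>auto simp: ip_add_left[of _ n] ip_smult_left\<close>)
  qed (use ij wc wo in auto)
  define u where "u i = complex_of_real (1 / s i) \<cdot>\<^sub>v (A *\<^sub>v w i)" for i
  have Aw: "A *\<^sub>v w i \<in> carrier_vec m" if "i < n" for i using A wc that by simp
  have "orthonormal m n u"
    unfolding orthonormal_def
  proof (intro conjI allI impI)
    fix i assume "i < n" then show "u i \<in> carrier_vec m" using Aw by (simp add: u_def)
  next
    fix i j assume ij: "i < n" "j < n"
    have "ip (u i) (u j) = complex_of_real (1 / s i) * complex_of_real (1 / s j) * ip (A *\<^sub>v w i) (A *\<^sub>v w j)"
      using Aw ij by (simp add: u_def ip_smult_left ip_smult_right)
    also have "\<dots> = (if i = j then 1 else 0)"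
    proof (cases i j rule: linorder_cases)
      case less
      then show ?thesis using orth ij by simp
    next
      case equal
      then show ?thesis using s_pos[of j] ij by (simp add: ip_self s_def[symmetric] power2_eq_square)
    next
      case greater
      then have "ip (A *\<^sub>v w i) (A *\<^sub>v w j) = 0"
        using orth[of j i] ij ip_commute[of "A *\<^sub>v w i" "A *\<^sub>v w j"] by simp
      then show ?thesis using greater by simp
    qed
    finally show "ip (u i) (u j) = (if i = j then 1 else 0)" .
  qed
  then obtain u' where u': "orthonormal m m u'" "\<And>i. i < n \<Longrightarrow> u' i = u i"
    using orthonormal_extend[of m n u m] \<open>n \<le> m\<close> by blast
  define U where "U = mat m m (\<lambda>(i, j). u' j $ i)"
  define W where "W = mat n n (\<lambda>(i, j). w j $ i)"
  define S where "S = mat m n (\<lambda>(i, j). if i = j then complex_of_real (s i) else 0)"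
  note U = unitary_mat_of_orthonormal[OF u'(1), folded U_def]
  note W = unitary_mat_of_orthonormal[OF w, folded W_def]
  have S: "S \<in> carrier_mat m n" by (simp add: S_def)
  have "A * W = U * S"
  proof (intro eq_matI)
    fix i j assume "i < dim_row (U * S)" "j < dim_col (U * S)"
    then have ij: "i < m" "j < n" using U S by auto
    have "col W j = w j" using ij wc[of j] by (intro eq_vecI) (auto simp: W_def carrier_vecD)
    then have "(A * W) $$ (i, j) = (A *\<^sub>v w j) $ i"
      using A W(1) ij by simp
    also have "\<dots> = complex_of_real (s j) * u j $ i"
      using A ij s_pos[of j] by (simp add: u_def)
    also have "\<dots> = (\<Sum>l<m. u' l $ i * (if l = j then complex_of_real (s l) else 0))"
      using ij \<open>n \<le> m\<close> u'(2) by (simp add: if_distrib mult.commute cong: if_cong)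
    also have "\<dots> = (U * S) $$ (i, j)"
      using ij by (simp add: U_def S_def scalar_prod_def atLeast0LessThan)
    finally show "(A * W) $$ (i, j) = (U * S) $$ (i, j)" .
  qed (use A U S W in auto)
  then have "U * S * adj W = A * (W * adj W)"
    using assoc_mult_mat[OF A W(1) adj_carrier[OF W(1)]] by simp
  then have "A = U * S * adj W" using W(3) A by simp
  then have "is_svd A U S W"
    using A U S W s_anti s_pos \<open>n \<le> m\<close>
    by (auto simp: is_svd_def unitary_mat_def S_def less_imp_le)
  then show ?thesis by blast
qed

section \<open>Perturbation of singular subspaces\<close>

lemma is_svdD:
  assumes "is_svd A U S W" and "A \<in> carrier_mat m n"
  shows "U \<in> carrier_mat m m" "W \<in> carrier_mat n n" "S \<in> carrier_mat m n"
    and "adj U * U = 1\<^sub>m m" "adj W * W = 1\<^sub>m n" and "A = U * S * adj W"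
    and "\<And>i j. i < m \<Longrightarrow> j < n \<Longrightarrow> i \<noteq> j \<Longrightarrow> S $$ (i, j) = 0"
    and "\<And>i. i < min m n \<Longrightarrow> S $$ (i, i) \<in> \<real> \<and> 0 \<le> Re (S $$ (i, i))"
    and "\<And>i j. i \<le> j \<Longrightarrow> j < min m n \<Longrightarrow> Re (S $$ (j, j)) \<le> Re (S $$ (i, i))"
  using assms by (auto simp: is_svd_def unitary_mat_def)

text \<open>The unitary factors preserve norms, so in the coordinates
  \<open>adj W *\<^sub>v x\<close> only the diagonal factor acts.\<close>

lemma svd_nrm_sq:
  assumes svd: "is_svd A U S W" and A: "A \<in> carrier_mat m n" and x: "x \<in> carrier_vec n"
  shows "(nrm (A *\<^sub>v x))\<^sup>2 = (\<Sum>i<min m n. (Re (S $$ (i, i)))\<^sup>2 * (cmod ((adj W *\<^sub>v x) $ i))\<^sup>2)"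
    and "nrm (adj W *\<^sub>v x) = nrm x"
proof -
  have c: "U \<in> carrier_mat m m" "W \<in> carrier_mat n n" "S \<in> carrier_mat m n"
    and u: "adj U * U = 1\<^sub>m m" "adj W * W = 1\<^sub>m n" and eq: "A = U * S * adj W"
    and off: "\<And>i j. i < m \<Longrightarrow> j < n \<Longrightarrow> i \<noteq> j \<Longrightarrow> S $$ (i, j) = 0"
    and re: "\<And>i. i < min m n \<Longrightarrow> S $$ (i, i) \<in> \<real>"
    using svd A by (auto simp: is_svd_def unitary_mat_def)
  define y where "y = adj W *\<^sub>v x"
  have y: "y \<in> carrier_vec n" unfolding y_def using adj_carrier[OF c(2)] x by (rule mult_mat_vec_carrier)
  have "W * adj W = 1\<^sub>m n" by (rule mat_mult_left_right_inverse[OF adj_carrier[OF c(2)] c(2) u(2)])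
  then show "nrm (adj W *\<^sub>v x) = nrm x"
    by (intro nrm_isometry[OF adj_carrier[OF c(2)] x]) simp
  have Sy: "S *\<^sub>v y \<in> carrier_vec m" using c y by simp
  have "A *\<^sub>v x = U *\<^sub>v (S *\<^sub>v y)"
    unfolding eq y_def by (rule assoc_mult_mat_vec3[OF c(1,3) adj_carrier[OF c(2)] x])
  then have "nrm (A *\<^sub>v x) = nrm (S *\<^sub>v y)" using nrm_isometry[OF c(1) Sy u(1)] by simp
  then have "(nrm (A *\<^sub>v x))\<^sup>2 = (\<Sum>i<m. (cmod ((S *\<^sub>v y) $ i))\<^sup>2)"
    using c by (simp add: nrm_sq del: index_mult_mat_vec)
  also have "\<dots> = (\<Sum>i<m. if i < n then (Re (S $$ (i, i)))\<^sup>2 * (cmod (y $ i))\<^sup>2 else 0)"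
  proof (intro sum.cong refl)
    fix i assume i: "i \<in> {..<m}"
    have "(S *\<^sub>v y) $ i = (\<Sum>j<n. S $$ (i, j) * y $ j)"
      by (rule mult_mat_vec_index[OF c(3) y]) (use i in simp)
    also have "\<dots> = (\<Sum>j<n. if j = i then S $$ (i, i) * y $ i else 0)"
      using off i by (intro sum.cong) auto
    also have "\<dots> = (if i < n then S $$ (i, i) * y $ i else 0)" by simp
    finally show "(cmod ((S *\<^sub>v y) $ i))\<^sup>2 = (if i < n then (Re (S $$ (i, i)))\<^sup>2 * (cmod (y $ i))\<^sup>2 else 0)"
      using re[of i] i by (auto simp: norm_mult power_mult_distrib elim!: Reals_cases)
  qed
  also have "\<dots> = (\<Sum>i<min m n. (Re (S $$ (i, i)))\<^sup>2 * (cmod (y $ i))\<^sup>2)"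
    by (rule sum.mono_neutral_cong_right) auto
  finally show "(nrm (A *\<^sub>v x))\<^sup>2 = (\<Sum>i<min m n. (Re (S $$ (i, i)))\<^sup>2 * (cmod ((adj W *\<^sub>v x) $ i))\<^sup>2)"
    by (simp add: y_def)
qed

text \<open>Existence turns the chosen \<open>S\<close> into the middle factor of a genuine
  decomposition, and the diagonal of any such factor has these extremal properties.\<close>

lemma sigma_bounds:
  assumes A: "A \<in> carrier_mat m n" and "n \<le> m" "1 \<le> n"
    and inj: "\<And>x. x \<in> carrier_vec n \<Longrightarrow> A *\<^sub>v x = 0\<^sub>v m \<Longrightarrow> x = 0\<^sub>v n"
  shows "sigma_min A > 0"
    and "\<And>x. x \<in> carrier_vec n \<Longrightarrow> sigma_min A * nrm x \<le> nrm (A *\<^sub>v x)"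
    and "\<And>x. x \<in> carrier_vec n \<Longrightarrow> nrm (A *\<^sub>v x) \<le> sigma_max A * nrm x"
proof -
  define S where "S = (SOME S. \<exists>U W. is_svd A U S W)"
  have "\<exists>U W. is_svd A U S W"
    unfolding S_def by (rule someI_ex) (rule svd_exists[OF A \<open>n \<le> m\<close> inj])
  then obtain U W where svd: "is_svd A U S W" by blast
  have mn: "min m n = n" using \<open>n \<le> m\<close> by simp
  have dims: "dim_row A = m" "dim_col A = n" using A by auto
  have s_ge: "Re (S $$ (i, i)) \<ge> 0" if "i < n" for i
    using svd that mn dims by (simp add: is_svd_def)
  have s_anti: "Re (S $$ (j, j)) \<le> Re (S $$ (i, i))" if "i \<le> j" "j < n" for i j
    using svd that mn dims by (simp add: is_svd_def)
  have max: "sigma_max A = Re (S $$ (0, 0))" by (simp add: sigma_max_def sing_val_def S_def)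
  have min: "sigma_min A = Re (S $$ (n - 1, n - 1))"
    using mn dims by (simp add: sigma_min_def sing_val_def S_def)
  note sq = svd_nrm_sq[OF svd A, unfolded mn]
  have W: "W \<in> carrier_mat n n" "adj W * W = 1\<^sub>m n"
    using svd dims by (auto simp: is_svd_def unitary_mat_def)
  have nsq: "(nrm x)\<^sup>2 = (\<Sum>i<n. (cmod ((adj W *\<^sub>v x) $ i))\<^sup>2)" if "x \<in> carrier_vec n" for x
    using sq(2)[OF that] W nrm_sq[of "adj W *\<^sub>v x"] by (simp del: index_mult_mat_vec)
  show lo: "sigma_min A * nrm x \<le> nrm (A *\<^sub>v x)" if x: "x \<in> carrier_vec n" for x
  proof (rule power2_le_imp_le)
    have "(\<Sum>i<n. (sigma_min A)\<^sup>2 * (cmod ((adj W *\<^sub>v x) $ i))\<^sup>2)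
        \<le> (\<Sum>i<n. (Re (S $$ (i, i)))\<^sup>2 * (cmod ((adj W *\<^sub>v x) $ i))\<^sup>2)"
      unfolding min
      by (intro sum_mono mult_right_mono power_mono s_anti s_ge) (use \<open>1 \<le> n\<close> in auto)
    then show "(sigma_min A * nrm x)\<^sup>2 \<le> (nrm (A *\<^sub>v x))\<^sup>2"
      using sq(1)[OF x] nsq[OF x] by (simp add: power_mult_distrib sum_distrib_left)
  qed simp
  show "nrm (A *\<^sub>v x) \<le> sigma_max A * nrm x" if x: "x \<in> carrier_vec n" for x
  proof (rule power2_le_imp_le)
    have "(\<Sum>i<n. (Re (S $$ (i, i)))\<^sup>2 * (cmod ((adj W *\<^sub>v x) $ i))\<^sup>2)
        \<le> (\<Sum>i<n. (sigma_max A)\<^sup>2 * (cmod ((adj W *\<^sub>v x) $ i))\<^sup>2)"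
      unfolding max
      by (intro sum_mono mult_right_mono power_mono s_anti s_ge) (use \<open>1 \<le> n\<close> in auto)
    then show "(nrm (A *\<^sub>v x))\<^sup>2 \<le> (sigma_max A * nrm x)\<^sup>2"
      using sq(1)[OF x] nsq[OF x] by (simp add: power_mult_distrib sum_distrib_left)
    show "0 \<le> sigma_max A * nrm x" unfolding max using s_ge[of 0] \<open>1 \<le> n\<close> by simp
  qed
  \<comment> \<open>The last right singular vector, which \<open>A\<close> stretches by exactly
    \<open>sigma_min A\<close>; injectivity makes this positive.\<close>
  define x where "x = W *\<^sub>v unit_vec n (n - 1)"
  have x: "x \<in> carrier_vec n" unfolding x_def using W by simp
  have Wx: "adj W *\<^sub>v x = unit_vec n (n - 1)"
    unfolding x_def using W assoc_mult_mat_vec[OF adj_carrier[OF W(1)] W(1), of "unit_vec n (n - 1)"] by simp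
  have "(nrm x)\<^sup>2 = (\<Sum>i<n. if i = n - 1 then 1 else 0)"
    unfolding nsq[OF x] Wx by (intro sum.cong) auto
  then have "nrm x \<noteq> 0" using \<open>1 \<le> n\<close> by auto
  then have "A *\<^sub>v x \<noteq> 0\<^sub>v m" using inj[OF x] by auto
  then have nz: "nrm (A *\<^sub>v x) \<noteq> 0" using nrm_eq_0[of "A *\<^sub>v x" m] A x by simp
  have "(nrm (A *\<^sub>v x))\<^sup>2 = (\<Sum>i<n. if i = n - 1 then (sigma_min A)\<^sup>2 else 0)"
    unfolding sq(1)[OF x] Wx min by (intro sum.cong) auto
  then have "(nrm (A *\<^sub>v x))\<^sup>2 = (sigma_min A)\<^sup>2" using \<open>1 \<le> n\<close> by simp
  then have "sigma_min A \<noteq> 0" using nz by auto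
  then show "sigma_min A > 0" using s_ge[of "n - 1"] \<open>1 \<le> n\<close> min by simp
qed

lemma first_cols_isometry:
  assumes U: "U \<in> carrier_mat m m" and uu: "adj U * U = 1\<^sub>m m" and "K \<le> m"
  shows "first_cols K U \<in> carrier_mat m K" "adj (first_cols K U) * first_cols K U = 1\<^sub>m K"
proof -
  show F: "first_cols K U \<in> carrier_mat m K" using U by (simp add: first_cols_def)
  show "adj (first_cols K U) * first_cols K U = 1\<^sub>m K"
  proof (intro eq_matI)
    fix i j assume ij: "i < dim_row (1\<^sub>m K :: complex mat)" "j < dim_col (1\<^sub>m K :: complex mat)"
    have "(adj (first_cols K U) * first_cols K U) $$ (i, j) = (adj U * U) $$ (i, j)"
      using ij U \<open>K \<le> m\<close> by (simp add: adj_def first_cols_def scalar_prod_def)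
    then show "(adj (first_cols K U) * first_cols K U) $$ (i, j) = 1\<^sub>m K $$ (i, j)"
      using uu ij \<open>K \<le> m\<close> by simp
  qed (use F in auto)
qed

text \<open>The identity \<open>X * W = U * S\<close> on the first \<open>K\<close> columns; padding
  \<open>y\<close> with zeros replaces the truncated factors by the full ones.\<close>

lemma svd_first_cols:
  assumes svd: "is_svd X U S W" and X: "X \<in> carrier_mat m n" and K: "K \<le> m" "K \<le> n"
    and y: "y \<in> carrier_vec K"
  shows "X *\<^sub>v (first_cols K W *\<^sub>v y) = first_cols K U *\<^sub>v vec K (\<lambda>i. S $$ (i, i) * y $ i)"
proof -
  have c: "U \<in> carrier_mat m m" "W \<in> carrier_mat n n" "S \<in> carrier_mat m n"
    and u: "adj U * U = 1\<^sub>m m" "adj W * W = 1\<^sub>m n" and eq: "X = U * S * adj W"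
    and off: "\<And>i j. i < m \<Longrightarrow> j < n \<Longrightarrow> i \<noteq> j \<Longrightarrow> S $$ (i, j) = 0"
    using svd X by (auto simp: is_svd_def unitary_mat_def)
  have F: "first_cols K U \<in> carrier_mat m K" "first_cols K W \<in> carrier_mat n K"
    using c by (auto simp: first_cols_def)
  define w where "w = vec n (\<lambda>j. if j < K then y $ j else 0)"
  define v where "v = vec K (\<lambda>i. S $$ (i, i) * y $ i)"
  define v' where "v' = vec m (\<lambda>i. if i < K then v $ i else 0)"
  have wc: "w \<in> carrier_vec n" by (simp add: w_def)
  have vc: "v \<in> carrier_vec K" "v' \<in> carrier_vec m" by (simp_all add: v_def v'_def)
  have ext: "first_cols K Q *\<^sub>v a = Q *\<^sub>v vec p (\<lambda>j. if j < K then a $ j else 0)"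
    if Q: "Q \<in> carrier_mat p p" and a: "a \<in> carrier_vec K" and "K \<le> p" for Q p a
  proof (intro eq_vecI)
    fix i assume "i < dim_vec (Q *\<^sub>v vec p (\<lambda>j. if j < K then a $ j else 0))"
    then have i: "i < p" using Q by simp
    have FQ: "first_cols K Q \<in> carrier_mat p K" using Q by (simp add: first_cols_def)
    have "(first_cols K Q *\<^sub>v a) $ i = (\<Sum>j<K. Q $$ (i, j) * a $ j)"
      unfolding mult_mat_vec_index[OF FQ a i] using i Q by (intro sum.cong) (auto simp: first_cols_def)
    also have "\<dots> = (\<Sum>j<p. Q $$ (i, j) * vec p (\<lambda>j. if j < K then a $ j else 0) $ j)"
      by (rule sum.mono_neutral_cong_left) (use \<open>K \<le> p\<close> in auto)
    also have "\<dots> = (Q *\<^sub>v vec p (\<lambda>j. if j < K then a $ j else 0)) $ i"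
      by (rule mult_mat_vec_index[OF Q _ i, symmetric]) simp
    finally show "(first_cols K Q *\<^sub>v a) $ i = (Q *\<^sub>v vec p (\<lambda>j. if j < K then a $ j else 0)) $ i" .
  qed (use Q in \<open>auto simp: first_cols_def\<close>)
  have "S *\<^sub>v w = v'"
  proof (intro eq_vecI)
    fix i assume "i < dim_vec v'"
    then have i: "i < m" by (simp add: v'_def)
    have "(S *\<^sub>v w) $ i = (\<Sum>j<n. S $$ (i, j) * w $ j)" by (rule mult_mat_vec_index[OF c(3) wc i])
    also have "\<dots> = (\<Sum>j<n. if j = i then S $$ (i, i) * w $ i else 0)"
      using off i by (intro sum.cong) auto
    also have "\<dots> = v' $ i" using i K by (simp add: v'_def v_def w_def)
    finally show "(S *\<^sub>v w) $ i = v' $ i" .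
  qed (use c in \<open>auto simp: v'_def\<close>)
  moreover have "X *\<^sub>v (W *\<^sub>v w) = U *\<^sub>v (S *\<^sub>v (adj W *\<^sub>v (W *\<^sub>v w)))"
    unfolding eq using c wc by (intro assoc_mult_mat_vec3[OF c(1,3) adj_carrier[OF c(2)]]) simp
  moreover have "adj W *\<^sub>v (W *\<^sub>v w) = w"
    using assoc_mult_mat_vec[OF adj_carrier[OF c(2)] c(2) wc] u wc by simp
  ultimately have "X *\<^sub>v (W *\<^sub>v w) = U *\<^sub>v v'" by simp
  then show ?thesis
    using ext[OF c(2) y K(2)] ext[OF c(1) vc(1) K(1)] by (simp add: w_def v'_def v_def)
qed

text \<open>One half of Courant-Fischer. The range of \<open>B\<close> has dimension
  \<open>K\<close>, so it contains a nonzero vector orthogonal to the first \<open>K - 1\<close>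
  right singular vectors; on it \<open>X\<close> stretches by at most the singular value with index
  \<open>K - 1\<close>, and by at least \<open>c\<close>.\<close>

lemma svd_singular_value_ge:
  assumes svd: "is_svd X U S W" and X: "X \<in> carrier_mat m n" and K: "1 \<le> K" "K \<le> m" "K \<le> n"
    and B: "B \<in> carrier_mat n K" and inj: "\<And>x. x \<in> carrier_vec K \<Longrightarrow> nrm x = 1 \<Longrightarrow> nrm (B *\<^sub>v x) > 0"
    and low: "\<And>x. x \<in> carrier_vec K \<Longrightarrow> c * nrm (B *\<^sub>v x) \<le> nrm (X *\<^sub>v (B *\<^sub>v x))"
    and "i < K"
  shows "c \<le> Re (S $$ (i, i))"
proof -
  have W: "W \<in> carrier_mat n n" using svd X by (auto simp: is_svd_def)
  have s_ge: "Re (S $$ (i, i)) \<ge> 0" if "i < min m n" for i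
    using svd that X by (simp add: is_svd_def)
  have s_anti: "Re (S $$ (j, j)) \<le> Re (S $$ (i, i))" if "i \<le> j" "j < min m n" for i j
    using svd that X by (simp add: is_svd_def)
  have Km: "K - 1 < min m n" using K unfolding min_less_iff_conj by (intro conjI) linarith+
  have wc: "col W j \<in> carrier_vec n" if "j < n" for j using W by (simp add: carrier_vecI)
  have "adj B *\<^sub>v col W j \<in> carrier_vec K" if "j < K - 1" for j
    using wc[of j] that K mult_mat_vec_carrier[OF adj_carrier[OF B]] by simp
  \<comment> \<open>Orthogonality of \<open>B *\<^sub>v x\<close> to \<open>col W j\<close> is
    pulled back through \<open>adj B\<close>, so that the count of conditions takes place in
    dimension \<open>K\<close>.\<close>
  then obtain x where x: "x \<in> carrier_vec K" "nrm x = 1" "\<And>j. j < K - 1 \<Longrightarrow> ip x (adj B *\<^sub>v col W j) = 0"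
    using exists_unit_orthogonal[of "K - 1" K "\<lambda>j. adj B *\<^sub>v col W j"] K by auto
  define v where "v = B *\<^sub>v x"
  have v: "v \<in> carrier_vec n" using B x by (simp add: v_def)
  have z: "(adj W *\<^sub>v v) $ j = 0" if "j < K - 1" for j
  proof -
    have "j < n" using that K by simp
    have "(adj W *\<^sub>v v) $ j = ip v (col W j)"
      using mult_mat_vec_index[OF adj_carrier[OF W] v \<open>j < n\<close>] v W \<open>j < n\<close>
      by (simp add: adj_index[OF W] ip_def mult.commute del: index_mult_mat_vec)
    also have "\<dots> = 0"
      unfolding v_def using ip_mult_mat_vec[OF B x(1) wc[OF \<open>j < n\<close>]] x(3)[OF that] by simp
    finally show ?thesis .
  qed
  let ?s = "Re (S $$ (K - 1, K - 1))"
  have "(nrm (X *\<^sub>v v))\<^sup>2 \<le> (\<Sum>i<min m n. ?s\<^sup>2 * (cmod ((adj W *\<^sub>v v) $ i))\<^sup>2)"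
    unfolding svd_nrm_sq(1)[OF svd X v]
  proof (intro sum_mono)
    fix i assume i: "i \<in> {..<min m n}"
    show "(Re (S $$ (i, i)))\<^sup>2 * (cmod ((adj W *\<^sub>v v) $ i))\<^sup>2 \<le> ?s\<^sup>2 * (cmod ((adj W *\<^sub>v v) $ i))\<^sup>2"
    proof (cases "i < K - 1")
      case False
      then show ?thesis using i by (intro mult_right_mono power_mono s_anti s_ge) auto
    qed (simp add: z del: index_mult_mat_vec)
  qed
  also have "\<dots> \<le> (\<Sum>i<n. ?s\<^sup>2 * (cmod ((adj W *\<^sub>v v) $ i))\<^sup>2)"
    by (rule sum_mono2) auto
  also have "\<dots> = (?s * nrm v)\<^sup>2"
    using svd_nrm_sq(2)[OF svd X v] nrm_sq[of "adj W *\<^sub>v v"] W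
    by (simp add: power_mult_distrib sum_distrib_left del: index_mult_mat_vec)
  finally have "nrm (X *\<^sub>v v) \<le> ?s * nrm v"
    by (rule power2_le_imp_le) (intro mult_nonneg_nonneg nrm_ge_0 s_ge Km)
  then have "c * nrm v \<le> ?s * nrm v" using low[OF x(1)] by (simp add: v_def)
  then have "c \<le> ?s" using inj[OF x(1,2)] by (simp add: v_def)
  also have "?s \<le> Re (S $$ (i, i))" using \<open>i < K\<close> by (intro s_anti Km) simp
  finally show ?thesis .
qed

text \<open>\<open>adj A\<close> may have a kernel, but it is bounded below on the range of
  \<open>A\<close>: by Cauchy-Schwarz the squared norm of \<open>A *\<^sub>v x\<close> is at most
  \<open>nrm x\<close> times the right-hand side, and \<open>a * nrm x\<close> is at most the norm
  of \<open>A *\<^sub>v x\<close>.\<close>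

lemma adj_mult_lower:
  assumes A: "A \<in> carrier_mat m n" and a: "a > 0" and low: "\<And>x. x \<in> carrier_vec n \<Longrightarrow> a * nrm x \<le> nrm (A *\<^sub>v x)"
    and x: "x \<in> carrier_vec n"
  shows "a * nrm (A *\<^sub>v x) \<le> nrm (adj A *\<^sub>v (A *\<^sub>v x))"
proof (cases "nrm (A *\<^sub>v x) = 0")
  case False
  let ?y = "A *\<^sub>v x"
  have "complex_of_real ((nrm ?y)\<^sup>2) = ip x (adj A *\<^sub>v ?y)" by (rule nrm_mult_mat_vec_sq[OF A x])
  then have "(nrm ?y)\<^sup>2 = cmod (ip x (adj A *\<^sub>v ?y))" by (metis abs_power2 norm_of_real)
  also have "\<dots> \<le> nrm x * nrm (adj A *\<^sub>v ?y)" using x A by (intro cmod_ip_le) simp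
  finally have "a * (nrm ?y)\<^sup>2 \<le> (a * nrm x) * nrm (adj A *\<^sub>v ?y)" using a by simp
  also have "\<dots> \<le> nrm ?y * nrm (adj A *\<^sub>v ?y)" by (intro mult_right_mono low x) simp
  finally have "nrm ?y * (a * nrm ?y) \<le> nrm ?y * nrm (adj A *\<^sub>v ?y)" by (simp add: power2_eq_square mult_ac)
  moreover have "nrm ?y > 0" using False by (simp add: order_less_le)
  ultimately show ?thesis by simp
qed simp

text \<open>A \<open>sin \<Theta>\<close> bound of Wedin type: the leading left singular vectors of a perturbation of
  \<open>A B\<close> are images of the perturbed matrix divided by singular values that are at least
  \<open>a b - \<epsilon>\<close> (Weyl), so only the perturbation takes them out of the column space of \<open>A\<close>.\<close>

lemma svd_subspace_perturbation:
  assumes A: "A \<in> carrier_mat m K" and B: "B \<in> carrier_mat K n" and E: "E \<in> carrier_mat m n"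
    and K: "1 \<le> K" "K \<le> m" "K \<le> n"
    and a: "a > 0" "\<And>x. x \<in> carrier_vec K \<Longrightarrow> a * nrm x \<le> nrm (A *\<^sub>v x)"
    and b: "b > 0" "\<And>x. x \<in> carrier_vec K \<Longrightarrow> b * nrm x \<le> nrm (adj B *\<^sub>v x)"
    and e: "\<And>x. x \<in> carrier_vec n \<Longrightarrow> nrm (E *\<^sub>v x) \<le> \<epsilon> * nrm x" "0 \<le> \<epsilon>" "\<epsilon> < a * b"
    and svd: "is_svd (A * B + E) U S W"
    and P: "P \<in> carrier_mat K m" "P * A = 1\<^sub>m K"
    and contr: "\<And>x. x \<in> carrier_vec m \<Longrightarrow> nrm (x - A *\<^sub>v (P *\<^sub>v x)) \<le> nrm x"
    and y: "y \<in> carrier_vec K"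
  shows "nrm (first_cols K U *\<^sub>v y - A *\<^sub>v (P *\<^sub>v (first_cols K U *\<^sub>v y))) \<le> \<epsilon> / (a * b - \<epsilon>) * nrm y"
proof -
  define X where "X = A * B + E"
  have X: "X \<in> carrier_mat m n" using A B E by (simp add: X_def)
  have svd: "is_svd X U S W" using svd by (simp add: X_def)
  have Xx: "X *\<^sub>v x = A *\<^sub>v (B *\<^sub>v x) + E *\<^sub>v x" if "x \<in> carrier_vec n" for x
    unfolding X_def
    using add_mult_distrib_mat_vec[OF mult_carrier_mat[OF A B] E that] assoc_mult_mat_vec[OF A B that] by simp
  define \<delta> where "\<delta> = a * b - \<epsilon>"
  have \<delta>: "\<delta> > 0" using e by (simp add: \<delta>_def)
  \<comment> \<open>Tested on the range of \<open>adj B\<close>, where \<open>B\<close> stretches by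
    at least \<open>b\<close> and then \<open>A\<close> by at least \<open>a\<close>, while
    \<open>E\<close> takes away at most \<epsilon>.\<close>
  have s: "\<delta> \<le> Re (S $$ (i, i))" if "i < K" for i
  proof (rule svd_singular_value_ge[OF svd X K adj_carrier[OF B] _ _ that])
    fix x :: "complex vec" assume x: "x \<in> carrier_vec K"
    show "nrm (adj B *\<^sub>v x) > 0" if "nrm x = 1" using b(2)[OF x] b(1) that by simp
    let ?v = "adj B *\<^sub>v x"
    have v: "?v \<in> carrier_vec n" using mult_mat_vec_carrier[OF adj_carrier[OF B] x] .
    have "a * b * nrm ?v \<le> a * nrm (B *\<^sub>v ?v)"
      using adj_mult_lower[OF adj_carrier[OF B] b x] a(1) by simp
    also have "\<dots> \<le> nrm (A *\<^sub>v (B *\<^sub>v ?v))" using B v by (intro a(2)) simp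
    also have "A *\<^sub>v (B *\<^sub>v ?v) = X *\<^sub>v ?v - E *\<^sub>v ?v"
      unfolding Xx[OF v] using A B E v by (intro eq_vecI) auto
    also have "nrm \<dots> \<le> nrm (X *\<^sub>v ?v) + nrm (E *\<^sub>v ?v)" using X E v by (intro nrm_diff[of _ m]) auto
    also have "\<dots> \<le> nrm (X *\<^sub>v ?v) + \<epsilon> * nrm ?v" using e(1)[OF v] by simp
    finally show "\<delta> * nrm ?v \<le> nrm (X *\<^sub>v ?v)" by (simp add: \<delta>_def algebra_simps)
  qed
  have s_nz: "S $$ (i, i) \<noteq> 0" if "i < K" for i using s[OF that] \<delta> by auto
  \<comment> \<open>Dividing by the singular values gives the coordinates of a vector that
    \<open>X\<close> maps to the prescribed combination of left singular vectors.\<close>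
  define y' where "y' = vec K (\<lambda>i. y $ i / S $$ (i, i))"
  have y': "y' \<in> carrier_vec K" by (simp add: y'_def)
  have "\<delta> * nrm y' \<le> nrm y"
  proof -
    have "\<delta> * nrm y' = L2_set (\<lambda>i. \<delta> * cmod (y' $ i)) {..<K}"
      using \<delta> y' by (simp add: nrm_def L2_set_right_distrib)
    also have "\<dots> \<le> L2_set (\<lambda>i. cmod (y $ i)) {..<K}"
    proof (rule L2_set_mono)
      fix i assume i: "i \<in> {..<K}"
      have "\<delta> \<le> cmod (S $$ (i, i))" using s[of i] i abs_Re_le_cmod[of "S $$ (i, i)"] by auto
      then have "\<delta> * cmod (y $ i) \<le> cmod (S $$ (i, i)) * cmod (y $ i)" by (intro mult_right_mono) auto
      then show "\<delta> * cmod (y' $ i) \<le> cmod (y $ i)"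
        using i s_nz[of i] by (simp add: y'_def norm_divide divide_le_eq mult.commute)
    qed (use \<delta> in simp)
    also have "\<dots> = nrm y" using y by (simp add: nrm_def)
    finally show ?thesis .
  qed
  define x where "x = first_cols K W *\<^sub>v y'"
  have cU: "U \<in> carrier_mat m m" "adj U * U = 1\<^sub>m m" and cW: "W \<in> carrier_mat n n" "adj W * W = 1\<^sub>m n"
    using svd X by (auto simp: is_svd_def unitary_mat_def)
  note FW = first_cols_isometry[OF cW K(3)] and FU = first_cols_isometry[OF cU K(2)]
  have x: "x \<in> carrier_vec n" "nrm x = nrm y'"
    unfolding x_def using FW y' nrm_isometry by auto
  have "vec K (\<lambda>i. S $$ (i, i) * y' $ i) = y"
    using y s_nz by (intro eq_vecI) (auto simp: y'_def)
  then have Fy: "first_cols K U *\<^sub>v y = A *\<^sub>v (B *\<^sub>v x) + E *\<^sub>v x"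
    using svd_first_cols[OF svd X K(2,3) y'] Xx[OF x(1)] by (simp add: x_def)
  have Bx: "B *\<^sub>v x \<in> carrier_vec K" and Ex: "E *\<^sub>v x \<in> carrier_vec m" using B E x by auto
  have PABx: "P *\<^sub>v (A *\<^sub>v (B *\<^sub>v x)) = B *\<^sub>v x"
    using assoc_mult_mat_vec[OF P(1) A Bx] P(2) Bx by simp
  have "P *\<^sub>v (first_cols K U *\<^sub>v y) = B *\<^sub>v x + P *\<^sub>v (E *\<^sub>v x)"
    unfolding Fy using mult_add_distrib_mat_vec[OF P(1) _ Ex, of "A *\<^sub>v (B *\<^sub>v x)"] A Bx PABx by simp
  then have "A *\<^sub>v (P *\<^sub>v (first_cols K U *\<^sub>v y)) = A *\<^sub>v (B *\<^sub>v x) + A *\<^sub>v (P *\<^sub>v (E *\<^sub>v x))"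
    using mult_add_distrib_mat_vec[OF A Bx, of "P *\<^sub>v (E *\<^sub>v x)"] P Ex by simp
  \<comment> \<open>The signal part lies in the range of \<open>A\<close> and is reproduced by the
    projection, so it cancels.\<close>
  then have "first_cols K U *\<^sub>v y - A *\<^sub>v (P *\<^sub>v (first_cols K U *\<^sub>v y)) = E *\<^sub>v x - A *\<^sub>v (P *\<^sub>v (E *\<^sub>v x))"
    unfolding Fy using A Bx Ex P vec_add_diff_add[of "A *\<^sub>v (B *\<^sub>v x)" m] by simp
  then have "nrm (first_cols K U *\<^sub>v y - A *\<^sub>v (P *\<^sub>v (first_cols K U *\<^sub>v y))) \<le> \<epsilon> * nrm y'"
    using contr[OF Ex] e(1)[OF x(1)] x(2) by simp
  also have "\<dots> \<le> \<epsilon> * (nrm y / \<delta>)"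
    using \<open>\<delta> * nrm y' \<le> nrm y\<close> \<delta> e(2) by (intro mult_left_mono) (auto simp: field_simps)
  finally show ?thesis by (simp add: \<delta>_def)
qed

text \<open>Singular vectors have unit length, so Pythagoras turns the sine bound \<tau> into the
  cosine \<open>sqrt (1 - \<tau>\<^sup>2)\<close>. For the last bound, \<open>adj A\<close>
  annihilates the residual and therefore sees only the projection. ESPRIT uses the estimates on the
  projection, Matrix Pencil the one on \<open>adj A\<close>.\<close>

lemma svd_subspace_lower:
  assumes A: "A \<in> carrier_mat m K" and B: "B \<in> carrier_mat K n" and E: "E \<in> carrier_mat m n"
    and K: "1 \<le> K" "K \<le> m" "K \<le> n"
    and a: "a > 0" "\<And>x. x \<in> carrier_vec K \<Longrightarrow> a * nrm x \<le> nrm (A *\<^sub>v x)"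
    and b: "b > 0" "\<And>x. x \<in> carrier_vec K \<Longrightarrow> b * nrm x \<le> nrm (adj B *\<^sub>v x)"
    and e: "\<And>x. x \<in> carrier_vec n \<Longrightarrow> nrm (E *\<^sub>v x) \<le> \<epsilon> * nrm x" "0 \<le> \<epsilon>" "\<epsilon> < a * b"
    and svd: "is_svd (A * B + E) U S W"
  defines "\<tau> \<equiv> \<epsilon> / (a * b - \<epsilon>)"
  assumes \<tau>: "\<tau> \<le> 1"
  obtains P where "P \<in> carrier_mat K m" "first_cols K U \<in> carrier_mat m K"
    "\<And>y. y \<in> carrier_vec K \<Longrightarrow> nrm (first_cols K U *\<^sub>v y) = nrm y"
    "\<And>y. y \<in> carrier_vec K \<Longrightarrow> nrm (first_cols K U *\<^sub>v y - A *\<^sub>v (P *\<^sub>v (first_cols K U *\<^sub>v y))) \<le> \<tau> * nrm y"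
    "\<And>y. y \<in> carrier_vec K \<Longrightarrow> sqrt (1 - \<tau>\<^sup>2) * nrm y \<le> nrm (A *\<^sub>v (P *\<^sub>v (first_cols K U *\<^sub>v y)))"
    "\<And>y. y \<in> carrier_vec K \<Longrightarrow> a * sqrt (1 - \<tau>\<^sup>2) * nrm y \<le> nrm (adj A *\<^sub>v (first_cols K U *\<^sub>v y))"
proof -
  obtain P where P: "P \<in> carrier_mat K m" "P * A = 1\<^sub>m K"
    "\<And>x. x \<in> carrier_vec m \<Longrightarrow> adj A *\<^sub>v (x - A *\<^sub>v (P *\<^sub>v x)) = 0\<^sub>v K"
    "\<And>x. x \<in> carrier_vec m \<Longrightarrow> (nrm x)\<^sup>2 = (nrm (A *\<^sub>v (P *\<^sub>v x)))\<^sup>2 + (nrm (x - A *\<^sub>v (P *\<^sub>v x)))\<^sup>2"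
    by (rule left_inverse_exists[OF A a], assumption) (rule that)
  have X: "A * B + E \<in> carrier_mat m n" using E by simp
  have cU: "U \<in> carrier_mat m m" "adj U * U = 1\<^sub>m m"
    using is_svdD[OF svd X] by blast+
  note F = first_cols_isometry[OF cU K(2)]
  have iso: "nrm (first_cols K U *\<^sub>v y) = nrm y" if "y \<in> carrier_vec K" for y
    by (rule nrm_isometry[OF F(1) that F(2)])
  have \<tau>0: "0 \<le> \<tau>" using e by (simp add: \<tau>_def)
  have contr: "nrm (x - A *\<^sub>v (P *\<^sub>v x)) \<le> nrm x" if "x \<in> carrier_vec m" for x
    by (rule power2_le_imp_le) (use P(4)[OF that] in auto)
  have res: "nrm (first_cols K U *\<^sub>v y - A *\<^sub>v (P *\<^sub>v (first_cols K U *\<^sub>v y))) \<le> \<tau> * nrm y"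
    if y: "y \<in> carrier_vec K" for y
    unfolding \<tau>_def by (rule svd_subspace_perturbation[OF A B E K a b e svd P(1,2) contr y])
  have low: "sqrt (1 - \<tau>\<^sup>2) * nrm y \<le> nrm (A *\<^sub>v (P *\<^sub>v (first_cols K U *\<^sub>v y)))"
    if y: "y \<in> carrier_vec K" for y
  proof (rule power2_le_imp_le)
    have Fy: "first_cols K U *\<^sub>v y \<in> carrier_vec m" using F y by simp
    have "(nrm (first_cols K U *\<^sub>v y - A *\<^sub>v (P *\<^sub>v (first_cols K U *\<^sub>v y))))\<^sup>2 \<le> (\<tau> * nrm y)\<^sup>2"
      by (intro power_mono res y) simp
    then have "(1 - \<tau>\<^sup>2) * (nrm y)\<^sup>2 \<le> (nrm (A *\<^sub>v (P *\<^sub>v (first_cols K U *\<^sub>v y))))\<^sup>2"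
      using P(4)[OF Fy] iso[OF y] by (simp add: power_mult_distrib algebra_simps)
    moreover have "\<tau>\<^sup>2 \<le> 1" using \<tau> \<tau>0 by (simp add: power_le_one)
    ultimately show "(sqrt (1 - \<tau>\<^sup>2) * nrm y)\<^sup>2 \<le> (nrm (A *\<^sub>v (P *\<^sub>v (first_cols K U *\<^sub>v y))))\<^sup>2"
      by (simp add: power_mult_distrib)
  qed simp
  have "a * sqrt (1 - \<tau>\<^sup>2) * nrm y \<le> nrm (adj A *\<^sub>v (first_cols K U *\<^sub>v y))" if y: "y \<in> carrier_vec K" for y
  proof -
    define x where "x = first_cols K U *\<^sub>v y"
    have x: "x \<in> carrier_vec m" using F y by (simp add: x_def)
    have Px: "P *\<^sub>v x \<in> carrier_vec K" and APx: "A *\<^sub>v (P *\<^sub>v x) \<in> carrier_vec m" using P A x by auto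
    have "a * sqrt (1 - \<tau>\<^sup>2) * nrm y \<le> a * nrm (A *\<^sub>v (P *\<^sub>v x))"
      using low[OF y] a by (simp add: x_def mult.assoc)
    also have "\<dots> \<le> nrm (adj A *\<^sub>v (A *\<^sub>v (P *\<^sub>v x)))" by (rule adj_mult_lower[OF A a Px])
    also have "adj A *\<^sub>v (A *\<^sub>v (P *\<^sub>v x)) = adj A *\<^sub>v x"
    proof -
      have d: "x - A *\<^sub>v (P *\<^sub>v x) \<in> carrier_vec m" using x APx by simp
      have "adj A *\<^sub>v x = adj A *\<^sub>v (A *\<^sub>v (P *\<^sub>v x) + (x - A *\<^sub>v (P *\<^sub>v x)))"
        using vec_add_diff_cancel[OF APx x] by simp
      also have "\<dots> = adj A *\<^sub>v (A *\<^sub>v (P *\<^sub>v x)) + 0\<^sub>v K"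
        using mult_add_distrib_mat_vec[OF adj_carrier[OF A] APx d] P(3)[OF x] by simp
      also have "\<dots> = adj A *\<^sub>v (A *\<^sub>v (P *\<^sub>v x))"
        using mult_mat_vec_carrier[OF adj_carrier[OF A] APx] by simp
      finally show ?thesis by simp
    qed
    finally show ?thesis by (simp add: x_def)
  qed
  then show ?thesis using that[OF P(1) F(1) iso res low] by blast
qed

text \<open>Right singular vectors are left singular vectors of the adjoint, so one subspace
  estimate serves both sides.\<close>

lemma is_svd_adj:
  assumes "is_svd X U S W" and X: "X \<in> carrier_mat m n"
  shows "is_svd (adj X) W (adj S) U"
proof -
  note D = is_svdD[OF assms]
  have "adj X = adj (adj W) * adj (U * S)"
    unfolding D(6) by (rule adj_mult[OF mult_carrier_mat[OF D(1,3)] adj_carrier[OF D(2)]])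
  also have "\<dots> = W * adj S * adj U"
    using adj_mult[OF D(1,3)] assoc_mult_mat[OF D(2) adj_carrier[OF D(3)] adj_carrier[OF D(1)]] by simp
  finally have "adj X = W * adj S * adj U" .
  moreover have S: "adj S $$ (i, i) = S $$ (i, i)" if "i < min n m" for i
    using D(8)[of i] that adj_index[OF D(3), of i i] by (auto elim!: Reals_cases)
  moreover have "adj S $$ (i, j) = 0" if "i < n" "j < m" "i \<noteq> j" for i j
    using D(7) that adj_index[OF D(3) that(1,2)] by simp
  moreover have "Re (adj S $$ (j, j)) \<le> Re (adj S $$ (i, i))" if "i \<le> j" "j < min n m" for i j
    using S[of i] S[of j] D(9)[of i j] that by simp
  ultimately show ?thesis
    using D(1,2,4,5) D(8) adj_carrier[OF D(3)] X unfolding is_svd_def unitary_mat_def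
    by (simp add: min.commute[of m n])
qed

section \<open>Perturbation of matrix pencils\<close>

lemma smult_mat_mult_vec:
  "A \<in> carrier_mat m n \<Longrightarrow> v \<in> carrier_vec n \<Longrightarrow> (c \<cdot>\<^sub>m A) *\<^sub>v v = c \<cdot>\<^sub>v (A *\<^sub>v (v :: complex vec))"
  by (intro eq_vecI) auto

lemma vec_add_eq_0_imp:
  fixes u v :: "complex vec"
  assumes "u \<in> carrier_vec n" "v \<in> carrier_vec n" "u + v = 0\<^sub>v n"
  shows "u = - v"
proof (intro eq_vecI)
  fix i assume i: "i < dim_vec (- v)"
  then have "u $ i + v $ i = (u + v) $ i" using assms(1,2) by simp
  also have "\<dots> = 0" unfolding assms(3) using assms(2) i by simp
  finally show "u $ i = (- v) $ i" using assms(2) i by (simp add: eq_neg_iff_add_eq_0)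
qed (use assms in auto)

section \<open>Determinants of pencils and matching of their roots\<close>

lemma continuous_on_det:
  fixes M :: "'t :: topological_space \<Rightarrow> complex mat"
  assumes "\<And>t. M t \<in> carrier_mat n n"
    and "\<And>i j. i < n \<Longrightarrow> j < n \<Longrightarrow> continuous_on T (\<lambda>t. M t $$ (i, j))"
  shows "continuous_on T (\<lambda>t. det (M t))"
proof -
  have "(\<lambda>t. det (M t)) = (\<lambda>t. \<Sum>p \<in> {p. p permutes {0..<n}}. signof p * (\<Prod>i = 0..<n. M t $$ (i, p i)))"
    using det_def'[OF assms(1)] by simp
  moreover have "continuous_on T (\<lambda>t. M t $$ (i, p i))" if "p permutes {0..<n}" "i \<in> {0..<n}" for p i
    using that assms(2) permutes_in_image[OF that(1), of i] by simp
  ultimately show ?thesis by (simp only:) (intro continuous_intros, auto)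
qed

text \<open>\<open>A\<close> factors out on the left. Any solution \<open>M\<close> of
  \<open>A * M = B\<close> thus has the eigenvalues of the pencil when \<open>A\<close> is
  nonsingular, which is how the ESPRIT matrix is tied to a pencil.\<close>

lemma det_pencil_char_poly:
  assumes A: "A \<in> carrier_mat n n" and M: "M \<in> carrier_mat n n"
  shows "det (x \<cdot>\<^sub>m A - A * M) = det A * poly (char_poly (M :: complex mat)) x"
proof -
  have c: "x \<cdot>\<^sub>m 1\<^sub>m n - M \<in> carrier_mat n n" using M by (intro minus_carrier_mat)
  have "x \<cdot>\<^sub>m A - A * M = A * (x \<cdot>\<^sub>m 1\<^sub>m n - M)"
    using mult_minus_distrib_mat[OF A _ M, of "x \<cdot>\<^sub>m 1\<^sub>m n"] mult_smult_distrib[OF A one_carrier_mat] A by simp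
  then have "det (x \<cdot>\<^sub>m A - A * M) = det A * det (x \<cdot>\<^sub>m 1\<^sub>m n - M)"
    using det_mult[OF A c] by simp
  also have "x \<cdot>\<^sub>m 1\<^sub>m n - M = - char_matrix M x"
    using M by (intro eq_matI) (auto simp: char_matrix_def)
  also have "det (- char_matrix M x) = poly (char_poly M) x" by (rule char_poly_matrix[OF M, symmetric])
  finally show ?thesis .
qed

lemma det_pencil_factorization:
  assumes A: "A \<in> carrier_mat n n" and B: "B \<in> carrier_mat n n" and det: "det (A :: complex mat) \<noteq> 0"
  obtains r where "\<And>x. det (x \<cdot>\<^sub>m A - B) = det A * (\<Prod>k<n. x - r k)"
proof -
  obtain H where H: "H \<in> carrier_mat n n" "A * H = 1\<^sub>m n"
    using inverse_mat_exists[OF A det] by blast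
  define M where "M = H * B"
  have M: "M \<in> carrier_mat n n" using H B by (simp add: M_def)
  have AM: "A * M = B" unfolding M_def using assoc_mult_mat[OF A H(1) B] H(2) B by simp
  obtain as where as: "char_poly M = (\<Prod>a\<leftarrow>as. [:- a, 1:])" "length as = n"
    using char_poly_factorized[OF M] by blast
  have "det (x \<cdot>\<^sub>m A - B) = det A * (\<Prod>k<n. x - as ! k)" for x
    using det_pencil_char_poly[OF A M, of x] unfolding AM as(1) poly_prod_list
    by (simp add: prod.list_conv_set_nth as(2) o_def atLeast0LessThan)
  then show ?thesis using that by blast
qed

text \<open>The segment is admissible because \<open>\<eta> < c\<close> keeps
  \<open>C + t G1\<close> nonsingular for all \<open>t\<close> in the unit interval: there are
  always exactly \<open>K\<close> roots and none escapes to infinity. The inclusion radius is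
  uniform in \<open>t\<close>, since the perturbations only shrink towards
  \<open>t = 0\<close>.\<close>

lemma pencil_matching:
  fixes z :: "nat \<Rightarrow> complex" and K :: nat
  defines "Z \<equiv> mat K K (\<lambda>(i, j). if i = j then z i else 0)"
  assumes C: "C \<in> carrier_mat K K" and G: "G1 \<in> carrier_mat K K" "G2 \<in> carrier_mat K K"
    and z: "\<And>k. k < K \<Longrightarrow> cmod (z k) \<le> 1"
    and \<eta>: "0 \<le> \<eta>" "\<eta> < c"
    and low: "\<And>y. y \<in> carrier_vec K \<Longrightarrow> c * nrm y \<le> nrm (C *\<^sub>v y)"
    and G1: "\<And>y. y \<in> carrier_vec K \<Longrightarrow> nrm (G1 *\<^sub>v y) \<le> \<eta> * nrm y"
    and G2: "\<And>y. y \<in> carrier_vec K \<Longrightarrow> nrm (G2 *\<^sub>v y) \<le> \<eta> * nrm y"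
  obtains r d where "d \<noteq> 0" "\<And>x. det (x \<cdot>\<^sub>m (C + G1) - (Z * C + G2)) = d * (\<Prod>k<K. x - r k)"
    "\<And>k. k < K \<Longrightarrow> cmod (r k - z k) \<le> (2 * real K - 1) * (2 * \<eta> / (c - \<eta>))"
proof -
  define A where "A t = C + complex_of_real t \<cdot>\<^sub>m G1" for t
  define B where "B t = Z * C + complex_of_real t \<cdot>\<^sub>m G2" for t
  have Z: "Z \<in> carrier_mat K K" by (simp add: Z_def)
  have ZC: "Z * C \<in> carrier_mat K K" using Z C by simp
  have A: "A t \<in> carrier_mat K K" and B: "B t \<in> carrier_mat K K" for t
    using C G ZC by (auto simp: A_def B_def)
  have Av: "A t *\<^sub>v y = C *\<^sub>v y + complex_of_real t \<cdot>\<^sub>v (G1 *\<^sub>v y)" if "y \<in> carrier_vec K" for t y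
    unfolding A_def using add_mult_distrib_mat_vec[OF C _ that, of "complex_of_real t \<cdot>\<^sub>m G1"]
      smult_mat_mult_vec[OF G(1) that] G by simp
  have Bv: "B t *\<^sub>v y = Z *\<^sub>v (C *\<^sub>v y) + complex_of_real t \<cdot>\<^sub>v (G2 *\<^sub>v y)" if "y \<in> carrier_vec K" for t y
    unfolding B_def
    using add_mult_distrib_mat_vec[OF ZC _ that, of "complex_of_real t \<cdot>\<^sub>m G2"] G assoc_mult_mat_vec[OF Z C that]
      smult_mat_mult_vec[OF G(2) that] by simp
  have low': "nrm (C *\<^sub>v y) > \<eta> * nrm y" if "y \<in> carrier_vec K" "y \<noteq> 0\<^sub>v K" for y
  proof -
    have "nrm y > 0" using that nrm_eq_0[of y K] by (simp add: order_less_le)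
    then have "\<eta> * nrm y < c * nrm y" using \<eta> by simp
    then show ?thesis using low[OF that(1)] by linarith
  qed
  have detA: "det (A t) \<noteq> 0" if t: "t \<in> {0..1}" for t
  proof
    assume "det (A t) = 0"
    then obtain y where y: "y \<in> carrier_vec K" "y \<noteq> 0\<^sub>v K" "A t *\<^sub>v y = 0\<^sub>v K"
      using det_0_iff_vec_prod_zero[OF A] by blast
    have c: "C *\<^sub>v y \<in> carrier_vec K" "complex_of_real t \<cdot>\<^sub>v (G1 *\<^sub>v y) \<in> carrier_vec K" using C G y by auto
    have "C *\<^sub>v y = - (complex_of_real t \<cdot>\<^sub>v (G1 *\<^sub>v y))"
      using vec_add_eq_0_imp[OF c] y(3) Av[OF y(1)] by simp
    then have "nrm (C *\<^sub>v y) = t * nrm (G1 *\<^sub>v y)" using t by simp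
    also have "\<dots> \<le> 1 * nrm (G1 *\<^sub>v y)" using t by (intro mult_right_mono) auto
    finally show False using G1[OF y(1)] low'[OF y(1,2)] by simp
  qed
  have "\<forall>t\<in>{0..1}. \<exists>r. \<forall>x. det (x \<cdot>\<^sub>m A t - B t) = det (A t) * (\<Prod>k<K. x - r k)"
    using det_pencil_factorization[OF A B detA] by blast
  then obtain r where r: "\<And>t x. t \<in> {0..1} \<Longrightarrow> det (x \<cdot>\<^sub>m A t - B t) = det (A t) * (\<Prod>k<K. x - r t k)"
    by metis
  have near: "\<exists>j<K. cmod (r t k - z j) \<le> 2 * \<eta> / (c - \<eta>)" if t: "t \<in> {0..1}" and k: "k < K" for t k
  proof -
    define l where "l = r t k"
    have "(\<Prod>i<K. l - r t i) = 0" using k by (auto simp: l_def)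
    then have "det (l \<cdot>\<^sub>m A t - B t) = 0" using r[OF t, of l] by simp
    moreover have lc: "l \<cdot>\<^sub>m A t - B t \<in> carrier_mat K K" using B by (rule minus_carrier_mat)
    ultimately obtain y where y: "y \<in> carrier_vec K" "y \<noteq> 0\<^sub>v K" "(l \<cdot>\<^sub>m A t - B t) *\<^sub>v y = 0\<^sub>v K"
      using det_0_iff_vec_prod_zero[OF lc] by blast
    define w where "w = C *\<^sub>v y"
    have w: "w \<in> carrier_vec K" using C y by (simp add: w_def)
    have g: "G1 *\<^sub>v y \<in> carrier_vec K" "G2 *\<^sub>v y \<in> carrier_vec K" using G y by auto
    \<comment> \<open>Row \<open>i\<close> of the eigenvector equation, with the unperturbed part on
      the left; \<open>Z\<close> being diagonal decouples the rows.\<close>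
    have e: "(l - z i) * w $ i = (complex_of_real t \<cdot>\<^sub>v (G2 *\<^sub>v y - l \<cdot>\<^sub>v (G1 *\<^sub>v y))) $ i" if i: "i < K" for i
    proof -
      have "(l \<cdot>\<^sub>m A t - B t) *\<^sub>v y = l \<cdot>\<^sub>v (A t *\<^sub>v y) - B t *\<^sub>v y"
        using minus_mult_distrib_mat_vec[OF _ B y(1), of "l \<cdot>\<^sub>m A t" t] A smult_mat_mult_vec[OF A y(1)] by simp
      then have "(l \<cdot>\<^sub>v (A t *\<^sub>v y) - B t *\<^sub>v y) $ i = 0"
        using i y(3)[symmetric] by (metis index_zero_vec(1))
      moreover have "(Z *\<^sub>v w) $ i = z i * w $ i"
      proof -
        have "(Z *\<^sub>v w) $ i = (\<Sum>j<K. if j = i then z i * w $ i else 0)"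
          unfolding mult_mat_vec_index[OF Z w i] using i by (intro sum.cong) (auto simp: Z_def)
        then show ?thesis using i by simp
      qed
      ultimately show ?thesis
        unfolding Av[OF y(1)] Bv[OF y(1)] w_def[symmetric] using i w carrier_matD[OF G(1)] carrier_matD[OF G(2)] carrier_matD[OF Z]
        by (simp del: index_mult_mat_vec add: algebra_simps)
    qed
    \<comment> \<open>Replacing every distance by the smallest one gives a bound on the whole vector
      \<open>w\<close> at once.\<close>
    define \<mu> where "\<mu> = Min ((\<lambda>i. cmod (l - z i)) ` {..<K})"
    have \<mu>: "\<mu> \<in> (\<lambda>i. cmod (l - z i)) ` {..<K}" unfolding \<mu>_def using k by (intro Min_in) auto
    then obtain j where j: "j < K" "\<mu> = cmod (l - z j)" by auto
    have \<mu>_le: "\<mu> \<le> cmod (l - z i)" if "i < K" for i unfolding \<mu>_def using that by (intro Min_le) auto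
    have "\<mu> * nrm w = L2_set (\<lambda>i. \<mu> * cmod (w $ i)) {..<K}"
      using j w by (simp add: nrm_def L2_set_right_distrib)
    also have "\<dots> \<le> L2_set (\<lambda>i. cmod ((complex_of_real t \<cdot>\<^sub>v (G2 *\<^sub>v y - l \<cdot>\<^sub>v (G1 *\<^sub>v y))) $ i)) {..<K}"
    proof (rule L2_set_mono)
      fix i assume "i \<in> {..<K}"
      then show "\<mu> * cmod (w $ i) \<le> cmod ((complex_of_real t \<cdot>\<^sub>v (G2 *\<^sub>v y - l \<cdot>\<^sub>v (G1 *\<^sub>v y))) $ i)"
        using e[symmetric] \<mu>_le by (simp only: lessThan_iff norm_mult) (intro mult_right_mono, auto)
    qed (use j in simp)
    also have "\<dots> = t * nrm (G2 *\<^sub>v y - l \<cdot>\<^sub>v (G1 *\<^sub>v y))"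
    proof -
      have "dim_vec (complex_of_real t \<cdot>\<^sub>v (G2 *\<^sub>v y - l \<cdot>\<^sub>v (G1 *\<^sub>v y))) = K" using g G by simp
      then have "L2_set (\<lambda>i. cmod ((complex_of_real t \<cdot>\<^sub>v (G2 *\<^sub>v y - l \<cdot>\<^sub>v (G1 *\<^sub>v y))) $ i)) {..<K}
         = nrm (complex_of_real t \<cdot>\<^sub>v (G2 *\<^sub>v y - l \<cdot>\<^sub>v (G1 *\<^sub>v y)))" unfolding nrm_def by simp
      then show ?thesis using t by simp
    qed
    also have "\<dots> \<le> 1 * nrm (G2 *\<^sub>v y - l \<cdot>\<^sub>v (G1 *\<^sub>v y))" using t by (intro mult_right_mono) auto
    also have "\<dots> \<le> nrm (G2 *\<^sub>v y) + cmod l * nrm (G1 *\<^sub>v y)"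
      using nrm_diff[of "G2 *\<^sub>v y" K "l \<cdot>\<^sub>v (G1 *\<^sub>v y)"] g by simp
    also have "\<dots> \<le> \<eta> * nrm y + cmod l * (\<eta> * nrm y)"
      by (intro add_mono mult_left_mono G1 G2 y(1)) simp
    also have "\<dots> \<le> \<eta> * nrm y + (1 + \<mu>) * (\<eta> * nrm y)"
    proof -
      \<comment> \<open>The nodes lie in the unit disk, so the unknown modulus of \<open>l\<close>
        is at most \<open>1 + \<mu>\<close>; the resulting inequality can be solved for \<mu>
        because \<open>\<eta> < c\<close>.\<close>
      have "cmod l \<le> cmod (z j) + cmod (l - z j)" using norm_triangle_ineq[of "z j" "l - z j"] by simp
      then show ?thesis using z[OF j(1)] j(2) \<eta> by (intro add_left_mono mult_right_mono) auto
    qed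
    finally have "\<mu> * nrm w \<le> (2 + \<mu>) * \<eta> * nrm y" by (simp add: algebra_simps)
    moreover have "\<mu> * (c * nrm y) \<le> \<mu> * nrm w" using low[OF y(1)] j(2) by (intro mult_left_mono) (auto simp: w_def)
    ultimately have "(\<mu> * c) * nrm y \<le> ((2 + \<mu>) * \<eta>) * nrm y" by (simp add: mult_ac)
    moreover have "nrm y > 0" using y nrm_eq_0[of y K] by (simp add: order_less_le)
    ultimately have "\<mu> * c \<le> (2 + \<mu>) * \<eta>" by simp
    then have "\<mu> \<le> 2 * \<eta> / (c - \<eta>)" using \<eta> by (simp add: pos_le_divide_eq algebra_simps)
    then show ?thesis using j by (auto simp: l_def)
  qed
  have add0: "M + complex_of_real 0 \<cdot>\<^sub>m G = M" if "M \<in> carrier_mat K K" "G \<in> carrier_mat K K" for M G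
    using that by (intro eq_matI) auto
  \<comment> \<open>At \<open>t = 0\<close> the pencil is \<open>(x - Z) * C\<close>, whose roots
    are the nodes themselves.\<close>
  have r0: "det (x \<cdot>\<^sub>m A 0 - B 0) = det (A 0) * (\<Prod>k<K. x - z k)" for x
  proof -
    define D where "D = x \<cdot>\<^sub>m 1\<^sub>m K - Z"
    have D: "D \<in> carrier_mat K K" unfolding D_def using Z by (intro minus_carrier_mat)
    have "det D = (\<Prod>k<K. x - z k)"
    proof -
      have "upper_triangular D" unfolding D_def by (auto simp: upper_triangular_def Z_def)
      then have "det D = (\<Prod>k<K. D $$ (k, k))"
        using det_upper_triangular[OF _ D] D by (simp add: prod_list_diag_prod atLeast0LessThan)
      then show ?thesis unfolding D_def by (simp add: Z_def)
    qed
    moreover have A0: "A 0 = C" and B0: "B 0 = Z * C"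
      unfolding A_def B_def using add0 C G ZC by simp_all
    moreover have "x \<cdot>\<^sub>m C - Z * C = D * C"
      unfolding D_def
      using minus_mult_distrib_mat[OF _ Z C, of "x \<cdot>\<^sub>m 1\<^sub>m K"] mult_smult_assoc_mat[OF one_carrier_mat C] C
      by simp
    ultimately show ?thesis using det_mult[OF D C] by simp
  qed
  have "\<exists>\<pi>. \<pi> permutes {..<K} \<and> (\<forall>k<K. cmod (r 1 (\<pi> k) - z k) \<le> (2 * real K - 1) * (2 * \<eta> / (c - \<eta>)))"
  proof (rule root_matching[where f = "\<lambda>t x. det (x \<cdot>\<^sub>m A t - B t)" and c = "\<lambda>t. det (A t)"])
    show "continuous_on {0..1} (\<lambda>t. det (A t))"
      by (rule continuous_on_det[OF A]) (use C G in \<open>auto simp: A_def intro!: continuous_intros\<close>)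
    show "continuous_on {0..1} (\<lambda>t. det (x \<cdot>\<^sub>m A t - B t))" for x
    proof (rule continuous_on_det)
      show "x \<cdot>\<^sub>m A t - B t \<in> carrier_mat K K" for t using B by (rule minus_carrier_mat)
      fix i j assume "i < K" "j < K"
      then have "(x \<cdot>\<^sub>m A t - B t) $$ (i, j) = x * (C $$ (i, j) + complex_of_real t * G1 $$ (i, j))
          - ((Z * C) $$ (i, j) + complex_of_real t * G2 $$ (i, j))" for t
        using C G ZC by (simp add: A_def B_def del: index_mult_mat(1))
      then show "continuous_on {0..1} (\<lambda>t. (x \<cdot>\<^sub>m A t - B t) $$ (i, j))"
        by (auto intro!: continuous_intros)
    qed
  qed (use r detA near r0 in auto)
  then obtain \<pi> where \<pi>: "\<pi> permutes {..<K}"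
    "\<forall>k<K. cmod (r 1 (\<pi> k) - z k) \<le> (2 * real K - 1) * (2 * \<eta> / (c - \<eta>))" by blast
  have smult1: "complex_of_real 1 \<cdot>\<^sub>m G = G" for G by (rule eq_matI) auto
  have A1: "A 1 = C + G1" and B1: "B 1 = Z * C + G2"
    unfolding A_def B_def smult1 by simp_all
  have "det (x \<cdot>\<^sub>m (C + G1) - (Z * C + G2)) = det (A 1) * (\<Prod>k<K. x - r 1 (\<pi> k))" for x
    using r[of 1 x] prod.permute[OF \<pi>(1), of "\<lambda>k. x - r 1 k"] by (simp add: A1 B1 o_def)
  then show ?thesis using that[of "det (A 1)" "r 1 \<circ> \<pi>"] detA[of 1] \<pi>(2) by auto
qed

section \<open>Vandermonde and Hankel matrices\<close>

lemma amin_le: "k < K \<Longrightarrow> amin K f \<le> cmod (f k)"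
  unfolding amin_def by (intro Min_le) auto

lemma amax_ge: "k < K \<Longrightarrow> cmod (f k) \<le> amax K f"
  unfolding amax_def by (intro Max_ge) auto

lemma vandermonde_carrier [simp]: "vandermonde M K z \<in> carrier_mat M K"
  by (simp add: vandermonde_def)

lemma vandermonde_mult_vec_index:
  "c \<in> carrier_vec K \<Longrightarrow> l < M \<Longrightarrow> (vandermonde M K z *\<^sub>v c) $ l = (\<Sum>k<K. z k ^ l * c $ k)"
  unfolding mult_mat_vec_index[OF vandermonde_carrier] by (intro sum.cong) (auto simp: vandermonde_def)

text \<open>Combining the rows with the coefficients of the polynomial that vanishes at all nodes
  except \<open>z i\<close> isolates \<open>c $ i\<close>. Its degree \<open>K - 1\<close> is below
  \<open>M\<close>, so the required rows exist.\<close>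

lemma vandermonde_injective:
  assumes inj: "inj_on z {..<K}" and "K \<le> M" and c: "c \<in> carrier_vec K"
    and 0: "vandermonde M K z *\<^sub>v c = 0\<^sub>v M"
  shows "c = 0\<^sub>v K"
proof (intro eq_vecI)
  fix i assume "i < dim_vec (0\<^sub>v K :: complex vec)"
  then have i: "i < K" by simp
  define p where "p = (\<Prod>j\<in>{..<K} - {i}. [:- z j, 1:])"
  have "degree p = K - 1" unfolding p_def by (subst degree_prod_eq_sum_degree) (use i in auto)
  then have deg: "l < M" if "l \<le> degree p" for l using that i \<open>K \<le> M\<close> by linarith
  have "(\<Sum>k<K. poly p (z k) * c $ k) = (\<Sum>k<K. \<Sum>l\<le>degree p. coeff p l * (z k ^ l * c $ k))"
    by (simp add: poly_altdef sum_distrib_right mult.assoc)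
  also have "\<dots> = (\<Sum>l\<le>degree p. coeff p l * (\<Sum>k<K. z k ^ l * c $ k))"
    by (subst sum.swap) (simp add: sum_distrib_left)
  also have "\<dots> = (\<Sum>l\<le>degree p. coeff p l * (vandermonde M K z *\<^sub>v c) $ l)"
    using vandermonde_mult_vec_index[OF c deg] by (intro sum.cong) (auto simp del: index_mult_mat_vec)
  also have "\<dots> = 0" unfolding 0 by (intro sum.neutral) (use deg in auto)
  finally have "(\<Sum>k<K. poly p (z k) * c $ k) = 0" .
  moreover have "poly p (z k) = 0" if "k < K" "k \<noteq> i" for k
    using that by (auto simp: p_def poly_prod)
  then have "(\<Sum>k<K. poly p (z k) * c $ k) = (\<Sum>k<K. if k = i then poly p (z i) * c $ i else 0)"
    by (intro sum.cong) auto
  ultimately have "poly p (z i) * c $ i = 0" using i by simp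
  moreover have "poly p (z i) \<noteq> 0"
    using inj i by (auto simp: p_def poly_prod inj_on_def)
  ultimately show "c $ i = 0\<^sub>v K $ i" using i by simp
qed (use c in simp)

lemma vandermonde_sigma:
  assumes "inj_on z {..<K}" "K \<le> M" "1 \<le> K"
  shows "sigma_min (vandermonde M K z) > 0"
    and "x \<in> carrier_vec K \<Longrightarrow> sigma_min (vandermonde M K z) * nrm x \<le> nrm (vandermonde M K z *\<^sub>v x)"
    and "x \<in> carrier_vec K \<Longrightarrow> nrm (vandermonde M K z *\<^sub>v x) \<le> sigma_max (vandermonde M K z) * nrm x"
  using sigma_bounds[OF vandermonde_carrier assms(2,3) vandermonde_injective[OF assms(1,2)]] by blast+

lemma nrm_unit_vec [simp]: "i < n \<Longrightarrow> nrm (unit_vec n i) = 1"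
proof -
  assume i: "i < n"
  have "(nrm (unit_vec n i))\<^sup>2 = (\<Sum>j<n. if j = i then 1 else 0)"
    unfolding nrm_sq using i by (intro sum.cong) auto
  then have "(nrm (unit_vec n i))\<^sup>2 = 1" using i by simp
  then show ?thesis using nrm_ge_0[of "unit_vec n i"] by (simp add: power2_eq_1_iff)
qed

lemma nrm_vandermonde_mono:
  assumes "x \<in> carrier_vec K" "M \<le> M'"
  shows "nrm (vandermonde M K z *\<^sub>v x) \<le> nrm (vandermonde M' K z *\<^sub>v x)"
proof (rule power2_le_imp_le)
  have *: "(nrm (vandermonde M K z *\<^sub>v x))\<^sup>2 = (\<Sum>l<M. (cmod (\<Sum>k<K. z k ^ l * x $ k))\<^sup>2)" for M
    unfolding nrm_sq using vandermonde_mult_vec_index[OF assms(1)]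
    by (simp add: vandermonde_def del: index_mult_mat_vec)
  show "(nrm (vandermonde M K z *\<^sub>v x))\<^sup>2 \<le> (nrm (vandermonde M' K z *\<^sub>v x))\<^sup>2"
    unfolding * by (rule sum_mono2) (use assms in auto)
qed simp

text \<open>Adding rows only lengthens the image of a unit vector. For \<open>M' = M + 1\<close>
  this gives \<open>1 \<le> \<beta>\<close>, for \<open>M' = M\<close> it gives
  \<open>1 \<le> kappa\<close>.\<close>

lemma vandermonde_sigma_min_le_max:
  assumes "inj_on z {..<K}" "K \<le> M" "M \<le> M'" "1 \<le> K"
  shows "sigma_min (vandermonde M K z) \<le> sigma_max (vandermonde M' K z)"
proof -
  have u: "unit_vec K 0 \<in> carrier_vec K" "nrm (unit_vec K 0) = 1" using assms by auto
  show ?thesis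
    using vandermonde_sigma(2)[OF assms(1,2,4) u(1)] nrm_vandermonde_mono[OF u(1) assms(3), of z]
      vandermonde_sigma(3)[OF assms(1) order_trans[OF assms(2,3)] assms(4) u(1)] u(2) by simp
qed

section \<open>Hankel matrices of exponential sums and of noise\<close>

text \<open>The diagonal matrix of the weights times the transposed (not conjugated) Vandermonde
  matrix: the right factor of a noiseless Hankel matrix.\<close>

definition weighted_rows :: "nat \<Rightarrow> nat \<Rightarrow> (nat \<Rightarrow> complex) \<Rightarrow> (nat \<Rightarrow> complex) \<Rightarrow> complex mat" where
  "weighted_rows K n \<alpha> z = mat K n (\<lambda>(k, j). \<alpha> k * z k ^ j)"

lemma weighted_rows_carrier [simp]: "weighted_rows K n \<alpha> z \<in> carrier_mat K n"
  by (simp add: weighted_rows_def)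

lemma adj_weighted_rows_lower:
  assumes "inj_on z {..<K}" "K \<le> n" "1 \<le> K" "amin K \<alpha> > 0" and x: "x \<in> carrier_vec K"
  shows "amin K \<alpha> * sigma_min (vandermonde n K z) * nrm x \<le> nrm (adj (weighted_rows K n \<alpha> z) *\<^sub>v x)"
proof -
  \<comment> \<open>Conjugating the whole product leaves moduli unchanged and turns the adjoint into
    the Vandermonde matrix itself, applied to this vector.\<close>
  define w where "w = vec K (\<lambda>k. \<alpha> k * cnj (x $ k))"
  have w: "w \<in> carrier_vec K" by (simp add: w_def)
  have "amin K \<alpha> * nrm x = L2_set (\<lambda>k. amin K \<alpha> * cmod (x $ k)) {..<K}"
    using x assms(4) by (simp add: nrm_def L2_set_right_distrib)
  also have "\<dots> \<le> L2_set (\<lambda>k. cmod (w $ k)) {..<K}"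
    by (rule L2_set_mono) (use assms(4) amin_le in \<open>auto simp: w_def norm_mult intro!: mult_right_mono\<close>)
  also have "\<dots> = nrm w" using w by (simp add: nrm_def)
  finally have 1: "amin K \<alpha> * nrm x \<le> nrm w" .
  have "cmod ((adj (weighted_rows K n \<alpha> z) *\<^sub>v x) $ j) = cmod ((vandermonde n K z *\<^sub>v w) $ j)" if "j < n" for j
  proof -
    have "(adj (weighted_rows K n \<alpha> z) *\<^sub>v x) $ j = (\<Sum>k<K. cnj (\<alpha> k * z k ^ j) * x $ k)"
      unfolding mult_mat_vec_index[OF adj_carrier[OF weighted_rows_carrier] x that]
    proof (intro sum.cong refl)
      fix k assume "k \<in> {..<K}"
      then have "adj (weighted_rows K n \<alpha> z) $$ (j, k) = cnj (\<alpha> k * z k ^ j)"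
        using that by (subst adj_index[OF weighted_rows_carrier]) (auto simp: weighted_rows_def)
      then show "adj (weighted_rows K n \<alpha> z) $$ (j, k) * x $ k = cnj (\<alpha> k * z k ^ j) * x $ k" by simp
    qed
    also have "\<dots> = cnj ((vandermonde n K z *\<^sub>v w) $ j)"
      unfolding vandermonde_mult_vec_index[OF w that] by (auto simp: w_def intro!: sum.cong)
    finally show ?thesis by simp
  qed
  then have 2: "nrm (adj (weighted_rows K n \<alpha> z) *\<^sub>v x) = nrm (vandermonde n K z *\<^sub>v w)"
    unfolding nrm_def
    by (intro L2_set_cong) (auto simp: weighted_rows_def vandermonde_def simp del: index_mult_mat_vec)
  have "amin K \<alpha> * sigma_min (vandermonde n K z) * nrm x \<le> sigma_min (vandermonde n K z) * nrm w"
    using 1 vandermonde_sigma(1)[OF assms(1-3)] by (simp add: mult.commute mult.left_commute)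
  also have "\<dots> \<le> nrm (vandermonde n K z *\<^sub>v w)" by (rule vandermonde_sigma(2)[OF assms(1-3) w])
  finally show ?thesis using 2 by simp
qed

text \<open>Sizes are carried in the form \<open>L + n = M + 1\<close> from here on, which avoids
  truncated subtraction.\<close>

lemma hankel_carrier: "L + n = M + 1 \<Longrightarrow> 1 \<le> n \<Longrightarrow> hankel L M y \<in> carrier_mat L n"
proof -
  assume "L + n = M + 1" "1 \<le> n"
  then have "M - L + 1 = n" by linarith
  then show ?thesis unfolding hankel_def by auto
qed

lemma hankel_exponential_sum:
  assumes "L + n = M + 1" "1 \<le> n" and y: "\<And>i. i < M \<Longrightarrow> y i = (\<Sum>k<K. \<alpha> k * z k ^ i) + e i"
  shows "hankel L M y = vandermonde L K z * weighted_rows K n \<alpha> z + hankel L M e"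
proof (intro eq_matI)
  have V: "vandermonde L K z * weighted_rows K n \<alpha> z \<in> carrier_mat L n"
    using vandermonde_carrier weighted_rows_carrier by (rule mult_carrier_mat)
  note H = hankel_carrier[OF assms(1,2), of e]
  fix i j assume "i < dim_row (vandermonde L K z * weighted_rows K n \<alpha> z + hankel L M e)"
    "j < dim_col (vandermonde L K z * weighted_rows K n \<alpha> z + hankel L M e)"
  then have ij: "i < L" "j < n" using V H by auto
  have "(vandermonde L K z * weighted_rows K n \<alpha> z) $$ (i, j) = (\<Sum>k<K. z k ^ i * (\<alpha> k * z k ^ j))"
    using ij by (simp add: vandermonde_def weighted_rows_def scalar_prod_def atLeast0LessThan)
  also have "\<dots> = (\<Sum>k<K. \<alpha> k * z k ^ (i + j))" by (simp add: power_add mult_ac)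
  finally show "hankel L M y $$ (i, j) = (vandermonde L K z * weighted_rows K n \<alpha> z + hankel L M e) $$ (i, j)"
    using ij assms by (simp add: hankel_def weighted_rows_def)
qed (use carrier_matD[OF hankel_carrier[OF assms(1,2)]] in simp_all)

lemma vnorm_ge_0 [simp]: "0 \<le> vnorm N e"
  by (simp add: vnorm_def sum_nonneg)

text \<open>Each noise sample occurs at most once in every row and at most once in every column, so
  the squared Frobenius norm is at most \<open>min L n\<close> times that of the noise vector. The
  shift \<open>s\<close> covers both Matrix Pencil matrices.\<close>

lemma hankel_norm_bound:
  assumes Ln: "L + n = M + 1" "1 \<le> n" and "M + s \<le> N" and x: "x \<in> carrier_vec n"
  shows "nrm (hankel L M (\<lambda>i. e (i + s)) *\<^sub>v x) \<le> sqrt (real (min L n)) * vnorm N e * nrm x"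
proof -
  define S where "S = (\<Sum>q<N. (cmod (e q))\<^sup>2)"
  have sub: "(\<Sum>j<p. (cmod (e (i + j + s)))\<^sup>2) \<le> S" if "i + p + s \<le> N" for i p
  proof -
    have "(\<Sum>j<p. (cmod (e (i + j + s)))\<^sup>2) = (\<Sum>q\<in>(\<lambda>j. i + j + s) ` {..<p}. (cmod (e q))\<^sup>2)"
      by (subst sum.reindex) (auto simp: inj_on_def)
    also have "\<dots> \<le> S" unfolding S_def by (rule sum_mono2) (use that in auto)
    finally show ?thesis .
  qed
  have rows: "(\<Sum>i<L. \<Sum>j<n. (cmod (e (i + j + s)))\<^sup>2) \<le> (\<Sum>i<L. S)"
    by (intro sum_mono sub) (use assms in auto)
  have "(\<Sum>i<L. \<Sum>j<n. (cmod (e (i + j + s)))\<^sup>2) = (\<Sum>j<n. \<Sum>i<L. (cmod (e (j + i + s)))\<^sup>2)"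
    by (subst sum.swap) (simp add: add.commute)
  also have "\<dots> \<le> (\<Sum>j<n. S)"
    by (intro sum_mono sub) (use assms in auto)
  finally have "(\<Sum>i<L. \<Sum>j<n. (cmod (e (i + j + s)))\<^sup>2) \<le> real (min L n) * S"
    using rows by (cases "L \<le> n") (auto simp: min_def)
  moreover have "(\<Sum>i<L. \<Sum>j<n. (cmod (hankel L M (\<lambda>i. e (i + s)) $$ (i, j)))\<^sup>2) = (\<Sum>i<L. \<Sum>j<n. (cmod (e (i + j + s)))\<^sup>2)"
    by (intro sum.cong) (use Ln in \<open>auto simp: hankel_def\<close>)
  ultimately have "sqrt (\<Sum>i<L. \<Sum>j<n. (cmod (hankel L M (\<lambda>i. e (i + s)) $$ (i, j)))\<^sup>2) \<le> sqrt (real (min L n)) * vnorm N e"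
    by (simp add: vnorm_def S_def real_sqrt_mult[symmetric])
  then show ?thesis
    using nrm_mult_mat_vec_le_frobenius[OF hankel_carrier[OF Ln] x] mult_right_mono[OF _ nrm_ge_0] order_trans by meson
qed

section \<open>Numerical estimates and the chordal metric\<close>

text \<open>The hypothesis on \<gamma> amounts to \<open>sqrt 2 * \<beta> * \<tau> < 1\<close>. As
  \<open>1 \<le> \<beta>\<close>, this forces \<open>\<tau> \<le> 1 / sqrt 2\<close>, hence a cosine
  of at least \<open>1 / sqrt 2\<close>; this is the origin of the constant
  \<open>sqrt 2\<close>.\<close>

lemma esprit_bound_arith:
  fixes \<beta> \<gamma> \<sigma> \<sigma>' :: real
  assumes "0 \<le> \<gamma>" "\<sigma>' > 0" "\<sigma>' \<le> \<sigma>" and \<beta>: "\<beta> = \<sigma> / \<sigma>'" and \<gamma>: "\<gamma> < 1 / (1 + sqrt 2 * \<beta>)"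
    and \<tau>: "\<tau> = \<gamma> / (1 - \<gamma>)" and c: "c = sqrt (1 - \<tau>\<^sup>2) / \<sigma>" and \<eta>: "\<eta> = \<tau> / \<sigma>'"
  shows "\<gamma> < 1" "\<tau> \<le> 1" "0 \<le> \<eta>" "\<eta> < c"
    "2 * \<eta> / (c - \<eta>) \<le> 2 * (sqrt 2 * \<beta> * \<gamma> / (1 - (1 + sqrt 2 * \<beta>) * \<gamma>))"
    "0 \<le> sqrt 2 * \<beta> * \<gamma> / (1 - (1 + sqrt 2 * \<beta>) * \<gamma>)"
proof -
  have \<beta>1: "1 \<le> \<beta>" using assms by simp
  have s2: "sqrt 2 > 1" by simp
  have "0 \<le> sqrt 2 * \<beta>" using \<beta>1 by simp
  then have "1 + sqrt 2 * \<beta> > 0" by linarith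
  then have key: "(1 + sqrt 2 * \<beta>) * \<gamma> < 1" using \<gamma> by (simp add: pos_less_divide_eq mult.commute)
  then have key': "sqrt 2 * \<beta> * \<gamma> < 1 - \<gamma>" by (simp add: algebra_simps)
  have "0 \<le> sqrt 2 * \<beta> * \<gamma>" using \<beta>1 assms(1) by simp
  then show \<gamma>1: "\<gamma> < 1" using key' by linarith
  have "sqrt 2 * \<gamma> \<le> sqrt 2 * \<beta> * \<gamma>" using \<beta>1 assms(1) by (simp add: mult_right_mono)
  then have "sqrt 2 * \<gamma> \<le> 1 - \<gamma>" using key' by linarith
  then have st: "sqrt 2 * \<tau> \<le> 1" using \<gamma>1 by (simp add: \<tau> divide_le_eq)
  have \<tau>0: "0 \<le> \<tau>" using \<gamma>1 assms(1) by (simp add: \<tau>)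
  have "\<tau> \<le> sqrt 2 * \<tau>" using \<tau>0 s2 by (simp add: mult_le_cancel_right1)
  then show "\<tau> \<le> 1" using st by linarith
  show "0 \<le> \<eta>" using \<tau>0 assms(2) by (simp add: \<eta>)
  have "(sqrt 2 * \<tau>)\<^sup>2 \<le> 1" using st \<tau>0 by (simp add: power_le_one)
  then have "1 \<le> 2 * (1 - \<tau>\<^sup>2)" by (simp add: power_mult_distrib)
  then have "sqrt 1 \<le> sqrt (2 * (1 - \<tau>\<^sup>2))" by (rule real_sqrt_le_mono)
  then have cos: "1 \<le> sqrt 2 * sqrt (1 - \<tau>\<^sup>2)" by (simp only: real_sqrt_mult real_sqrt_one)
  define C where "C = sqrt (1 - \<tau>\<^sup>2)"
  have "sqrt 2 * \<beta> * \<tau> < 1" using key' \<gamma>1 by (simp add: \<tau> divide_less_eq)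
  then have "sqrt 2 * (\<beta> * \<tau>) < sqrt 2 * C" using cos unfolding C_def mult.assoc by linarith
  then have bt: "\<beta> * \<tau> < C" by simp
  have \<sigma>: "\<sigma> > 0" using assms by simp
  \<comment> \<open>Both \<eta> and \<open>c\<close> are now multiples of
    \<open>1 / \<sigma>\<close>, so their comparison involves only \<beta>, \<tau> and the
    cosine.\<close>
  have e\<sigma>: "\<eta> = \<beta> * \<tau> / \<sigma>" using \<sigma> assms(2) by (simp add: \<eta> \<beta>)
  show "\<eta> < c" unfolding e\<sigma> c C_def[symmetric] using bt \<sigma> by (simp add: divide_strict_right_mono)
  have "2 * \<eta> / (c - \<eta>) = 2 * (\<beta> * \<tau>) / (C - \<beta> * \<tau>)"
    unfolding e\<sigma> c C_def[symmetric] using \<sigma> by (simp add: diff_divide_distrib[symmetric])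
  also have "\<dots> \<le> 2 * (sqrt 2 * (\<beta> * \<tau>)) / (1 - sqrt 2 * (\<beta> * \<tau>))"
  proof -
    have "2 * (\<beta> * \<tau>) / (C - \<beta> * \<tau>) = 2 * (sqrt 2 * (\<beta> * \<tau>)) / (sqrt 2 * C - sqrt 2 * (\<beta> * \<tau>))"
      using bt by (simp add: right_diff_distrib[symmetric])
    also have "\<dots> \<le> 2 * (sqrt 2 * (\<beta> * \<tau>)) / (1 - sqrt 2 * (\<beta> * \<tau>))"
    proof (intro divide_left_mono mult_pos_pos)
      show "1 - sqrt 2 * (\<beta> * \<tau>) \<le> sqrt 2 * C - sqrt 2 * (\<beta> * \<tau>)" using cos by (simp add: C_def)
      show "0 < 1 - sqrt 2 * (\<beta> * \<tau>)" using \<open>sqrt 2 * \<beta> * \<tau> < 1\<close> by (simp add: mult.assoc)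
      then show "0 < sqrt 2 * C - sqrt 2 * (\<beta> * \<tau>)" using cos unfolding C_def by linarith
    qed (use \<beta>1 \<tau>0 in simp)
    finally show ?thesis .
  qed
  also have "\<dots> = 2 * (sqrt 2 * \<beta> * \<gamma> / (1 - (1 + sqrt 2 * \<beta>) * \<gamma>))"
  proof -
    have "1 - sqrt 2 * (\<beta> * \<tau>) = (1 - (1 + sqrt 2 * \<beta>) * \<gamma>) / (1 - \<gamma>)"
      using \<gamma>1 by (simp add: \<tau> field_simps)
    then show ?thesis using \<gamma>1 by (simp add: \<tau>)
  qed
  finally show "2 * \<eta> / (c - \<eta>) \<le> 2 * (sqrt 2 * \<beta> * \<gamma> / (1 - (1 + sqrt 2 * \<beta>) * \<gamma>))" .
  show "0 \<le> sqrt 2 * \<beta> * \<gamma> / (1 - (1 + sqrt 2 * \<beta>) * \<gamma>)"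
    using key \<open>0 \<le> sqrt 2 * \<beta> * \<gamma>\<close> by simp
qed

text \<open>One cosine is lost on the left and one on the right, so \<open>\<eta> / c\<close> is
  \<gamma> divided by the squared cosine, which is
  \<open>(1 - 2 * \<gamma>) / (1 - \<gamma>)^2\<close>. What remains is an inequality between
  polynomials in \<gamma>.\<close>

lemma pencil_bound_arith:
  fixes \<gamma> \<tau> a b \<epsilon> :: real
  assumes "a > 0" "b > 0" "0 \<le> \<epsilon>" "\<gamma> = \<epsilon> / (a * b)" and \<gamma>: "\<gamma> < 7 / 25" and \<tau>: "\<tau> = \<gamma> / (1 - \<gamma>)"
    and c: "c = b * sqrt (1 - \<tau>\<^sup>2)" and \<eta>: "\<eta> = \<epsilon> / (a * sqrt (1 - \<tau>\<^sup>2))" and "1 \<le> \<rho>"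
  shows "\<tau> < 1" "0 \<le> \<eta>" "\<eta> < c"
    "2 * \<eta> / (c - \<eta>) \<le> \<gamma> * (2 * sqrt 2 / (1 - \<gamma>) * \<rho> + (1 + sqrt 2 * \<gamma> / (1 - \<gamma>)))"
proof -
  have \<gamma>0: "0 \<le> \<gamma>" using assms by simp
  then show \<tau>1: "\<tau> < 1" using \<gamma> by (simp add: \<tau> divide_less_eq)
  have \<tau>0: "0 \<le> \<tau>" using \<gamma>0 \<gamma> by (simp add: \<tau>)
  have t2: "\<tau>\<^sup>2 < 1" using \<tau>0 \<tau>1 by (simp add: power_less_one_iff)
  define C where "C = sqrt (1 - \<tau>\<^sup>2)"
  have C: "C > 0" "C\<^sup>2 = 1 - \<tau>\<^sup>2" using t2 by (auto simp: C_def)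
  have C2: "C\<^sup>2 = (1 - 2 * \<gamma>) / (1 - \<gamma>)\<^sup>2"
  proof -
    have "C\<^sup>2 = ((1 - \<gamma>)\<^sup>2 - \<gamma>\<^sup>2) / (1 - \<gamma>)\<^sup>2"
      unfolding C(2) \<tau> power_divide using \<gamma> by (simp add: diff_divide_distrib)
    moreover have "(1 - \<gamma>)\<^sup>2 - \<gamma>\<^sup>2 = 1 - 2 * \<gamma>" by (simp add: power2_eq_square algebra_simps)
    ultimately show ?thesis by simp
  qed
  have \<epsilon>: "\<epsilon> = \<gamma> * (a * b)" using assms by simp
  show "0 \<le> \<eta>" using assms(1,3) C by (simp add: \<eta> C_def[symmetric])
  have e: "\<eta> = (\<gamma> / C\<^sup>2) * (b * C)" unfolding \<eta> \<epsilon> C_def[symmetric] using assms(1,2) C(1) by (simp add: power2_eq_square)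
  \<comment> \<open>With \<open>sqrt 2\<close> replaced by \<open>7/5\<close> the target is
    \<open>14/5 / (1 - \<gamma>) + 1\<close>, that is
    \<open>(19/5 - \<gamma>) / (1 - \<gamma>)\<close>. In the difference the linear part
    \<open>9/5 - 32/5 * \<gamma>\<close> is positive below \<open>9/32\<close>, which exceeds
    \<open>7/25\<close>, and the square absorbs the cube.\<close>
  have p1: "2 * (1 - \<gamma>) ^ 3 \<le> (19/5 - \<gamma>) * ((1 - 2 * \<gamma>) - \<gamma> * (1 - \<gamma>)\<^sup>2)"
  proof -
    have "(19/5 - \<gamma>) * ((1 - 2 * \<gamma>) - \<gamma> * (1 - \<gamma>)\<^sup>2) - 2 * (1 - \<gamma>) ^ 3
      = 9/5 - 32/5 * \<gamma> + 23/5 * \<gamma>\<^sup>2 - 19/5 * \<gamma> ^ 3 + \<gamma> ^ 4 "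
      by (simp add: power2_eq_square power3_eq_cube power4_eq_xxxx field_simps)
    moreover have "\<gamma> ^ 3 \<le> \<gamma>\<^sup>2 * (7/25)"
      unfolding power3_eq_cube power2_eq_square using \<gamma> by (intro mult_left_mono) auto
    moreover have "0 \<le> \<gamma> ^ 4" "0 \<le> \<gamma>\<^sup>2" by simp_all
    ultimately show ?thesis using \<gamma> \<gamma>0 by linarith
  qed
  have dpos: "(1 - 2 * \<gamma>) - \<gamma> * (1 - \<gamma>)\<^sup>2 > 0"
  proof -
    have "\<gamma> * (1 - \<gamma>)\<^sup>2 \<le> \<gamma> * 1" using \<gamma> \<gamma>0 by (intro mult_left_mono) (auto simp: power_le_one)
    then show ?thesis using \<gamma> by linarith
  qed
  have q: "\<gamma> / C\<^sup>2 = \<gamma> * (1 - \<gamma>)\<^sup>2 / (1 - 2 * \<gamma>)" unfolding C2 by simp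
  have q1: "\<gamma> / C\<^sup>2 < 1" unfolding q using dpos \<gamma> by (simp add: divide_less_eq)
  then have "(\<gamma> / C\<^sup>2) * (b * C) < 1 * (b * C)" using assms(2) C(1) by (intro mult_strict_right_mono) auto
  then show "\<eta> < c" unfolding e c C_def[symmetric] by simp
  have "2 * \<eta> / (c - \<eta>) = 2 * (\<gamma> / C\<^sup>2) / (1 - \<gamma> / C\<^sup>2)"
  proof -
    have "c - \<eta> = (1 - \<gamma> / C\<^sup>2) * (b * C)" by (simp add: e c C_def[symmetric] algebra_simps)
    then show ?thesis unfolding e using assms(2) C(1) by simp
  qed
  also have "\<dots> = 2 * \<gamma> * (1 - \<gamma>)\<^sup>2 / ((1 - 2 * \<gamma>) - \<gamma> * (1 - \<gamma>)\<^sup>2)"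
  proof -
    have "2 * (x / y) / (1 - x / y) = 2 * x / (y - x)" if "y \<noteq> 0" for x y :: real
    proof -
      have "1 - x / y = (y - x) / y" using that by (simp add: diff_divide_distrib)
      then show ?thesis using that by simp
    qed
    from this[of "1 - 2 * \<gamma>" "\<gamma> * (1 - \<gamma>)\<^sup>2"] show ?thesis
      unfolding q using \<gamma> by (simp add: mult.assoc)
  qed
  also have "\<dots> = \<gamma> * (2 * (1 - \<gamma>) ^ 3 / ((1 - 2 * \<gamma>) - \<gamma> * (1 - \<gamma>)\<^sup>2)) / (1 - \<gamma>)"
    using \<gamma> by (simp add: power2_eq_square power3_eq_cube)
  also have "\<dots> \<le> \<gamma> * (19/5 - \<gamma>) / (1 - \<gamma>)"
    using p1 dpos \<gamma> \<gamma>0 by (intro divide_right_mono mult_left_mono) (auto simp: divide_le_eq)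
  also have "\<dots> = \<gamma> * ((14/5) / (1 - \<gamma>) + 1)" using \<gamma> by (simp add: field_simps)
  also have "\<dots> \<le> \<gamma> * (2 * sqrt 2 / (1 - \<gamma>) * \<rho> + (1 + sqrt 2 * \<gamma> / (1 - \<gamma>)))"
  proof (intro mult_left_mono \<gamma>0)
    have "(7/5)\<^sup>2 \<le> (2::real)" by (simp add: power2_eq_square)
    then have s2: "7/5 \<le> sqrt 2" by (rule real_le_rsqrt)
    have "7/5 * 1 \<le> sqrt 2 * \<rho>" using s2 \<open>1 \<le> \<rho>\<close> by (intro mult_mono) auto
    then have "14/5 \<le> 2 * sqrt 2 * \<rho>" by linarith
    then have "(14/5) / (1 - \<gamma>) \<le> 2 * sqrt 2 * \<rho> / (1 - \<gamma>)" using \<gamma> by (intro divide_right_mono) auto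
    moreover have "0 \<le> sqrt 2 * \<gamma> / (1 - \<gamma>)" using \<gamma> \<gamma>0 by simp
    ultimately show "14 / 5 / (1 - \<gamma>) + 1 \<le> 2 * sqrt 2 / (1 - \<gamma>) * \<rho> + (1 + sqrt 2 * \<gamma> / (1 - \<gamma>))"
      by (simp add: mult.commute mult.left_commute)
  qed
  finally show "2 * \<eta> / (c - \<eta>) \<le> \<gamma> * (2 * sqrt 2 / (1 - \<gamma>) * \<rho> + (1 + sqrt 2 * \<gamma> / (1 - \<gamma>)))" .
qed

text \<open>From \<open>7/25\<close> on, the bracket is at least \<open>sqrt 2 * 23/6\<close> and
  the factor in front at least \<open>7/25 / sqrt 2\<close>; their product is
  \<open>161/150\<close>. Here \<open>25/18\<close> is the value of
  \<open>1 / (1 - \<gamma>)\<close> at the threshold.\<close>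

lemma pencil_bound_trivial:
  fixes \<gamma> A \<rho> k :: real
  assumes "7 / 25 \<le> \<gamma>" "\<gamma> < 1" "0 \<le> A" "A \<le> 1" "1 \<le> \<rho>" "1 \<le> k"
  shows "1 \<le> k * \<gamma> / sqrt (1 + A\<^sup>2) * (2 * sqrt 2 / (1 - \<gamma>) * \<rho> + (1 + sqrt 2 * \<gamma> / (1 - \<gamma>)))"
proof -
  define i where "i = 1 / (1 - \<gamma>)"
  have i: "25/18 \<le> i" using assms by (simp add: i_def field_simps)
  have "(7/5)\<^sup>2 \<le> (2::real)" by (simp add: power2_eq_square)
  then have s2: "7/5 \<le> sqrt 2" by (rule real_le_rsqrt)
  have s3: "sqrt 2 \<le> 3/2" by (rule real_le_lsqrt) (auto simp: power2_eq_square)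
  have "A\<^sup>2 \<le> 1" using assms by (simp add: power_le_one)
  then have sA: "sqrt (1 + A\<^sup>2) \<le> sqrt 2" by simp
  have "25/18 * 1 \<le> i * \<rho>" using i assms by (intro mult_mono) auto
  then have 1: "2 * sqrt 2 * (25/18) \<le> 2 * sqrt 2 * (i * \<rho>)" by (intro mult_left_mono) auto
  have "7/25 * (25/18) \<le> \<gamma> * i" using i assms by (intro mult_mono) auto
  then have 2: "sqrt 2 * (7/18) \<le> sqrt 2 * (\<gamma> * i)" by (intro mult_left_mono) auto
  have "19/6 * sqrt 2 + 1 \<le> 2 * sqrt 2 * (i * \<rho>) + (1 + sqrt 2 * (\<gamma> * i))" using 1 2 by linarith
  moreover have "sqrt 2 * (23/6) \<le> 19/6 * sqrt 2 + 1" using s3 by simp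
  ultimately have B: "sqrt 2 * (23/6) \<le> 2 * sqrt 2 / (1 - \<gamma>) * \<rho> + (1 + sqrt 2 * \<gamma> / (1 - \<gamma>))"
    by (simp add: i_def)
  have "7/25 / sqrt 2 \<le> k * \<gamma> / sqrt (1 + A\<^sup>2)"
  proof (rule frac_le)
    show "7/25 \<le> k * \<gamma>" using assms mult_mono[of 1 k "7/25" \<gamma>] by simp
  qed (use sA assms in \<open>auto simp: add_pos_nonneg\<close>)
  then have B': "7/25 / sqrt 2 * (sqrt 2 * (23/6)) \<le> k * \<gamma> / sqrt (1 + A\<^sup>2) * (2 * sqrt 2 / (1 - \<gamma>) * \<rho> + (1 + sqrt 2 * \<gamma> / (1 - \<gamma>)))"
    using B assms by (intro mult_mono) (auto intro!: divide_nonneg_nonneg mult_nonneg_nonneg)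
  have "1 \<le> 7/25 / sqrt 2 * (sqrt 2 * (23/6))" by simp
  then show ?thesis using B' by (rule order_trans)
qed

lemma chordal_le_1: "chordal u v \<le> 1"
proof -
  have *: "1 / sqrt (1 + (cmod w)\<^sup>2) \<le> 1" for w :: complex
  proof -
    have "1 \<le> sqrt (1 + (cmod w)\<^sup>2)" by simp
    then show ?thesis by (subst divide_le_eq_1_pos) linarith+
  qed
  have "cmod (z - w) \<le> sqrt (1 + (cmod z)\<^sup>2) * sqrt (1 + (cmod w)\<^sup>2)" for z w
  proof -
    have "cmod (z - w) \<le> cmod z + cmod w" by (rule norm_triangle_ineq4)
    also have "\<dots> \<le> sqrt ((1 + (cmod z)\<^sup>2) * (1 + (cmod w)\<^sup>2))"
    proof (rule real_le_rsqrt)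
      \<comment> \<open>Lagrange's identity for the vectors \<open>(1, cmod z)\<close> and
        \<open>(cmod w, 1)\<close>.\<close>
      have "(1 + (cmod z)\<^sup>2) * (1 + (cmod w)\<^sup>2) - (cmod z + cmod w)\<^sup>2 = (1 - cmod z * cmod w)\<^sup>2"
        by (simp add: power2_eq_square algebra_simps)
      then show "(cmod z + cmod w)\<^sup>2 \<le> (1 + (cmod z)\<^sup>2) * (1 + (cmod w)\<^sup>2)"
        by (metis diff_ge_0_iff_ge zero_le_power2)
    qed
    finally show ?thesis by (simp add: real_sqrt_mult)
  qed
  moreover have "0 < sqrt (1 + (cmod z)\<^sup>2) * sqrt (1 + (cmod w)\<^sup>2)" for z w :: complex
    by (simp add: add_pos_nonneg)
  ultimately have "chordal (Some z) (Some w) \<le> 1" for z w by (simp add: divide_le_eq_1_pos)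
  then show ?thesis using * by (cases u; cases v) (simp_all del: chordal.simps(1))
qed

text \<open>The root belonging to \<open>u\<close> is only bounded below by 1, since nothing is
  known about the modulus of \<open>u\<close>; the one belonging to the node supplies the factor
  with \<open>A\<close>.\<close>

lemma chordal_le_euclidean:
  assumes "0 \<le> A" "A \<le> cmod w"
  shows "chordal (Some u) (Some w) \<le> cmod (u - w) / sqrt (1 + A\<^sup>2)"
proof -
  have "A\<^sup>2 \<le> (cmod w)\<^sup>2" using assms by (intro power_mono)
  then have "1 * sqrt (1 + A\<^sup>2) \<le> sqrt (1 + (cmod u)\<^sup>2) * sqrt (1 + (cmod w)\<^sup>2)"
    by (intro mult_mono) auto
  moreover have "0 < sqrt (1 + A\<^sup>2)" by (simp add: add_pos_nonneg)
  ultimately show ?thesis by (simp add: divide_left_mono add_pos_nonneg)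
qed

section \<open>The two estimators\<close>

lemma nrm_rows_le:
  assumes G: "G \<in> carrier_mat L K" and y: "y \<in> carrier_vec K"
  shows "nrm (rows_down G *\<^sub>v y) \<le> nrm (G *\<^sub>v y)" "nrm (rows_up G *\<^sub>v y) \<le> nrm (G *\<^sub>v y)"
proof -
  have c: "rows_down G \<in> carrier_mat (L - 1) K" "rows_up G \<in> carrier_mat (L - 1) K"
    using G by (auto simp: rows_down_def rows_up_def)
  have d: "(rows_down G *\<^sub>v y) $ i = (G *\<^sub>v y) $ i" "(rows_up G *\<^sub>v y) $ i = (G *\<^sub>v y) $ (i + 1)"
    if "i < L - 1" for i
    using that G mult_mat_vec_index[OF c(1) y that] mult_mat_vec_index[OF c(2) y that]
      mult_mat_vec_index[OF G y, of i] mult_mat_vec_index[OF G y, of "i + 1"]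
    by (auto simp: rows_down_def rows_up_def simp del: index_mult_mat_vec intro!: sum.cong)
  have le: "(\<Sum>i<L - 1. (cmod ((G *\<^sub>v y) $ i))\<^sup>2) \<le> (nrm (G *\<^sub>v y))\<^sup>2"
    "(\<Sum>i<L - 1. (cmod ((G *\<^sub>v y) $ (i + 1)))\<^sup>2) \<le> (nrm (G *\<^sub>v y))\<^sup>2"
  proof -
    show "(\<Sum>i<L - 1. (cmod ((G *\<^sub>v y) $ i))\<^sup>2) \<le> (nrm (G *\<^sub>v y))\<^sup>2"
      unfolding nrm_sq using G by (intro sum_mono2) auto
    have "(\<Sum>i<L - 1. (cmod ((G *\<^sub>v y) $ (i + 1)))\<^sup>2) = (\<Sum>i\<in>Suc ` {..<L - 1}. (cmod ((G *\<^sub>v y) $ i))\<^sup>2)"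
      by (subst sum.reindex) (auto simp del: index_mult_mat_vec)
    also have "\<dots> \<le> (nrm (G *\<^sub>v y))\<^sup>2"
      unfolding nrm_sq using G by (intro sum_mono2) auto
    finally show "(\<Sum>i<L - 1. (cmod ((G *\<^sub>v y) $ (i + 1)))\<^sup>2) \<le> (nrm (G *\<^sub>v y))\<^sup>2" .
  qed
  have "(nrm (rows_down G *\<^sub>v y))\<^sup>2 = (\<Sum>i<L - 1. (cmod ((G *\<^sub>v y) $ i))\<^sup>2)"
    "(nrm (rows_up G *\<^sub>v y))\<^sup>2 = (\<Sum>i<L - 1. (cmod ((G *\<^sub>v y) $ (i + 1)))\<^sup>2)"
    unfolding nrm_sq[of "rows_down G *\<^sub>v y"] nrm_sq[of "rows_up G *\<^sub>v y"]
    using carrier_matD[OF c(1)] carrier_matD[OF c(2)] d by (simp_all del: index_mult_mat_vec)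
  then show "nrm (rows_down G *\<^sub>v y) \<le> nrm (G *\<^sub>v y)" "nrm (rows_up G *\<^sub>v y) \<le> nrm (G *\<^sub>v y)"
    using le by (simp_all add: power2_le_imp_le)
qed

lemma diag_mult_index:
  assumes "C \<in> carrier_mat K m" "k < K" "j < m"
  shows "(mat K K (\<lambda>(i, j). if i = j then z i else 0) * C) $$ (k, j) = z k * (C $$ (k, j) :: complex)"
proof -
  have "(mat K K (\<lambda>(i, j). if i = j then z i else 0) * C) $$ (k, j) = (\<Sum>i<K. if i = k then z k * C $$ (k, j) else 0)"
  proof -
    have "(mat K K (\<lambda>(i, j). if i = j then z i else 0) * C) $$ (k, j) = (\<Sum>i<K. (if k = i then z k else 0) * C $$ (i, j))"
      using assms by (simp add: scalar_prod_def atLeast0LessThan)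
    also have "\<dots> = (\<Sum>i<K. if i = k then z k * C $$ (k, j) else 0)" by (intro sum.cong) auto
    finally show ?thesis .
  qed
  then show ?thesis using assms by simp
qed

lemma vandermonde_mult_index:
  assumes "C \<in> carrier_mat K m" "l < M" "j < m"
  shows "(vandermonde M K z * C) $$ (l, j) = (\<Sum>k<K. z k ^ l * C $$ (k, j))"
  using assms by (auto simp: vandermonde_def scalar_prod_def atLeast0LessThan)

lemma permutes_of_mset_eq:
  fixes K :: nat
  assumes "image_mset r (mset_set {..<K}) = image_mset zh (mset_set {..<K})"
  obtains \<pi> where "\<pi> permutes {..<K}" "\<And>k. k < K \<Longrightarrow> r k = zh (\<pi> k)"
  using image_mset_eq_implies_permutes[OF finite_lessThan assms] that by (metis lessThan_iff)

text \<open>With \<open>C\<close> the coordinates of the projection of the estimated signal subspace onto the column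
  space of the Vandermonde matrix, compressing the pencil of shifted subspaces by a left inverse of
  the shorter Vandermonde matrix gives a perturbation of the pencil \<open>(C, Z C)\<close>.\<close>

lemma esprit_matching:
  fixes z \<alpha> e y zh :: "nat \<Rightarrow> complex"
  assumes K: "1 \<le> K" "K < L" "K \<le> n" "L + n = N + 1"
    and inj: "inj_on z {..<K}" and z1: "\<And>k. k < K \<Longrightarrow> cmod (z k) \<le> 1" and am: "amin K \<alpha> > 0"
    and y: "\<And>i. i < N \<Longrightarrow> y i = (\<Sum>k<K. \<alpha> k * z k ^ i) + e i"
    and svd: "is_svd (hankel L N y) U S W"
    and \<Phi>: "\<Phi> \<in> carrier_mat K K" "rows_down (first_cols K U) * \<Phi> = rows_up (first_cols K U)"
    and cp: "char_poly \<Phi> = (\<Prod>k<K. [:- zh k, 1:])"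
  defines "\<gamma> \<equiv> sqrt (real (min L n)) * vnorm N e /
      (amin K \<alpha> * sigma_min (vandermonde L K z) * sigma_min (vandermonde n K z))"
    and "\<beta> \<equiv> sigma_max (vandermonde L K z) / sigma_min (vandermonde (L - 1) K z)"
  assumes \<gamma>: "\<gamma> < 1 / (1 + sqrt 2 * \<beta>)"
  shows "\<exists>\<pi>. \<pi> permutes {..<K} \<and> (\<forall>k<K. cmod (zh (\<pi> k) - z k) \<le>
    (2 * real K - 1) * sqrt 2 * \<beta> * \<gamma> / (1 - (1 + sqrt 2 * \<beta>) * \<gamma>)
      * (1 + kappa (vandermonde L K z)) * kappa (vandermonde L K z))"
proof -
  define V V' B E F Z where "V = vandermonde L K z" and "V' = vandermonde (L - 1) K z"
    and "B = weighted_rows K n \<alpha> z" and "E = hankel L N e" and "F = first_cols K U"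
    and "Z = mat K K (\<lambda>(i, j). if i = j then z i else 0)"
  define a b \<epsilon> \<sigma> \<sigma>' where "a = sigma_min V" and "b = amin K \<alpha> * sigma_min (vandermonde n K z)"
    and "\<epsilon> = sqrt (real (min L n)) * vnorm N e" and "\<sigma> = sigma_max V" and "\<sigma>' = sigma_min V'"
  have KL: "K \<le> L" "K \<le> L - 1" using K by auto
  have V: "V \<in> carrier_mat L K" and V': "V' \<in> carrier_mat (L - 1) K" and B: "B \<in> carrier_mat K n"
    and Z: "Z \<in> carrier_mat K K"
    by (simp_all add: V_def V'_def B_def Z_def)
  have E: "E \<in> carrier_mat L n" unfolding E_def using K by (intro hankel_carrier) auto
  note sV = vandermonde_sigma[OF inj KL(1) K(1), folded V_def a_def \<sigma>_def]
  note sV' = vandermonde_sigma[OF inj KL(2) K(1), folded V'_def \<sigma>'_def]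
  have b: "b > 0" "\<And>x. x \<in> carrier_vec K \<Longrightarrow> b * nrm x \<le> nrm (adj B *\<^sub>v x)"
    using am vandermonde_sigma(1)[OF inj K(3,1)] adj_weighted_rows_lower[OF inj K(3,1) am]
    by (auto simp: b_def B_def)
  have \<epsilon>: "nrm (E *\<^sub>v x) \<le> \<epsilon> * nrm x" if "x \<in> carrier_vec n" for x
    using hankel_norm_bound[of L n N 0 N x e] K that by (simp add: E_def \<epsilon>_def)
  have \<epsilon>0: "0 \<le> \<epsilon>" by (simp add: \<epsilon>_def)
  have \<gamma>e: "\<gamma> = \<epsilon> / (a * b)" by (simp add: \<gamma>_def a_def b_def \<epsilon>_def V_def mult_ac)
  have \<beta>e: "\<beta> = \<sigma> / \<sigma>'" by (simp add: \<beta>_def \<sigma>_def \<sigma>'_def V_def V'_def)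
  have \<gamma>0: "0 \<le> \<gamma>" using \<epsilon>0 sV(1) b(1) by (simp add: \<gamma>e)
  have \<sigma>: "\<sigma>' \<le> \<sigma>"
    using vandermonde_sigma_min_le_max[OF inj KL(2) _ K(1), of L] by (simp add: \<sigma>_def \<sigma>'_def V_def V'_def)
  define \<tau> c \<eta> where "\<tau> = \<gamma> / (1 - \<gamma>)" and "c = sqrt (1 - \<tau>\<^sup>2) / \<sigma>" and "\<eta> = \<tau> / \<sigma>'"
  note arith = esprit_bound_arith[OF \<gamma>0 sV'(1) \<sigma> \<beta>e \<gamma> \<tau>_def c_def \<eta>_def]
  have ab: "a * b > 0" using sV(1) b(1) by simp
  have \<epsilon>ab: "\<epsilon> < a * b" using arith(1) ab by (simp add: \<gamma>e)
  have \<tau>e: "\<tau> = \<epsilon> / (a * b - \<epsilon>)"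
  proof -
    have "1 - \<epsilon> / (a * b) = (a * b - \<epsilon>) / (a * b)" using sV(1) b(1) by (simp add: diff_divide_distrib)
    then show ?thesis using sV(1) b(1) unfolding \<tau>_def \<gamma>e by simp
  qed
  have X: "hankel L N y = V * B + E"
    unfolding V_def B_def E_def using K y by (intro hankel_exponential_sum) auto
  obtain P where P: "P \<in> carrier_mat K L" and F: "F \<in> carrier_mat L K"
    and res: "\<And>x. x \<in> carrier_vec K \<Longrightarrow> nrm (F *\<^sub>v x - V *\<^sub>v (P *\<^sub>v (F *\<^sub>v x))) \<le> \<tau> * nrm x"
    and low: "\<And>x. x \<in> carrier_vec K \<Longrightarrow> sqrt (1 - \<tau>\<^sup>2) * nrm x \<le> nrm (V *\<^sub>v (P *\<^sub>v (F *\<^sub>v x)))"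
  proof (rule svd_subspace_lower[OF V B E K(1) KL(1) K(3) sV(1,2) b \<epsilon> \<epsilon>0 \<epsilon>ab svd[unfolded X], folded F_def \<tau>e])
    show "\<tau> \<le> 1" by (rule arith(2))
  qed (assumption | (rule that, assumption+))+
  define C where "C = P * F"
  have C: "C \<in> carrier_mat K K" using P F by (simp add: C_def)
  have Cv: "C *\<^sub>v x = P *\<^sub>v (F *\<^sub>v x)" if "x \<in> carrier_vec K" for x
    unfolding C_def by (rule assoc_mult_mat_vec[OF P F that])
  have \<sigma>0: "\<sigma> > 0" using \<sigma> sV'(1) by simp
  \<comment> \<open>Passing from vectors in the range of \<open>V\<close> to their coordinates costs
    \<open>sigma_max V\<close>, the numerator of \<beta>.\<close>
  have lowC: "c * nrm x \<le> nrm (C *\<^sub>v x)" if x: "x \<in> carrier_vec K" for x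
  proof -
    have "sqrt (1 - \<tau>\<^sup>2) * nrm x \<le> nrm (V *\<^sub>v (C *\<^sub>v x))" using low[OF x] Cv[OF x] by simp
    also have "\<dots> \<le> \<sigma> * nrm (C *\<^sub>v x)" using C x by (intro sV(3)) simp
    finally show ?thesis using \<sigma>0 by (simp add: c_def divide_le_eq mult.commute)
  qed
  define G where "G = F - V * C"
  have VC: "V * C \<in> carrier_mat L K" using V C by simp
  have G: "G \<in> carrier_mat L K" unfolding G_def using VC by (rule minus_carrier_mat)
  have Gv: "nrm (G *\<^sub>v x) \<le> \<tau> * nrm x" if x: "x \<in> carrier_vec K" for x
  proof -
    have "G *\<^sub>v x = F *\<^sub>v x - V *\<^sub>v (P *\<^sub>v (F *\<^sub>v x))"
      unfolding G_def minus_mult_distrib_mat_vec[OF F VC x] assoc_mult_mat_vec[OF V C x] Cv[OF x] by (rule refl)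
    then show ?thesis using res[OF x] by simp
  qed
  \<comment> \<open>Its norm is at most \<open>1 / \<sigma>'\<close>, which supplies the denominator
    of \<beta>.\<close>
  obtain P' where P': "P' \<in> carrier_mat K (L - 1)" "P' * V' = 1\<^sub>m K"
    "\<And>x. x \<in> carrier_vec (L - 1) \<Longrightarrow> \<sigma>' * nrm (P' *\<^sub>v x) \<le> nrm x"
    by (rule left_inverse_exists[OF V' sV'(1) sV'(2)], assumption) (rule that)
  define G1 G2 where "G1 = P' * rows_down G" and "G2 = P' * rows_up G"
  have rd: "rows_down G \<in> carrier_mat (L - 1) K" "rows_up G \<in> carrier_mat (L - 1) K"
    using G by (auto simp: rows_down_def rows_up_def)
  have G12: "G1 \<in> carrier_mat K K" "G2 \<in> carrier_mat K K" using P'(1) rd by (auto simp: G1_def G2_def)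
  have bound: "nrm (P' * R *\<^sub>v x) \<le> \<eta> * nrm x"
    if R: "R \<in> carrier_mat (L - 1) K" "nrm (R *\<^sub>v x) \<le> nrm (G *\<^sub>v x)" and x: "x \<in> carrier_vec K" for R x
  proof -
    have "\<sigma>' * nrm (P' *\<^sub>v (R *\<^sub>v x)) \<le> \<tau> * nrm x"
      using P'(3)[of "R *\<^sub>v x"] R x Gv[OF x] by simp
    then show ?thesis
      unfolding assoc_mult_mat_vec[OF P'(1) R(1) x] using sV'(1) by (simp add: \<eta>_def field_simps)
  qed
  have g1: "nrm (G1 *\<^sub>v x) \<le> \<eta> * nrm x" and g2: "nrm (G2 *\<^sub>v x) \<le> \<eta> * nrm x" if x: "x \<in> carrier_vec K" for x
    unfolding G1_def G2_def using bound rd nrm_rows_le[OF G x] x by blast+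
  obtain r d where rd': "d \<noteq> 0" "\<And>x. det (x \<cdot>\<^sub>m (C + G1) - (Z * C + G2)) = d * (\<Prod>k<K. x - r k)"
    "\<And>k. k < K \<Longrightarrow> cmod (r k - z k) \<le> (2 * real K - 1) * (2 * \<eta> / (c - \<eta>))"
    by (rule pencil_matching[where z = z and K = K, folded Z_def, OF C G12 z1 arith(3,4) lowC g1 g2]) (assumption | (rule that, assumption+))+
  have ZC: "Z * C \<in> carrier_mat K K" using Z C by simp
  have FG: "F $$ (i, j) = (V * C) $$ (i, j) + G $$ (i, j)" if "i < L" "j < K" for i j
    using that carrier_matD[OF V] carrier_matD[OF C] by (simp add: G_def del: index_mult_mat(1))
  have down: "rows_down F = V' * C + rows_down G"
  proof (intro eq_matI)
    fix i j assume "i < dim_row (V' * C + rows_down G)" "j < dim_col (V' * C + rows_down G)"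
    then have ij: "i < L - 1" "j < K" using rd by auto
    then have "(V' * C) $$ (i, j) = (V * C) $$ (i, j)"
      unfolding V_def V'_def by (simp add: vandermonde_mult_index[OF C] del: index_mult_mat(1))
    then show "rows_down F $$ (i, j) = (V' * C + rows_down G) $$ (i, j)"
      using ij F G FG[of i j] C V' by (simp add: rows_down_def del: index_mult_mat(1))
  qed (use F G rd in \<open>auto simp: rows_down_def\<close>)
  \<comment> \<open>Rotational invariance: deleting the first row of \<open>V\<close> instead of the
    last gives \<open>V' * Z\<close>.\<close>
  have up: "rows_up F = V' * (Z * C) + rows_up G"
  proof (intro eq_matI)
    fix i j assume "i < dim_row (V' * (Z * C) + rows_up G)" "j < dim_col (V' * (Z * C) + rows_up G)"
    then have ij: "i < L - 1" "j < K" using rd by auto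
    have "(V' * (Z * C)) $$ (i, j) = (\<Sum>k<K. z k ^ i * (Z * C) $$ (k, j))"
      unfolding V'_def by (rule vandermonde_mult_index[OF ZC ij])
    also have "\<dots> = (\<Sum>k<K. z k ^ (i + 1) * C $$ (k, j))"
      using ij(2) unfolding Z_def by (simp add: diag_mult_index[OF C] mult_ac del: index_mult_mat(1))
    also have "\<dots> = (V * C) $$ (i + 1, j)"
      unfolding V_def by (rule vandermonde_mult_index[OF C, symmetric]) (use ij in auto)
    finally have "(V' * (Z * C)) $$ (i, j) = (V * C) $$ (i + 1, j)" .
    then show "rows_up F $$ (i, j) = (V' * (Z * C) + rows_up G) $$ (i, j)"
      using ij F G FG[of "i + 1" j] ZC V' by (simp add: rows_up_def del: index_mult_mat(1))
  qed (use F G rd in \<open>auto simp: rows_up_def\<close>)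
  have PV: "P' * (V' * M) = M" if "M \<in> carrier_mat K K" for M
    using assoc_mult_mat[OF P'(1) V' that] P'(2) that by simp
  have A1: "P' * rows_down F = C + G1" and B1: "P' * rows_up F = Z * C + G2"
    unfolding down up G1_def G2_def
    using mult_add_distrib_mat[OF P'(1) _ rd(1), of "V' * C"] mult_add_distrib_mat[OF P'(1) _ rd(2), of "V' * (Z * C)"]
      PV[OF C] PV[OF ZC] V' C ZC by simp_all
  have rdF: "rows_down F \<in> carrier_mat (L - 1) K" using F by (auto simp: rows_down_def)
  \<comment> \<open>The assumption that \<Phi> solves the shifted system exactly enters here, making
    its eigenvalues those of the compressed pencil.\<close>
  have "(C + G1) * \<Phi> = Z * C + G2"
    unfolding A1[symmetric] B1[symmetric] using assoc_mult_mat[OF P'(1) rdF \<Phi>(1)] \<Phi>(2) by (simp add: F_def)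
  moreover have A1c: "C + G1 \<in> carrier_mat K K" using C G12 by simp
  ultimately have "d * (\<Prod>k<K. x - r k) = det (C + G1) * (\<Prod>k<K. x - zh k)" for x
    using rd'(2)[of x] det_pencil_char_poly[OF A1c \<Phi>(1), of x] by (simp add: cp poly_prod)
  then have "image_mset r (mset_set {..<K}) = image_mset zh (mset_set {..<K})"
    by (rule prod_linear_eq_imp_mset_eq[OF rd'(1)])
  then obtain \<pi> where \<pi>: "\<pi> permutes {..<K}" "\<And>k. k < K \<Longrightarrow> r k = zh (\<pi> k)"
    using permutes_of_mset_eq by blast
  have \<kappa>: "1 \<le> kappa V"
    using vandermonde_sigma_min_le_max[OF inj KL(1) order_refl K(1)] sV(1) by (simp add: kappa_def a_def V_def)
  let ?q = "sqrt 2 * \<beta> * \<gamma> / (1 - (1 + sqrt 2 * \<beta>) * \<gamma>)"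
  have "cmod (zh (\<pi> k) - z k) \<le> (2 * real K - 1) * sqrt 2 * \<beta> * \<gamma> / (1 - (1 + sqrt 2 * \<beta>) * \<gamma>)
      * (1 + kappa V) * kappa V" if "k < K" for k
  proof -
    have "cmod (zh (\<pi> k) - z k) \<le> (2 * real K - 1) * (2 * \<eta> / (c - \<eta>))"
      using rd'(3)[OF that] \<pi>(2)[OF that] by simp
    also have "\<dots> \<le> (2 * real K - 1) * (2 * ?q)" using arith(5) K(1) by (intro mult_left_mono) auto
    also have "\<dots> \<le> (2 * real K - 1) * (((1 + kappa V) * kappa V) * ?q)"
    proof (intro mult_left_mono mult_right_mono arith(6))
      \<comment> \<open>The condition number factors absorb the 2 in the inclusion radius.\<close>
      have "(1 + 1) * 1 \<le> (1 + kappa V) * kappa V" using \<kappa> by (intro mult_mono) auto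
      then show "2 \<le> (1 + kappa V) * kappa V" by simp
    qed (use K(1) in simp)
    finally show ?thesis by (simp add: mult_ac)
  qed
  then show ?thesis using \<pi>(1) unfolding V_def by blast
qed

text \<open>Here the pencil is compressed by the inverse of \<open>S\<^sup>H V\<close>. For \<open>\<gamma> \<ge> 7/25\<close> the claimed bound
  exceeds \<open>1\<close>, the largest possible chordal distance; for smaller \<open>\<gamma>\<close> all generalized eigenvalues
  are finite and already their Euclidean distances to the nodes are small enough.\<close>

lemma matrix_pencil_matching:
  fixes z \<alpha> e y :: "nat \<Rightarrow> complex" and zh :: "nat \<Rightarrow> complex option"
  assumes K: "1 \<le> K" "K \<le> L" "K \<le> n" "L + n = N"
    and inj: "inj_on z {..<K}" and z1: "\<And>k. k < K \<Longrightarrow> cmod (z k) \<le> 1" and am: "amin K \<alpha> > 0"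
    and y: "\<And>i. i < N \<Longrightarrow> y i = (\<Sum>k<K. \<alpha> k * z k ^ i) + e i"
    and svd: "is_svd (hankel L (N - 1) y) U S W"
  defines "\<Psi>1 \<equiv> adj (first_cols K U) * hankel L (N - 1) y * first_cols K W"
    and "\<Psi>2 \<equiv> adj (first_cols K U) * hankel L (N - 1) (\<lambda>i. y (i + 1)) * first_cols K W"
  assumes eigs: "gen_eigs K \<Psi>1 \<Psi>2 zh"
  defines "\<gamma> \<equiv> sqrt (real (min L n)) * vnorm N e /
      (amin K \<alpha> * sigma_min (vandermonde L K z) * sigma_min (vandermonde n K z))"
  assumes \<gamma>1: "\<gamma> < 1"
  shows "\<exists>\<pi>. \<pi> permutes {..<K} \<and> (\<forall>k<K. chordal (zh (\<pi> k)) (Some (z k)) \<le>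
    (2 * real K - 1) * \<gamma> / sqrt (1 + (amin K z)\<^sup>2) *
     (2 * sqrt 2 / (1 - \<gamma>) * (amax K \<alpha> / amin K \<alpha>) * kappa (vandermonde L K z) * kappa (vandermonde n K z)
       + (1 + sqrt 2 * \<gamma> / (1 - \<gamma>))))"
proof -
  define \<rho> where "\<rho> = amax K \<alpha> / amin K \<alpha> * kappa (vandermonde L K z) * kappa (vandermonde n K z)"
  have r1: "1 \<le> amax K \<alpha> / amin K \<alpha>" using amin_le[of 0 K \<alpha>] amax_ge[of 0 K \<alpha>] am K(1) by simp
  have r2: "1 \<le> kappa (vandermonde M K z)" if "K \<le> M" for M
    using vandermonde_sigma_min_le_max[OF inj that order_refl K(1)] vandermonde_sigma(1)[OF inj that K(1)]
    by (simp add: kappa_def)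
  have "1 \<le> u * v" if "1 \<le> u" "1 \<le> v" for u v :: real using mult_mono[of 1 u 1 v] that by simp
  then have \<rho>: "1 \<le> \<rho>" unfolding \<rho>_def using r1 r2 K(2,3) by blast
  have k1: "1 \<le> 2 * real K - 1" using K(1) by simp
  have A0: "0 \<le> amin K z" unfolding amin_def using K(1) by (intro Min.boundedI) (auto simp: lessThan_empty_iff)
  have A1: "amin K z \<le> 1" using amin_le[of 0 K z] z1[of 0] K(1) by simp
  have "\<exists>\<pi>. \<pi> permutes {..<K} \<and> (\<forall>k<K. chordal (zh (\<pi> k)) (Some (z k)) \<le>
    (2 * real K - 1) * \<gamma> / sqrt (1 + (amin K z)\<^sup>2) * (2 * sqrt 2 / (1 - \<gamma>) * \<rho> + (1 + sqrt 2 * \<gamma> / (1 - \<gamma>))))"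
  proof (cases "7 / 25 \<le> \<gamma>")
    case True
    have "chordal (zh (id k)) (Some (z k)) \<le>
      (2 * real K - 1) * \<gamma> / sqrt (1 + (amin K z)\<^sup>2) * (2 * sqrt 2 / (1 - \<gamma>) * \<rho> + (1 + sqrt 2 * \<gamma> / (1 - \<gamma>)))" for k
      using chordal_le_1 pencil_bound_trivial[OF True \<gamma>1 A0 A1 \<rho> k1] by (rule order_trans)
    then show ?thesis using permutes_id by blast
  next
    case False
    then have \<gamma>s: "\<gamma> < 7 / 25" by simp
    define V B E1 E2 F R Z where "V = vandermonde L K z" and "B = weighted_rows K n \<alpha> z"
      and "E1 = hankel L (N - 1) e" and "E2 = hankel L (N - 1) (\<lambda>i. e (i + 1))"
      and "F = first_cols K U" and "R = first_cols K W"
      and "Z = mat K K (\<lambda>(i, j). if i = j then z i else 0)"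
    define a b \<epsilon> where "a = sigma_min V" and "b = amin K \<alpha> * sigma_min (vandermonde n K z)"
      and "\<epsilon> = sqrt (real (min L n)) * vnorm N e"
    have Ln: "L + n = (N - 1) + 1" "1 \<le> n" using K by auto
    have V: "V \<in> carrier_mat L K" and B: "B \<in> carrier_mat K n" and Z: "Z \<in> carrier_mat K K"
      by (simp_all add: V_def B_def Z_def)
    have E: "E1 \<in> carrier_mat L n" "E2 \<in> carrier_mat L n"
      unfolding E1_def E2_def using hankel_carrier[OF Ln] by auto
    note sV = vandermonde_sigma[OF inj K(2,1), folded V_def a_def]
    have b: "b > 0" "\<And>x. x \<in> carrier_vec K \<Longrightarrow> b * nrm x \<le> nrm (adj B *\<^sub>v x)"
      using am vandermonde_sigma(1)[OF inj K(3,1)] adj_weighted_rows_lower[OF inj K(3,1) am]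
      by (auto simp: b_def B_def)
    have \<epsilon>: "nrm (E1 *\<^sub>v x) \<le> \<epsilon> * nrm x" "nrm (E2 *\<^sub>v x) \<le> \<epsilon> * nrm x" if "x \<in> carrier_vec n" for x
      using hankel_norm_bound[OF Ln, of 0 N x e] hankel_norm_bound[OF Ln, of 1 N x e] K that
      by (simp_all add: E1_def E2_def \<epsilon>_def)
    have \<epsilon>0: "0 \<le> \<epsilon>" by (simp add: \<epsilon>_def)
    have \<gamma>e: "\<gamma> = \<epsilon> / (a * b)" by (simp add: \<gamma>_def a_def b_def \<epsilon>_def V_def mult_ac)
    define \<tau> c \<eta> where "\<tau> = \<gamma> / (1 - \<gamma>)" and "c = b * sqrt (1 - \<tau>\<^sup>2)" and "\<eta> = \<epsilon> / (a * sqrt (1 - \<tau>\<^sup>2))"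
    note arith = pencil_bound_arith[OF sV(1) b(1) \<epsilon>0 \<gamma>e \<gamma>s \<tau>_def c_def \<eta>_def \<rho>]
    have ab: "a * b > 0" using sV(1) b(1) by simp
    have \<epsilon>ab: "\<epsilon> < a * b" "\<epsilon> < b * a" using \<gamma>1 ab by (simp_all add: \<gamma>e mult.commute)
    have \<tau>e: "\<tau> = \<epsilon> / (a * b - \<epsilon>)" "\<tau> = \<epsilon> / (b * a - \<epsilon>)"
    proof -
      have "1 - \<epsilon> / (a * b) = (a * b - \<epsilon>) / (a * b)" using sV(1) b(1) by (simp add: diff_divide_distrib)
      then show "\<tau> = \<epsilon> / (a * b - \<epsilon>)" using sV(1) b(1) unfolding \<tau>_def \<gamma>e by simp
      then show "\<tau> = \<epsilon> / (b * a - \<epsilon>)" by (simp add: mult.commute)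
    qed
    have \<tau>1: "\<tau> \<le> 1" using arith(1) by simp
    have X1: "hankel L (N - 1) y = V * B + E1"
      unfolding V_def B_def E1_def using y by (intro hankel_exponential_sum[OF Ln]) auto
    \<comment> \<open>Shifting the data by one sample multiplies each weight by its node, so
      \<open>Z\<close> appears to the left of the same right factor \<open>B\<close>.\<close>
    have X2: "hankel L (N - 1) (\<lambda>i. y (i + 1)) = V * (Z * B) + E2"
    proof -
      have "y (i + 1) = (\<Sum>k<K. \<alpha> k * z k * z k ^ i) + e (i + 1)" if "i < N - 1" for i
        using y[of "i + 1"] that by (simp add: mult_ac)
      then have "hankel L (N - 1) (\<lambda>i. y (i + 1)) = V * weighted_rows K n (\<lambda>k. \<alpha> k * z k) z + E2"
        unfolding V_def E2_def by (intro hankel_exponential_sum[OF Ln])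
      also have "weighted_rows K n (\<lambda>k. \<alpha> k * z k) z = Z * B"
      proof (intro eq_matI)
        fix i j assume "i < dim_row (Z * B)" "j < dim_col (Z * B)"
        then have ij: "i < K" "j < n" using Z B by auto
        then show "weighted_rows K n (\<lambda>k. \<alpha> k * z k) z $$ (i, j) = (Z * B) $$ (i, j)"
          unfolding Z_def diag_mult_index[OF B ij] by (simp add: B_def weighted_rows_def)
      qed (use Z B in \<open>auto simp: weighted_rows_def\<close>)
      finally show ?thesis .
    qed
    have VB: "V * B \<in> carrier_mat L n" using V B by simp
    have X1c: "V * B + E1 \<in> carrier_mat L n" using VB E by simp
    have F: "F \<in> carrier_mat L K" "\<And>x. x \<in> carrier_vec K \<Longrightarrow> nrm (F *\<^sub>v x) = nrm x"
      and lowF: "\<And>x. x \<in> carrier_vec K \<Longrightarrow> a * sqrt (1 - \<tau>\<^sup>2) * nrm x \<le> nrm (adj V *\<^sub>v (F *\<^sub>v x))"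
      by (rule svd_subspace_lower[OF V B E(1) K(1-3) sV(1,2) b \<epsilon>(1) \<epsilon>0 \<epsilon>ab(1) svd[unfolded X1], folded F_def \<tau>e(1)];
          use \<tau>1 in blast)+
    have adjX: "adj (V * B + E1) = adj B * adj V + adj E1"
      using adj_add[OF VB E(1)] adj_mult[OF V B] by simp
    have \<epsilon>': "nrm (adj E1 *\<^sub>v x) \<le> \<epsilon> * nrm x" if "x \<in> carrier_vec L" for x
      using adj_bound[OF E(1) \<epsilon>(1) \<epsilon>0 that] .
    have sV2: "a * nrm x \<le> nrm (adj (adj V) *\<^sub>v x)" if "x \<in> carrier_vec K" for x using sV(2)[OF that] by simp
    \<comment> \<open>For the adjoint, \<open>adj B\<close> becomes the left factor and
      \<open>adj V\<close> the right one, so \<open>a\<close> and \<open>b\<close> exchange roles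
      while \<tau> stays the same.\<close>
    have R: "R \<in> carrier_mat n K" "\<And>x. x \<in> carrier_vec K \<Longrightarrow> nrm (R *\<^sub>v x) = nrm x"
      and lowR: "\<And>x. x \<in> carrier_vec K \<Longrightarrow> b * sqrt (1 - \<tau>\<^sup>2) * nrm x \<le> nrm (adj (adj B) *\<^sub>v (R *\<^sub>v x))"
      by (rule svd_subspace_lower[OF adj_carrier[OF B] adj_carrier[OF V] adj_carrier[OF E(1)] K(1,3,2) b sV(1) sV2
          \<epsilon>' \<epsilon>0 \<epsilon>ab(2) is_svd_adj[OF svd[unfolded X1] X1c, unfolded adjX], folded R_def \<tau>e(2)];
          use \<tau>1 in blast)+
    define T where "T = adj F * V"
    have T: "T \<in> carrier_mat K K" unfolding T_def using mult_carrier_mat[OF adj_carrier[OF F(1)] V] .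
    have adjT: "adj T = adj V * F" using adj_mult[OF adj_carrier[OF F(1)] V] by (simp add: T_def)
    define g where "g = a * sqrt (1 - \<tau>\<^sup>2)"
    have \<tau>2: "\<tau>\<^sup>2 < 1"
    proof -
      have "0 \<le> \<tau>" using \<epsilon>0 \<epsilon>ab by (simp add: \<tau>e(1))
      then show ?thesis using arith(1) by (simp add: power_less_one_iff)
    qed
    have g: "g > 0" using sV(1) \<tau>2 by (simp add: g_def)
    have lowT: "g * nrm x \<le> nrm (adj T *\<^sub>v x)" if "x \<in> carrier_vec K" for x
      using lowF[OF that] unfolding adjT assoc_mult_mat_vec[OF adj_carrier[OF V] F(1) that] by (simp add: g_def)
    \<comment> \<open>The cosine bound controls \<open>adj T\<close>, not \<open>T\<close>. A left
      inverse of \<open>adj T\<close> becomes, after taking adjoints, a right inverse of the square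
      matrix \<open>T\<close> with the same norm bound.\<close>
    obtain Q where Q: "Q \<in> carrier_mat K K" "Q * adj T = 1\<^sub>m K"
      "\<And>x. x \<in> carrier_vec K \<Longrightarrow> g * nrm (Q *\<^sub>v x) \<le> nrm x"
      by (rule left_inverse_exists[OF adj_carrier[OF T] g lowT], assumption) (rule that)
    define H where "H = adj Q"
    have H: "H \<in> carrier_mat K K" unfolding H_def by (rule adj_carrier[OF Q(1)])
    have "T * H = 1\<^sub>m K"
      using adj_mult[OF Q(1) adj_carrier[OF T]] Q(2) by (simp add: H_def)
    then have HT: "H * T = 1\<^sub>m K" by (rule mat_mult_left_right_inverse[OF T H])
    have Hb: "nrm (H *\<^sub>v x) \<le> 1 / g * nrm x" if "x \<in> carrier_vec K" for x
      unfolding H_def using Q(3) g by (intro adj_bound[OF Q(1) _ _ that]) (auto simp: field_simps)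
    have detH: "det H \<noteq> 0" using det_mult[OF H T] HT by auto
    define C where "C = B * R"
    have C: "C \<in> carrier_mat K K" using B R by (simp add: C_def)
    have lowC: "c * nrm x \<le> nrm (C *\<^sub>v x)" if "x \<in> carrier_vec K" for x
      using lowR[OF that] assoc_mult_mat_vec[OF B R(1) that] by (simp add: C_def c_def)
    have FH: "adj F \<in> carrier_mat K L" by (rule adj_carrier[OF F(1)])
    define G1 G2 where "G1 = H * (adj F * E1 * R)" and "G2 = H * (adj F * E2 * R)"
    have FER: "adj F * M * R \<in> carrier_mat K K" if "M \<in> carrier_mat L n" for M
      using FH that R by (meson mult_carrier_mat)
    have G12: "G1 \<in> carrier_mat K K" "G2 \<in> carrier_mat K K"
      using H FER[OF E(1)] FER[OF E(2)] by (auto simp: G1_def G2_def)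
    have adjF: "nrm (adj F *\<^sub>v x) \<le> 1 * nrm x" if "x \<in> carrier_vec L" for x
      by (rule adj_bound[OF F(1) _ _ that]) (use F(2) in auto)
    \<comment> \<open>\<open>R\<close> is isometric and \<open>adj F\<close> a contraction, so only
      \<open>H\<close> can enlarge the noise. Its norm bound \<open>1 / g\<close> puts one cosine
      into \<eta>; the other one sits in \<open>c\<close> and comes from \<open>R\<close>.\<close>
    have bound: "nrm (H * (adj F * M * R) *\<^sub>v x) \<le> \<eta> * nrm x"
      if M: "M \<in> carrier_mat L n" "\<And>x. x \<in> carrier_vec n \<Longrightarrow> nrm (M *\<^sub>v x) \<le> \<epsilon> * nrm x" and x: "x \<in> carrier_vec K" for M x
    proof -
      have Rx: "R *\<^sub>v x \<in> carrier_vec n" using R x by simp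
      have "nrm (H * (adj F * M * R) *\<^sub>v x) = nrm (H *\<^sub>v (adj F *\<^sub>v (M *\<^sub>v (R *\<^sub>v x))))"
        using assoc_mult_mat_vec[OF H FER[OF M(1)] x] assoc_mult_mat_vec3[OF FH M(1) R(1) x] by simp
      also have "\<dots> \<le> 1 / g * nrm (adj F *\<^sub>v (M *\<^sub>v (R *\<^sub>v x)))"
        using FH M Rx by (intro Hb) (meson mult_mat_vec_carrier)
      also have "\<dots> \<le> 1 / g * (\<epsilon> * nrm x)"
        using adjF[of "M *\<^sub>v (R *\<^sub>v x)"] M(2)[OF Rx] R(2)[OF x] M(1) Rx g by (intro mult_left_mono) auto
      finally show ?thesis by (simp add: \<eta>_def g_def)
    qed
    have g1: "nrm (G1 *\<^sub>v x) \<le> \<eta> * nrm x" and g2: "nrm (G2 *\<^sub>v x) \<le> \<eta> * nrm x" if "x \<in> carrier_vec K" for x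
      unfolding G1_def G2_def using bound[OF E(1) \<epsilon>(1) that] bound[OF E(2) \<epsilon>(2) that] by blast+
    obtain r d where rd: "d \<noteq> 0" "\<And>x. det (x \<cdot>\<^sub>m (C + G1) - (Z * C + G2)) = d * (\<Prod>k<K. x - r k)"
      "\<And>k. k < K \<Longrightarrow> cmod (r k - z k) \<le> (2 * real K - 1) * (2 * \<eta> / (c - \<eta>))"
      by (rule pencil_matching[where z = z and K = K, folded Z_def, OF C G12 z1 arith(2,3) lowC g1 g2]) (assumption | (rule that, assumption+))+
    have compress: "H * (adj F * (V * M + E) * R) = M * R + H * (adj F * E * R)"
      if M: "M \<in> carrier_mat K n" and E: "E \<in> carrier_mat L n" for M E
    proof -
      have VM: "V * M \<in> carrier_mat L n" using V M by simp
      have MR: "M * R \<in> carrier_mat K K" using M R by simp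
      have "adj F * (V * M + E) * R = adj F * (V * M) * R + adj F * E * R"
        using mult_add_distrib_mat[OF FH VM E] add_mult_distrib_mat[OF _ _ R(1), of "adj F * (V * M)" K "adj F * E"]
          FH VM E by simp
      also have "adj F * (V * M) * R = T * (M * R)"
        unfolding T_def using assoc_mult_mat[OF FH V M] assoc_mult_mat[OF T M R(1)] by (simp add: T_def)
      finally have "H * (adj F * (V * M + E) * R) = H * (T * (M * R)) + H * (adj F * E * R)"
        using mult_add_distrib_mat[OF H _ FER[OF E], of "T * (M * R)"] T MR by simp
      also have "H * (T * (M * R)) = M * R"
        using assoc_mult_mat[OF H T MR, symmetric] unfolding HT left_mult_one_mat[OF MR] .
      finally show ?thesis .
    qed
    have ZB: "Z * B \<in> carrier_mat K n" using Z B by simp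
    have \<Psi>: "\<Psi>1 \<in> carrier_mat K K" "\<Psi>2 \<in> carrier_mat K K"
      unfolding \<Psi>1_def \<Psi>2_def X1 X2 F_def[symmetric] R_def[symmetric] using V ZB E VB by (auto intro!: FER)
    have H\<Psi>: "H * \<Psi>1 = C + G1" "H * \<Psi>2 = Z * C + G2"
      unfolding \<Psi>1_def \<Psi>2_def X1 X2 F_def[symmetric] R_def[symmetric] compress[OF B E(1)] compress[OF ZB E(2)]
      using assoc_mult_mat[OF Z B R(1)] by (simp_all add: C_def G1_def G2_def)
    obtain c0 where c0: "c0 \<noteq> 0"
      "pencil_poly \<Psi>1 \<Psi>2 = Polynomial.smult c0 (\<Prod>k\<in>{k. k < K \<and> zh k \<noteq> None}. [:- the (zh k), 1:])"
      using eigs by (auto simp: gen_eigs_def)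
    define J where "J = {k. k < K \<and> zh k \<noteq> None}"
    have J: "finite J" "J \<subseteq> {..<K}" by (auto simp: J_def)
    \<comment> \<open>\<open>pencil_poly\<close> is the determinant of the second matrix minus the
      scaled first one, opposite to the orientation used for the matching; hence the sign
      \<open>(-1) ^ K\<close>.\<close>
    have val: "d * (\<Prod>k<K. x - r k) = det H * (-1) ^ K * c0 * (\<Prod>k\<in>J. x - the (zh k))" for x
    proof -
      have p: "poly (pencil_poly \<Psi>1 \<Psi>2) x = det ((-1) \<cdot>\<^sub>m (x \<cdot>\<^sub>m \<Psi>1 - \<Psi>2))"
        unfolding pencil_poly_def
        by (rule poly_det_cong[of _ K]) (use \<Psi> in \<open>auto intro!: minus_carrier_mat simp: algebra_simps\<close>)
      have m: "x \<cdot>\<^sub>m \<Psi>1 - \<Psi>2 \<in> carrier_mat K K" using \<Psi>(2) by (rule minus_carrier_mat)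
      have "x \<cdot>\<^sub>m (C + G1) - (Z * C + G2) = H * (x \<cdot>\<^sub>m \<Psi>1 - \<Psi>2)"
        unfolding H\<Psi>[symmetric]
        using mult_minus_distrib_mat[OF H _ \<Psi>(2), of "x \<cdot>\<^sub>m \<Psi>1"] mult_smult_distrib[OF H \<Psi>(1), of x] \<Psi> by simp
      then have "d * (\<Prod>k<K. x - r k) = det H * det (x \<cdot>\<^sub>m \<Psi>1 - \<Psi>2)"
        using rd(2)[of x] det_mult[OF H m] by simp
      also have "det (x \<cdot>\<^sub>m \<Psi>1 - \<Psi>2) = (-1) ^ K * poly (pencil_poly \<Psi>1 \<Psi>2) x"
        unfolding p det_smult using carrier_matD(2)[OF m] by (simp add: mult.assoc[symmetric] power_mult_distrib[symmetric])
      finally show ?thesis by (simp add: c0(2)[folded J_def] poly_prod mult.assoc)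
    qed
    \<comment> \<open>The left-hand side has degree exactly \<open>K\<close>, so the finite
      generalized eigenvalues already exhaust all \<open>K\<close> indices and \<open>None\<close>
      does not occur.\<close>
    have JK: "J = {..<K}"
    proof -
      have "Polynomial.smult d (\<Prod>k<K. [:- r k, 1:]) = Polynomial.smult (det H * (-1) ^ K * c0) (\<Prod>k\<in>J. [:- the (zh k), 1:])"
        by (rule poly_ext) (simp only: poly_smult poly_prod, use val in simp)
      then have "degree (Polynomial.smult d (\<Prod>k<K. [:- r k, 1:])) = degree (Polynomial.smult (det H * (-1) ^ K * c0) (\<Prod>k\<in>J. [:- the (zh k), 1:]))"
        by simp
      then have "K = card J" using rd(1) detH c0(1) J by (simp add: degree_prod_eq_sum_degree)
      then show ?thesis using J by (metis card_lessThan card_subset_eq finite_lessThan)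
    qed
    have some: "zh k = Some (the (zh k))" if "k < K" for k
    proof -
      have "k \<in> J" using that by (simp add: JK)
      then show ?thesis by (simp add: J_def)
    qed
    have "image_mset r (mset_set {..<K}) = image_mset (\<lambda>k. the (zh k)) (mset_set {..<K})"
      by (rule prod_linear_eq_imp_mset_eq[OF rd(1) val[unfolded JK]])
    then obtain \<pi> where \<pi>: "\<pi> permutes {..<K}" "\<And>k. k < K \<Longrightarrow> r k = the (zh (\<pi> k))"
      using permutes_of_mset_eq by blast
    have "chordal (zh (\<pi> k)) (Some (z k)) \<le> (2 * real K - 1) * \<gamma> / sqrt (1 + (amin K z)\<^sup>2)
        * (2 * sqrt 2 / (1 - \<gamma>) * \<rho> + (1 + sqrt 2 * \<gamma> / (1 - \<gamma>)))" if k: "k < K" for k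
    proof -
      have "\<pi> k < K" using \<pi>(1) k by (metis lessThan_iff permutes_in_image)
      then have "chordal (zh (\<pi> k)) (Some (z k)) = chordal (Some (r k)) (Some (z k))" using some \<pi>(2)[OF k] by simp
      also have "\<dots> \<le> cmod (r k - z k) / sqrt (1 + (amin K z)\<^sup>2)"
        by (rule chordal_le_euclidean[OF A0 amin_le[OF k]])
      also have "\<dots> \<le> (2 * real K - 1) * (\<gamma> * (2 * sqrt 2 / (1 - \<gamma>) * \<rho> + (1 + sqrt 2 * \<gamma> / (1 - \<gamma>)))) / sqrt (1 + (amin K z)\<^sup>2)"
        using order_trans[OF rd(3)[OF k] mult_left_mono[OF arith(4)]] k1 by (intro divide_right_mono) auto
      finally show ?thesis by simp
    qed
    then show ?thesis using \<pi>(1) by blast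
  qed
  then show ?thesis by (simp add: \<rho>_def mult.assoc)
qed

text \<open>The guard \<open>Suc K \<le> L\<close> in the first half ensures that the shortened
  Vandermonde matrix in \<beta> still has at least \<open>K\<close> rows. Singular vectors are not
  unique, so both halves quantify over all decompositions; the factorization of
  \<open>char_poly\<close> records eigenvalues with algebraic multiplicity.\<close>

theorem theorem1:
  fixes K N L :: nat and z \<alpha> e :: "nat \<Rightarrow> complex"
  assumes K1: "1 \<le> K" and N2K: "2 * K \<le> N" and KL: "K \<le> L" and LNK: "L \<le> N - K"
    and z_inj: "inj_on z {..<K}"
    and z_nz: "\<forall>k<K. 0 < cmod (z k) \<and> cmod (z k) \<le> 1"
    and amin_pos: "amin K \<alpha> > 0"
  defines "xt \<equiv> \<lambda>n. (\<Sum>k<K. \<alpha> k * z k ^ n) + e n"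
    and "\<gamma>1 \<equiv> sqrt (real (min L (N - L + 1))) * vnorm N e /
               (amin K \<alpha> * sigma_min (vandermonde L K z) * sigma_min (vandermonde (N - L + 1) K z))"
    and "\<beta> \<equiv> sigma_max (vandermonde L K z) / sigma_min (vandermonde (L - 1) K z)"
    and "\<gamma>2 \<equiv> sqrt (real (min L (N - L))) * vnorm N e /
               (amin K \<alpha> * sigma_min (vandermonde L K z) * sigma_min (vandermonde (N - L) K z))"
  shows
   "(Suc K \<le> L \<longrightarrow>
      (\<forall>U S W \<Phi> zh.
         is_svd (hankel L N xt) U S W \<longrightarrow>
         \<Phi> = pinv (rows_down (first_cols K U)) * rows_up (first_cols K U) \<longrightarrow>
         rows_down (first_cols K U) * \<Phi> = rows_up (first_cols K U) \<longrightarrow>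
         \<gamma>1 < 1 / (1 + sqrt 2 * \<beta>) \<longrightarrow>
         char_poly \<Phi> = (\<Prod>k<K. [:- zh k, 1:]) \<longrightarrow>
         (\<exists>\<pi>. \<pi> permutes {..<K} \<and>
            (\<forall>k<K. cmod (zh (\<pi> k) - z k) \<le>
               (2 * real K - 1) * sqrt 2 * \<beta> * \<gamma>1 / (1 - (1 + sqrt 2 * \<beta>) * \<gamma>1)
               * (1 + kappa (vandermonde L K z)) * kappa (vandermonde L K z)))))
    \<and>
    (\<forall>U S W zh.
         is_svd (hankel L (N - 1) xt) U S W \<longrightarrow>
         regular_pair (adj (first_cols K U) * hankel L (N - 1) xt * first_cols K W)
                      (adj (first_cols K U) * hankel L (N - 1) (\<lambda>n. xt (n + 1)) * first_cols K W) \<longrightarrow>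
         gen_eigs K (adj (first_cols K U) * hankel L (N - 1) xt * first_cols K W)
                    (adj (first_cols K U) * hankel L (N - 1) (\<lambda>n. xt (n + 1)) * first_cols K W) zh \<longrightarrow>
         \<gamma>2 < 1 \<longrightarrow>
         (\<exists>\<pi>. \<pi> permutes {..<K} \<and>
            (\<forall>k<K. chordal (zh (\<pi> k)) (Some (z k)) \<le>
               (2 * real K - 1) * \<gamma>2 / sqrt (1 + (amin K z)\<^sup>2) *
               (2 * sqrt 2 / (1 - \<gamma>2) * (amax K \<alpha> / amin K \<alpha>)
                  * kappa (vandermonde L K z) * kappa (vandermonde (N - L) K z)
                + (1 + sqrt 2 * \<gamma>2 / (1 - \<gamma>2))))))"
proof (intro conjI impI allI)
  have dims: "K \<le> N - L" "K \<le> N - L + 1" "L + (N - L + 1) = N + 1" "L + (N - L) = N"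
    using K1 N2K KL LNK by auto
  have z1: "cmod (z k) \<le> 1" if "k < K" for k using z_nz that by blast
  have y: "xt i = (\<Sum>k<K. \<alpha> k * z k ^ i) + e i" for i by (simp add: xt_def)
  {
    fix U S W \<Phi> zh
    assume "Suc K \<le> L" and svd: "is_svd (hankel L N xt) U S W"
      and \<Phi>: "rows_down (first_cols K U) * \<Phi> = rows_up (first_cols K U)"
      and \<gamma>: "\<gamma>1 < 1 / (1 + sqrt 2 * \<beta>)"
      and cp: "char_poly \<Phi> = (\<Prod>k<K. [:- zh k, 1:])"
    \<comment> \<open>The dimensions of \<open>\<Phi>\<close> come from the hypotheses, since \<open>pinv\<close> is a \<open>THE\<close>-term.\<close>
    have "dim_col \<Phi> = K"
      using arg_cong[OF \<Phi>, of dim_col] by (simp add: rows_up_def first_cols_def)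
    moreover have "dim_row \<Phi> = dim_col \<Phi>"
    proof (rule ccontr)
      assume "dim_row \<Phi> \<noteq> dim_col \<Phi>"
      \<comment> \<open>\<open>det\<close> takes the default value 0 on a non-square matrix, whereas
        the factored polynomial is nonzero.\<close>
      then have "char_poly \<Phi> = 0" by (simp add: char_poly_def char_poly_matrix_def det_def)
      then show False using cp by simp
    qed
    ultimately have "\<Phi> \<in> carrier_mat K K" by auto
    then show "\<exists>\<pi>. \<pi> permutes {..<K} \<and> (\<forall>k<K. cmod (zh (\<pi> k) - z k) \<le>
               (2 * real K - 1) * sqrt 2 * \<beta> * \<gamma>1 / (1 - (1 + sqrt 2 * \<beta>) * \<gamma>1)
               * (1 + kappa (vandermonde L K z)) * kappa (vandermonde L K z))"
      using esprit_matching[OF K1 _ dims(2,3) z_inj z1 amin_pos y svd _ \<Phi> cp] \<gamma> \<open>Suc K \<le> L\<close>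
      unfolding \<gamma>1_def \<beta>_def by simp
  }
  {
    fix U S W zh
    assume svd: "is_svd (hankel L (N - 1) xt) U S W"
      and eigs: "gen_eigs K (adj (first_cols K U) * hankel L (N - 1) xt * first_cols K W)
                    (adj (first_cols K U) * hankel L (N - 1) (\<lambda>n. xt (n + 1)) * first_cols K W) zh"
      and \<gamma>: "\<gamma>2 < 1"
    show "\<exists>\<pi>. \<pi> permutes {..<K} \<and>
            (\<forall>k<K. chordal (zh (\<pi> k)) (Some (z k)) \<le>
               (2 * real K - 1) * \<gamma>2 / sqrt (1 + (amin K z)\<^sup>2) *
               (2 * sqrt 2 / (1 - \<gamma>2) * (amax K \<alpha> / amin K \<alpha>)
                  * kappa (vandermonde L K z) * kappa (vandermonde (N - L) K z)
                + (1 + sqrt 2 * \<gamma>2 / (1 - \<gamma>2))))"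
      using matrix_pencil_matching[OF K1 KL dims(1,4) z_inj z1 amin_pos y svd eigs] \<gamma>
      unfolding \<gamma>2_def by blast
  }
qed

end
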